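(* For every integer $k\ge0$ and $N\in\{14,15\}$, $|L_N(k)|=T_N(k)+\mathcal E_N(k)$, where $$T_{14}(k)=\frac{(k+1)\left(324k^6+1944k^5+4482k^4+4968k^3+2788k^2+824k+105\right)}{315},$$ $$T_{15}(k)=\frac{(k+1)(2k+1)(2k+3)\left(512k^4+2048k^3+2584k^2+1072k+105\right)}{1260},$$ $$\mathcal E_{14}(k)=\begin{cases}\dfrac{2(k+3)}9,&k\equiv0,3\pmod6,\\[2mm]\dfrac{2(k-1)}9,&k\equiv1,4\pmod6,\\[2mm]-\dfrac{4(k+1)}9,&k\equiv2,5\pmod6,\end{cases}\qquad \mathcal E_{15}(k)=\begin{cases}\dfrac{k+3}4,&k\equiv0\pmod4,\\[2mm]-\dfrac{k+1}4,&k\equiv1,3\pmod4,\\[2mm]\dfrac{k-1}4,&k\equiv2\pmod4.\end{cases}$$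
   Context: Notation: $q=e^{2\pi i\tau}$, $\operatorname{Im}\tau>0$; $(x_1,\dots,x_s;q)_\infty=\prod_{i=1}^s\prod_{n\ge0}(1-x_iq^n)$. For $N\ge5$ put $m=\lfloor N/2\rfloor$. For an even integer $a_0\ge0$ and $\mathbf a=(a_1,\dots,a_m)\in\mathbb Z^m$, $$f^{(N)}_{\mathbf a}(\tau)=q^{\frac N{24}S_1-\frac1{2N}S_2}(q^N;q^N)_\infty^{a_0}\prod_{j=1}^m(q^j,q^{N-j};q^N)_\infty^{a_j},\quad S_1=a_0+2\sum_{j=1}^m a_j,\quad S_2=\sum_{j=1}^m j(N-j)a_j.$$ For an integer $k\ge0$, $L_N(k)$ is the set of all $\mathbf a\in\mathbb Z^m$ such that, with $a_0=2k$, $f^{(N)}_{\mathbf a}\in M_k(\Gamma_1(N))$, the space of holomorphic modular forms of weight $k$ on $\Gamma_1(N)=\{\begin{pmatrix}a&b\\c&d\end{pmatrix}\in\mathrm{SL}_2(\mathbb Z):a\equiv d\equiv1,\ c\equiv0\pmod N\}$. Here $N\in\{14,15\}$, $m=7$. *)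

theory Defs
  imports "HOL-Complex_Analysis.Complex_Analysis" "HOL-Number_Theory.Cong"
begin

abbreviation upper_half_plane :: "complex set" where
  "upper_half_plane \<equiv> {\<tau>. Im \<tau> > 0}"

definition SL2Z :: "(int ^ 2 ^ 2) set" where
  "SL2Z = {A. det A = 1}"

definition Gamma1 :: "nat \<Rightarrow> (int ^ 2 ^ 2) set" where
  "Gamma1 N = {A \<in> SL2Z. [A $ 1 $ 1 = 1] (mod int N) \<and> [A $ 2 $ 2 = 1] (mod int N) \<and>
                          [A $ 2 $ 1 = 0] (mod int N)}"

definition act :: "int ^ 2 ^ 2 \<Rightarrow> complex \<Rightarrow> complex" where
  "act A = moebius (of_int (A $ 1 $ 1)) (of_int (A $ 1 $ 2))
                   (of_int (A $ 2 $ 1)) (of_int (A $ 2 $ 2))"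

definition slash :: "nat \<Rightarrow> (complex \<Rightarrow> complex) \<Rightarrow> int ^ 2 ^ 2 \<Rightarrow> complex \<Rightarrow> complex" where
  "slash k f A \<tau> = f (act A \<tau>) / (of_int (A $ 2 $ 1) * \<tau> + of_int (A $ 2 $ 2)) ^ k"

text \<open>Holomorphy at \<open>\<infinity>\<close> of an \<open>h\<close>-periodic function on the upper half plane: it is a
  holomorphic function on the unit disc in the variable \<open>exp (2 \<pi> i \<tau> / h)\<close>, i.e. it has a
  Fourier expansion without negative exponents. The \<open>h\<close>-periodicity is implied.\<close>

definition holomorphic_at_infinity :: "nat \<Rightarrow> (complex \<Rightarrow> complex) \<Rightarrow> bool" where
  "holomorphic_at_infinity h f \<longleftrightarrow>
     (\<exists>g. g holomorphic_on ball 0 1 \<and>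
          (\<forall>\<tau>\<in>upper_half_plane. f \<tau> = g (exp (2 * of_real pi * \<i> * \<tau> / of_nat h))))"

text \<open>Holomorphy at all cusps is required through all translates under the full modular group.
  A translate of a form that is invariant under \<open>Gamma1 N\<close> is invariant under the principal
  congruence subgroup of level \<open>N\<close> (a normal subgroup of the full modular group contained in
  \<open>Gamma1 N\<close>), hence \<open>N\<close>-periodic, so the local variable with \<open>h = N\<close> can be used at
  every cusp, whatever its width. A modular form is a function on the upper half plane only; the
  values of \<open>f\<close> elsewhere are irrelevant.\<close>

definition modular_form_Gamma1 :: "nat \<Rightarrow> nat \<Rightarrow> (complex \<Rightarrow> complex) \<Rightarrow> bool" where
  "modular_form_Gamma1 k N f \<longleftrightarrow>
     f holomorphic_on upper_half_plane \<and>
     (\<forall>A\<in>Gamma1 N. \<forall>\<tau>\<in>upper_half_plane. slash k f A \<tau> = f \<tau>) \<and>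
     (\<forall>A\<in>SL2Z. holomorphic_at_infinity N (slash k f A))"

definition qpochhammer_inf :: "complex \<Rightarrow> complex \<Rightarrow> complex" where
  "qpochhammer_inf x q = (\<Prod>n. 1 - x * q ^ n)"

text \<open>For even \<open>N\<close> and \<open>j = N div 2\<close> both Pochhammer symbols below coincide, and the factor
  occurs squared, as in the formula it renders.\<close>

definition theta_quotient :: "nat \<Rightarrow> nat \<Rightarrow> (nat \<Rightarrow> int) \<Rightarrow> complex \<Rightarrow> complex" where
  "theta_quotient N a0 a \<tau> =
     (let m = N div 2;
          q = exp (2 * of_real pi * \<i> * \<tau>);
          S1 = int a0 + 2 * (\<Sum>j=1..m. a j);
          S2 = (\<Sum>j=1..m. int j * int (N - j) * a j)
      in exp (2 * of_real pi * \<i> * \<tau> *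
              (of_nat N / 24 * of_int S1 - 1 / (2 * of_nat N) * of_int S2)) *
         qpochhammer_inf (q ^ N) (q ^ N) ^ a0 *
         (\<Prod>j=1..m. (qpochhammer_inf (q ^ j) (q ^ N) *
                     qpochhammer_inf (q ^ (N - j)) (q ^ N)) powi a j))"

text \<open>Vectors in \<open>\<int>\<^sup>m\<close> with \<open>m = N div 2\<close> are functions on \<open>{1..m}\<close>, extended by
  \<^term>\<open>undefined\<close> outside, so that each vector is represented exactly once.\<close>

definition L :: "nat \<Rightarrow> nat \<Rightarrow> (nat \<Rightarrow> int) set" where
  "L N k = {a \<in> {1..N div 2} \<rightarrow>\<^sub>E UNIV. modular_form_Gamma1 k N (theta_quotient N (2 * k) a)}"

definition T14 :: "nat \<Rightarrow> real" where
  "T14 k = (let k = real k in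
     (k + 1) * (324 * k^6 + 1944 * k^5 + 4482 * k^4 + 4968 * k^3 + 2788 * k^2 + 824 * k + 105)
       / 315)"

definition T15 :: "nat \<Rightarrow> real" where
  "T15 k = (let k = real k in
     (k + 1) * (2 * k + 1) * (2 * k + 3) *
       (512 * k^4 + 2048 * k^3 + 2584 * k^2 + 1072 * k + 105) / 1260)"

definition E14 :: "nat \<Rightarrow> real" where
  "E14 k =
     (if k mod 6 \<in> {0, 3} then 2 * (real k + 3) / 9
      else if k mod 6 \<in> {1, 4} then 2 * (real k - 1) / 9
      else - (4 * (real k + 1) / 9))"

definition E15 :: "nat \<Rightarrow> real" where
  "E15 k =
     (if k mod 4 = 0 then (real k + 3) / 4
      else if k mod 4 \<in> {1, 3} then - ((real k + 1) / 4)
      else (real k - 1) / 4)"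

end

theory Submission
  imports Defs
begin

text \<open>Write \<open>q = e(\<tau>)\<close> with \<open>e(x) = exp (2 \<pi> i x)\<close>. The infinite products in the theta
  quotient are, up to elementary factors, theta functions of the argument \<open>j \<tau>\<close> for the lattice
  spanned by \<open>N \<tau>\<close> and \<open>1\<close>. Normalised suitably, that is, turned into Klein forms
  (\<open>klein\<close>), they transform under the full modular group without any multiplier: the quotient of the two
  sides of the transformation law is an elliptic function without poles, so that Liouville's theorem applies
  (\<open>quasi_periodic_unique\<close>, \<open>theta_modular\<close>, \<open>klein_modular\<close>). The discriminant
  \<open>\<Delta>\<close> is treated in the same way, since it is a constant multiple of the inverse fourth power of
  the product of the three Klein forms of order two, which the modular group permutes (\<open>Delta_modular\<close>).
  If the integer \<open>k + (a\<^sub>1 + \<dots> + a\<^sub>m)\<close> equals \<open>12 D\<close>, the theta quotient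
  with \<open>a\<^sub>0 = 2 k\<close> is exactly the product of \<open>\<Delta> (N \<tau>) ^ D\<close> and of the
  powers with exponents \<open>a\<^sub>j\<close> of the Klein forms of \<open>(j/N, 0)\<close> at \<open>N
  \<tau>\<close>.

  This makes the behaviour of the theta quotient at all cusps explicit. It is a modular form of weight
  \<open>k\<close> if and only if \<open>12\<close> divides \<open>k + (a\<^sub>1 + \<dots> + a\<^sub>m)\<close>, an
  explicit character of \<open>\<Gamma>\<^sub>1(N)\<close> is trivial, and the orders at all cusps are natural numbers
  (\<open>modular_form_theta_quotient_iff\<close>). The necessity of the first condition follows from the cusp
  \<open>0\<close>, where the twelfth power of a form that is holomorphic there has an order divisible by
  \<open>12\<close>. For \<open>N = 14\<close> the character is trivial if and only if \<open>a\<^sub>1 + 2 a\<^sub>2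
  + \<dots> + 7 a\<^sub>7\<close> is even and \<open>a\<^sub>1 + 4 a\<^sub>2 + \<dots> + 49 a\<^sub>7\<close> is
  divisible by \<open>28\<close>; for \<open>N = 15\<close> it is if and only if the second number is divisible by
  \<open>15\<close>.

  The order at a cusp \<open>a/c\<close> depends only on \<open>e = gcd N c\<close> and on \<open>a\<close> modulo
  \<open>e\<close> up to sign. There are eight such classes at both levels, and the vector of the eight orders
  determines the exponents. The exponent vectors are thus in bijection with the vectors of natural numbers that
  satisfy a linear equation (the valence formula) and certain congruences: for \<open>N = 14\<close> the equation
  \<open>3 A + 3 B + C1 + C2 + C3 + E1 + E2 + E3 = 6 k\<close> and one congruence modulo \<open>2\<close> and one
  modulo \<open>3\<close> (\<open>solutions14\<close>), for \<open>N = 15\<close> the equation \<open>4 A + 4 B + 2 C1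
  + 2 C2 + E1 + E2 + E3 + E4 = 8 k\<close> and one congruence modulo \<open>4\<close> (\<open>solutions15\<close>).

  The indicator function of the congruences is an average of characters of a cyclic group of order \<open>6\<close> or
  \<open>4\<close>, and the sum of a character over the solutions of the equation is a coefficient of a product of
  eight series \<open>1 / (1 - \<eta> X\<^sup>w)\<close>. The main terms come from the characters that give rise to
  poles of high order: \<open>T\<^sub>1\<^sub>4\<close> is the contribution of the trivial and of the quadratic
  character, and the characters of order \<open>3\<close> and \<open>6\<close> sum up to
  \<open>E\<^sub>1\<^sub>4\<close>; \<open>T\<^sub>1\<^sub>5\<close> is the contribution of the trivial character, and
  the three other ones sum up to \<open>E\<^sub>1\<^sub>5\<close>.\<close>

section \<open>The infinite product\<close>

lemma qpoch_summable:
  fixes x q :: complex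
  assumes "norm q < 1"
  shows "summable (\<lambda>n. norm ((1 - x * q ^ n) - 1))"
proof -
  have "(\<lambda>n. norm ((1 - x * q ^ n) - 1)) = (\<lambda>n. norm x * norm q ^ n)"
    by (simp add: norm_mult norm_power)
  thus ?thesis using assms by (simp add: summable_mult summable_geometric)
qed

lemma qpoch_convergent_prod:
  fixes x q :: complex
  assumes "norm q < 1"
  shows "convergent_prod (\<lambda>n. 1 - x * q ^ n)"
  by (intro abs_convergent_prod_imp_convergent_prod summable_imp_abs_convergent_prod
      qpoch_summable assms)

lemma qpoch_Suc:
  assumes "norm q < 1"
  shows "qpochhammer_inf x q = (1 - x) * qpochhammer_inf (x * q) q"
proof -
  have "(\<lambda>n. 1 - x * q ^ n) has_prod
          ((\<Prod>k<1. 1 - x * q ^ k) * (\<Prod>k. 1 - x * q ^ (k + 1)))"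
    by (rule has_prod_ignore_initial_segment'[OF qpoch_convergent_prod[OF assms]])
  from has_prod_unique[OF this] show ?thesis
    by (simp add: qpochhammer_inf_def mult.assoc)
qed

lemma qpoch_eq_0_iff:
  assumes "norm q < 1"
  shows "qpochhammer_inf x q = 0 \<longleftrightarrow> (\<exists>n. x * q ^ n = 1)"
proof -
  have "(\<lambda>n. 1 - x * q ^ n) has_prod qpochhammer_inf x q"
    unfolding qpochhammer_inf_def using qpoch_convergent_prod[OF assms] by (rule convergent_prod_has_prod)
  from has_prod_eq_0_iff[OF this]
  have "qpochhammer_inf x q = 0 \<longleftrightarrow> (\<exists>n. 0 = 1 - x * q ^ n)"
    by (simp add: image_iff)
  also have "\<dots> \<longleftrightarrow> (\<exists>n. x * q ^ n = 1)"
    by (simp add: eq_commute[of 0] eq_commute[of 1])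
  finally show ?thesis .
qed

lemma qpoch_self_nonzero:
  assumes "norm q < 1"
  shows "qpochhammer_inf q q \<noteq> 0"
proof
  assume "qpochhammer_inf q q = 0"
  then obtain n where "q ^ Suc n = 1" unfolding qpoch_eq_0_iff[OF assms] power_Suc ..
  hence "norm q ^ Suc n = 1" unfolding norm_power[symmetric] by simp
  moreover have "norm q ^ Suc n \<le> norm q"
    using power_decreasing[of 1 "Suc n" "norm q"] assms by simp
  ultimately show False using assms by linarith
qed

lemma qpoch_LIMSEQ:
  assumes "norm q < 1"
  shows "(\<lambda>N. \<Prod>n<N. 1 - x * q ^ n) \<longlonglongrightarrow> qpochhammer_inf x q"
proof -
  have "(\<lambda>N. \<Prod>n\<le>N. 1 - x * q ^ n) \<longlonglongrightarrow> qpochhammer_inf x q"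
    unfolding qpochhammer_inf_def by (intro convergent_prod_LIMSEQ qpoch_convergent_prod assms)
  then have "(\<lambda>N. \<Prod>n<Suc N. 1 - x * q ^ n) \<longlonglongrightarrow> qpochhammer_inf x q"
    by (simp add: lessThan_Suc_atMost)
  then show ?thesis by (rule filterlim_sequentially_Suc[THEN iffD1])
qed

lemma holomorphic_on_qpoch:
  assumes S: "open S" and f: "f holomorphic_on S" and g: "g holomorphic_on S"
    and g1: "\<And>x. x \<in> S \<Longrightarrow> norm (g x) < 1"
  shows "(\<lambda>x. qpochhammer_inf (f x) (g x)) holomorphic_on S"
proof (rule holomorphic_uniform_sequence[OF S])
  show "(\<lambda>x. \<Prod>n<N. 1 - f x * g x ^ n) holomorphic_on S" for N
    by (intro holomorphic_intros f g)
  fix x assume x: "x \<in> S"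
  obtain d where d: "d > 0" "cball x d \<subseteq> S"
    using S x open_contains_cball by blast
  have cf: "continuous_on (cball x d) f" and cg: "continuous_on (cball x d) g"
    using f g d holomorphic_on_imp_continuous_on continuous_on_subset by blast+
  have "compact (f ` cball x d)" using cf compact_continuous_image compact_cball by blast
  then obtain C where C: "\<And>y. y \<in> cball x d \<Longrightarrow> norm (f y) \<le> C"
    using compact_imp_bounded bounded_iff by (metis imageI)
  have cng: "continuous_on (cball x d) (\<lambda>y. norm (g y))" using cg by (intro continuous_intros)
  obtain z where z: "z \<in> cball x d" "\<And>y. y \<in> cball x d \<Longrightarrow> norm (g y) \<le> norm (g z)"
    using continuous_attains_sup[OF compact_cball _ cng] d by fastforce
  define r where "r = norm (g z)"
  have r: "0 \<le> r" "r < 1" using g1 z d by (auto simp: r_def)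
  have "uniformly_convergent_on (cball x d) (\<lambda>N y. \<Sum>n<N. norm ((1 - f y * g y ^ n) - 1))"
  proof (rule Weierstrass_m_test')
    fix n y assume y: "y \<in> cball x d"
    show "norm (norm ((1 - f y * g y ^ n) - 1)) \<le> C * r ^ n"
      using C[OF y] z(2)[OF y] r by (auto simp: norm_mult norm_power r_def intro!: mult_mono power_mono intro: order_trans[OF norm_ge_zero])
  qed (use r in \<open>auto intro!: summable_mult summable_geometric\<close>)
  hence "uniformly_convergent_on (cball x d) (\<lambda>N y. \<Prod>n<N. 1 - f y * g y ^ n)"
    by (intro uniformly_convergent_on_prod' compact_cball) (auto intro!: continuous_intros cf cg)
  then obtain h where h: "uniform_limit (cball x d) (\<lambda>N y. \<Prod>n<N. 1 - f y * g y ^ n) h sequentially"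
    by (auto simp: uniformly_convergent_on_def)
  have "h y = qpochhammer_inf (f y) (g y)" if y: "y \<in> cball x d" for y
  proof -
    have "(\<lambda>N. \<Prod>n<N. 1 - f y * g y ^ n) \<longlonglongrightarrow> h y"
      using tendsto_uniform_limitI[OF h y] .
    moreover have "norm (g y) < 1" using y d g1 by blast
    then have "(\<lambda>N. \<Prod>n<N. 1 - f y * g y ^ n) \<longlonglongrightarrow> qpochhammer_inf (f y) (g y)"
      by (rule qpoch_LIMSEQ)
    ultimately show ?thesis using LIMSEQ_unique by blast
  qed
  hence ul: "uniform_limit (cball x d) (\<lambda>N y. \<Prod>n<N. 1 - f y * g y ^ n) (\<lambda>y. qpochhammer_inf (f y) (g y)) sequentially"
    using h uniform_limit_cong'[of "cball x d" "\<lambda>N y. \<Prod>n<N. 1 - f y * g y ^ n" "\<lambda>N y. \<Prod>n<N. 1 - f y * g y ^ n"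
        h "\<lambda>y. qpochhammer_inf (f y) (g y)" sequentially] by simp
  show "\<exists>d>0. cball x d \<subseteq> S \<and> uniform_limit (cball x d) (\<lambda>N y. \<Prod>n<N. 1 - f y * g y ^ n)
          (\<lambda>y. qpochhammer_inf (f y) (g y)) sequentially"
    by (rule exI[of _ d]) (intro conjI d ul)
qed

lemma holomorphic_on_qpoch_compose [holomorphic_intros]:
  assumes f: "f holomorphic_on S" and q: "norm q < 1"
  shows "(\<lambda>x. qpochhammer_inf (f x) q) holomorphic_on S"
proof -
  have "(\<lambda>x. qpochhammer_inf x q) holomorphic_on UNIV"
    by (rule holomorphic_on_qpoch) (use q in \<open>auto intro!: holomorphic_intros\<close>)
  from holomorphic_on_compose_gen[OF f this] show ?thesis by (simp add: o_def)
qed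

text \<open>A product identity for the two square roots of the argument, and the resulting one for the nome: \<open>(x; q)(-x; q)
  = (x\<^sup>2; q\<^sup>2)\<close> and \<open>(x; q\<^sup>2)(x q; q\<^sup>2) = (x; q)\<close>.\<close>

lemma qpoch_mult_minus:
  assumes "norm q < 1"
  shows "qpochhammer_inf x q * qpochhammer_inf (- x) q = qpochhammer_inf (x\<^sup>2) (q\<^sup>2)"
proof -
  have "(1 - x * q ^ n) * (1 - (- x) * q ^ n) = 1 - x\<^sup>2 * (q\<^sup>2) ^ n" for n
    by (simp add: algebra_simps power2_eq_square flip: power_mult_distrib)
  thus ?thesis unfolding qpochhammer_inf_def
    using prodinf_mult[OF qpoch_convergent_prod[OF assms, of x] qpoch_convergent_prod[OF assms, of "- x"]]
    by simp
qed

lemma qpoch_even_odd: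
  assumes "norm q < 1"
  shows "qpochhammer_inf x (q\<^sup>2) * qpochhammer_inf (x * q) (q\<^sup>2) = qpochhammer_inf x q"
proof -
  have q2: "norm (q\<^sup>2) < 1"
    unfolding power2_eq_square norm_mult using mult_strict_mono'[OF assms assms] by simp
  have split: "(\<Prod>n<2 * N. 1 - x * q ^ n)
      = (\<Prod>n<N. 1 - x * (q\<^sup>2) ^ n) * (\<Prod>n<N. 1 - x * q * (q\<^sup>2) ^ n)" for N
  proof (induction N)
    case (Suc N)
    have "(\<Prod>n<2 * Suc N. 1 - x * q ^ n)
        = (\<Prod>n<2 * N. 1 - x * q ^ n) * ((1 - x * (q\<^sup>2) ^ N) * (1 - x * q * (q\<^sup>2) ^ N))"
      by (simp add: mult.assoc flip: power_mult)
    thus ?case unfolding Suc.IH prod.lessThan_Suc by (simp only: mult_ac)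
  qed simp
  have "(\<lambda>N. \<Prod>n<2 * N. 1 - x * q ^ n) \<longlonglongrightarrow> qpochhammer_inf x q"
    using LIMSEQ_subseq_LIMSEQ[OF qpoch_LIMSEQ[OF assms], of "\<lambda>N. 2 * N"]
    by (simp add: o_def strict_mono_def)
  moreover have "(\<lambda>N. \<Prod>n<2 * N. 1 - x * q ^ n) \<longlonglongrightarrow>
     qpochhammer_inf x (q\<^sup>2) * qpochhammer_inf (x * q) (q\<^sup>2)"
    unfolding split by (intro tendsto_mult qpoch_LIMSEQ q2)
  ultimately show ?thesis using LIMSEQ_unique by blast
qed

section \<open>The exponential\<close>

text \<open>The function \<open>e(x) = exp (2 \<pi> i x)\<close>.\<close>

definition ee :: "complex \<Rightarrow> complex" where "ee x = exp (2 * of_real pi * \<i> * x)"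

lemma ee_add: "ee (x + y) = ee x * ee y"
  by (simp add: ee_def distrib_left exp_add)

lemma ee_0 [simp]: "ee 0 = 1" by (simp add: ee_def)

lemma ee_nonzero [simp]: "ee x \<noteq> 0" by (simp add: ee_def)

lemma ee_minus: "ee (- x) = inverse (ee x)" by (simp add: ee_def exp_minus)

lemma ee_diff: "ee (x - y) = ee x / ee y"
  by (simp add: ee_def right_diff_distrib exp_diff)

lemma ee_of_nat_mult: "ee (of_nat n * x) = ee x ^ n"
  by (simp add: ee_def mult.left_commute flip: exp_of_nat_mult)

lemma ee_of_int_mult: "ee (of_int n * x) = ee x powi n"
  by (simp add: ee_def exp_power_int mult.left_commute)

lemma ee_eq_1_iff: "ee x = 1 \<longleftrightarrow> (\<exists>n::int. x = of_int n)"
proof -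
  have "ee x = 1 \<longleftrightarrow> Im x = 0 \<and> (\<exists>n::int. Re x = of_int n)"
    unfolding ee_def exp_eq_1 by (auto simp: field_simps)
  also have "\<dots> \<longleftrightarrow> (\<exists>n::int. x = of_int n)"
    by (auto simp: complex_eq_iff)
  finally show ?thesis .
qed

lemma ee_of_int [simp]: "ee (of_int n) = 1" using ee_eq_1_iff by blast

lemma ee_of_nat [simp]: "ee (of_nat n) = 1" using ee_of_int[of "int n"] by (simp del: ee_of_int)

lemma ee_1 [simp]: "ee 1 = 1" using ee_of_int[of 1] by (simp del: ee_of_int)

lemma ee_half: "ee (1 / 2) = - 1"
  by (simp add: ee_def exp_pi_i)

lemma norm_ee: "norm (ee x) = exp (- 2 * pi * Im x)"
  by (simp add: ee_def norm_exp_eq_Re)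

lemma norm_ee_less_1: "Im t > 0 \<Longrightarrow> norm (ee t) < 1"
  by (simp add: norm_ee)

lemma holomorphic_on_ee [holomorphic_intros]:
  "f holomorphic_on S \<Longrightarrow> (\<lambda>x. ee (f x)) holomorphic_on S"
  unfolding ee_def by (intro holomorphic_intros)

lemma ee_has_field_derivative: "(ee has_field_derivative 2 * of_real pi * \<i> * ee x) (at x)"
  unfolding ee_def by (auto intro!: derivative_eq_intros)

section \<open>The theta function\<close>

text \<open>The odd theta function, as an infinite product in \<open>w = e(z)\<close> and \<open>q = e(t)\<close>, normalised so
  that its derivative at \<open>z = 0\<close> is \<open>- 2 \<pi> i\<close>: it equals
  \<open>w\<^sup>-\<^sup>1\<^sup>/\<^sup>2 (w; q) (q/w; q) / (q; q)\<^sup>2\<close>.\<close>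

definition theta :: "complex \<Rightarrow> complex \<Rightarrow> complex" where
  "theta z t = ee (- z / 2) * qpochhammer_inf (ee z) (ee t) * qpochhammer_inf (ee (t - z)) (ee t)
                 / qpochhammer_inf (ee t) (ee t) ^ 2"

lemma holomorphic_on_theta [holomorphic_intros]:
  assumes "Im t > 0" "f holomorphic_on S"
  shows "(\<lambda>z. theta (f z) t) holomorphic_on S"
  unfolding theta_def using norm_ee_less_1[OF assms(1)]
  by (intro holomorphic_intros assms) (auto simp: qpoch_self_nonzero)

lemma theta_plus_1: "theta (z + 1) t = - theta z t"
proof -
  have "ee (t - (z + 1)) = ee (t - z)"
    using ee_diff[of "t - z" 1] by (simp add: algebra_simps)
  moreover have "ee (- (z + 1) / 2) = - ee (- z / 2)"
  proof -
    have eq: "- (z + 1) / 2 = - z / 2 - 1 / 2" by (simp add: field_simps)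
    show ?thesis unfolding eq ee_diff ee_half by simp
  qed
  ultimately show ?thesis by (simp add: theta_def ee_add)
qed

lemma theta_plus_tau:
  assumes "Im t > 0"
  shows "theta (z + t) t = - ee (- t / 2 - z) * theta z t"
proof -
  define Q where "Q = qpochhammer_inf (ee t) (ee t) ^ 2"
  note q1 = norm_ee_less_1[OF assms]
  have A: "qpochhammer_inf (ee z) (ee t) = (1 - ee z) * qpochhammer_inf (ee z * ee t) (ee t)"
    by (rule qpoch_Suc[OF q1])
  have "qpochhammer_inf (ee (- z)) (ee t) = (1 - ee (- z)) * qpochhammer_inf (ee (- z) * ee t) (ee t)"
    by (rule qpoch_Suc[OF q1])
  hence B: "qpochhammer_inf (ee (t - (z + t))) (ee t) = (1 - ee (- z)) * qpochhammer_inf (ee (t - z)) (ee t)"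
    by (simp add: ee_add[symmetric])
  have C: "1 - ee (- z) = - ee (- z) * (1 - ee z)"
    by (simp add: ee_minus field_simps)
  have D: "ee (- (z + t) / 2) = ee (- z / 2) * ee (- t / 2)"
    unfolding ee_add[symmetric] by (rule arg_cong[where f = ee]) (simp add: field_simps)
  have E: "ee (- t / 2 - z) = ee (- t / 2) * ee (- z)"
    by (simp add: ee_add[symmetric])
  show ?thesis
    unfolding theta_def B C D E A Q_def[symmetric] ee_add[of z t] by simp
qed

lemma theta_0 [simp]: "Im t > 0 \<Longrightarrow> theta 0 t = 0"
  using qpoch_Suc[OF norm_ee_less_1, of t 1] by (simp add: theta_def)

text \<open>The transformation law of a function with the quasi-periods of the theta function under the whole lattice.\<close>

lemma quasi_periodic_lattice:
  fixes F :: "complex \<Rightarrow> complex"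
  assumes F1: "\<And>z. F (z + 1) = - F z" and Ft: "\<And>z. F (z + t) = - ee (- t / 2 - z) * F z"
  shows "F (z + of_int m * t + of_int n)
           = ee ((of_int (m + n) - of_int (m * m) * t) / 2 - of_int m * z) * F z"
proof -
  have neg: "ee (x + 1 / 2) = - ee x" "ee (x - 1 / 2) = - ee x" for x
    using ee_half by (simp_all add: ee_add ee_diff)
  have N: "F (z + of_int n) = ee (of_int n / 2) * F z" for z and n :: int
  proof (induction n rule: int_induct[where k = 0])
    case (step1 i)
    have "F (z + of_int (i + 1)) = - F (z + of_int i)"
      using F1[of "z + of_int i"] by (simp add: algebra_simps)
    also have "\<dots> = - ee (of_int i / 2) * F z" by (simp add: step1)
    also have "- ee (of_int i / 2) = ee (of_int (i + 1) / 2)"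
      using neg(1)[of "of_int i / 2"] by (simp add: add_divide_distrib)
    finally show ?case .
  next
    case (step2 i)
    have "F (z + of_int (i - 1)) = - F (z + of_int i)"
      using F1[of "z + of_int (i - 1)"] by (simp add: algebra_simps)
    also have "\<dots> = - ee (of_int i / 2) * F z" by (simp add: step2)
    also have "- ee (of_int i / 2) = ee (of_int (i - 1) / 2)"
      using neg(2)[of "of_int i / 2"] by (simp add: diff_divide_distrib)
    finally show ?case .
  qed simp
  have M: "F (z + of_int m * t) = ee ((of_int m - of_int (m * m) * t) / 2 - of_int m * z) * F z" for m :: int
  proof (induction m rule: int_induct[where k = 0])
    case (step1 i)
    have "F (z + of_int (i + 1) * t) = - ee (- t / 2 - (z + of_int i * t)) * F (z + of_int i * t)"
      using Ft[of "z + of_int i * t"] by (simp add: algebra_simps)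
    also have "\<dots> = - (ee (- t / 2 - (z + of_int i * t)) * ee ((of_int i - of_int (i * i) * t) / 2 - of_int i * z)) * F z"
      by (simp add: step1)
    also have "- (ee (- t / 2 - (z + of_int i * t)) * ee ((of_int i - of_int (i * i) * t) / 2 - of_int i * z))
       = ee ((of_int (i + 1) - of_int ((i + 1) * (i + 1)) * t) / 2 - of_int (i + 1) * z)"
      unfolding ee_add[symmetric] neg(1)[symmetric]
      by (rule arg_cong[where f = ee]) (simp add: field_simps)
    finally show ?case .
  next
    case (step2 i)
    define w where "w = z + of_int (i - 1) * t"
    have "F (w + t) = - ee (- t / 2 - w) * F w" by (rule Ft)
    moreover have "ee (t / 2 + w) * ee (- t / 2 - w) = 1"
      by (simp flip: ee_add)
    ultimately have "F w = - ee (t / 2 + w) * F (w + t)"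
      by simp
    also have "w + t = z + of_int i * t" by (simp add: w_def algebra_simps)
    also have "- ee (t / 2 + w) * F (z + of_int i * t)
      = - (ee (t / 2 + w) * ee ((of_int i - of_int (i * i) * t) / 2 - of_int i * z)) * F z"
      by (simp add: step2)
    also have "- (ee (t / 2 + w) * ee ((of_int i - of_int (i * i) * t) / 2 - of_int i * z))
       = ee ((of_int (i - 1) - of_int ((i - 1) * (i - 1)) * t) / 2 - of_int (i - 1) * z)"
      unfolding ee_add[symmetric] neg(2)[symmetric]
      by (rule arg_cong[where f = ee]) (simp add: w_def field_simps)
    finally show ?case by (simp add: w_def)
  qed simp
  have "F (z + of_int m * t + of_int n)
     = (ee (of_int n / 2) * ee ((of_int m - of_int (m * m) * t) / 2 - of_int m * z)) * F z"
    by (simp add: N M)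
  also have "ee (of_int n / 2) * ee ((of_int m - of_int (m * m) * t) / 2 - of_int m * z)
     = ee ((of_int (m + n) - of_int (m * m) * t) / 2 - of_int m * z)"
    unfolding ee_add[symmetric] by (rule arg_cong[where f = ee]) (simp add: field_simps)
  finally show ?thesis .
qed

lemmas theta_lattice = quasi_periodic_lattice[OF theta_plus_1 theta_plus_tau]

text \<open>The zeros of the theta function are the points of the lattice spanned by \<open>t\<close> and \<open>1\<close>.\<close>

lemma theta_eq_0_iff:
  assumes "Im t > 0"
  shows "theta z t = 0 \<longleftrightarrow> (\<exists>m n::int. z = of_int m * t + of_int n)"
proof
  assume "\<exists>m n::int. z = of_int m * t + of_int n"
  then obtain m n :: int where "z = of_int m * t + of_int n" by blast
  thus "theta z t = 0" using theta_lattice[OF assms, of 0 m n] assms by simp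
next
  note q1 = norm_ee_less_1[OF assms]
  assume "theta z t = 0"
  then consider "qpochhammer_inf (ee z) (ee t) = 0" | "qpochhammer_inf (ee (t - z)) (ee t) = 0"
    using qpoch_self_nonzero[OF q1] by (auto simp: theta_def)
  thus "\<exists>m n::int. z = of_int m * t + of_int n"
  proof cases
    case 1
    then obtain n where "ee z * ee t ^ n = 1" using qpoch_eq_0_iff[OF q1] by blast
    hence "ee (z + of_nat n * t) = 1" by (simp add: ee_add ee_of_nat_mult)
    then obtain k :: int where "z + of_nat n * t = of_int k" using ee_eq_1_iff by blast
    hence "z = of_int (- int n) * t + of_int k" by (simp add: algebra_simps)
    thus ?thesis by blast
  next
    case 2
    then obtain n where "ee (t - z) * ee t ^ n = 1" using qpoch_eq_0_iff[OF q1] by blast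
    hence "ee (t - z + of_nat n * t) = 1" by (simp add: ee_add ee_of_nat_mult)
    then obtain k :: int where "t - z + of_nat n * t = of_int k" using ee_eq_1_iff by blast
    hence "z = of_int (int n + 1) * t + of_int (- k)" by (simp add: algebra_simps)
    thus ?thesis by blast
  qed
qed

lemma theta_has_field_derivative_0:
  assumes "Im t > 0"
  shows "((\<lambda>z. theta z t) has_field_derivative (- 2 * of_real pi * \<i>)) (at 0)"
proof -
  note q1 = norm_ee_less_1[OF assms]
  define R where "R z = ee (- z / 2) * qpochhammer_inf (ee z * ee t) (ee t)
     * qpochhammer_inf (ee (t - z)) (ee t) / qpochhammer_inf (ee t) (ee t) ^ 2" for z
  have th: "theta z t = (1 - ee z) * R z" for z
    unfolding theta_def R_def by (subst qpoch_Suc[OF q1, of "ee z"]) simp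
  have R0: "R 0 = 1" using qpoch_self_nonzero[OF q1] by (simp add: R_def power2_eq_square)
  have "R holomorphic_on UNIV"
    unfolding R_def using qpoch_self_nonzero[OF q1] by (intro holomorphic_intros q1) auto
  then obtain R' where R': "(R has_field_derivative R') (at 0)"
    by (auto simp: holomorphic_on_def field_differentiable_def)
  have "((\<lambda>z. (1 - ee z) * R z) has_field_derivative
          ((1 - ee 0) * R' + (0 - 2 * of_real pi * \<i> * ee 0) * R 0)) (at 0)"
    by (rule DERIV_mult'[OF DERIV_diff[OF DERIV_const ee_has_field_derivative] R'])
  thus ?thesis by (simp add: R0 th)
qed

text \<open>Liouville's theorem: up to a constant factor the theta function is the only entire function with its quasi-periods
  that vanishes at the origin. The constant is read off from the derivatives at \<open>0\<close>. (The quotient of the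
  two functions is elliptic without poles.)\<close>

lemma quasi_periodic_unique:
  fixes F :: "complex \<Rightarrow> complex"
  assumes t: "Im t > 0" and F1: "\<And>z. F (z + 1) = - F z"
    and Ft: "\<And>z. F (z + t) = - ee (- t / 2 - z) * F z"
    and hol: "F holomorphic_on UNIV" and F0: "F 0 = 0"
    and D: "(F has_field_derivative - 2 * of_real pi * \<i> * C) (at 0)"
  shows "F z = C * theta z t"
proof -
  define \<Lambda> where "\<Lambda> = {z. \<exists>m n::int. z = of_int m * t + of_int n}"
  have th0: "theta z t = 0 \<longleftrightarrow> z \<in> \<Lambda>" for z
    using theta_eq_0_iff[OF t] by (simp add: \<Lambda>_def)
  have F\<Lambda>: "F z = 0" if z: "z \<in> \<Lambda>" for z
  proof -
    obtain m n :: int where "z = of_int m * t + of_int n" using z by (auto simp: \<Lambda>_def)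
    thus ?thesis using quasi_periodic_lattice[of F t 0 m n, OF F1 Ft] F0 by simp
  qed
  \<comment> \<open>the quotient of the two functions, extended by its limit to the common zeros\<close>
  define G where "G z = (if z \<in> \<Lambda> then C else F z / theta z t)" for z
  have shift: "z + of_int m * t + of_int n \<in> \<Lambda> \<longleftrightarrow> z \<in> \<Lambda>" for z and m n :: int
    using theta_lattice[OF t, of z m n] by (simp flip: th0)
  have G_per: "G (z + of_int m * t + of_int n) = G z" for z and m n :: int
    unfolding G_def shift quasi_periodic_lattice[of F t, OF F1 Ft] theta_lattice[OF t] by simp
  have th_hol: "(\<lambda>z. theta z t) holomorphic_on UNIV" by (intro holomorphic_intros t)
  have th_cont: "continuous_on UNIV (\<lambda>z. theta z t)"
    by (rule holomorphic_on_imp_continuous_on[OF th_hol])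
  have "open {z. theta z t \<noteq> 0}"
    using open_vimage[OF open_delete[OF open_UNIV] th_cont, of 0] by (simp add: vimage_def)
  moreover have "{z. theta z t \<noteq> 0} = - \<Lambda>" using th0 by auto
  ultimately have op: "open (- \<Lambda>)" by simp
  have G_off: "G holomorphic_on - \<Lambda>"
  proof (rule holomorphic_transform)
    show "(\<lambda>z. F z / theta z t) holomorphic_on - \<Lambda>"
      by (intro holomorphic_intros t holomorphic_on_subset[OF hol]) (auto simp: th0)
  qed (auto simp: G_def)
  have lim_th: "((\<lambda>z. theta z t / z) \<longlongrightarrow> - 2 * of_real pi * \<i>) (at 0)"
    using theta_has_field_derivative_0[OF t] theta_0[OF t] by (simp add: has_field_derivative_iff)
  have lim_F: "((\<lambda>z. F z / z) \<longlongrightarrow> - 2 * of_real pi * \<i> * C) (at 0)"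
    using D F0 by (simp add: has_field_derivative_iff)
  have nz: "eventually (\<lambda>z. theta z t / z \<noteq> 0) (at 0)"
    by (rule tendsto_imp_eventually_ne[OF lim_th]) simp
  then obtain r where r: "r > 0" "\<And>z. z \<noteq> 0 \<Longrightarrow> dist z 0 < r \<Longrightarrow> theta z t \<noteq> 0"
    by (auto simp: eventually_at)
  have r\<Lambda>: "ball 0 r - {0} \<subseteq> - \<Lambda>" using r by (auto simp flip: th0)
  have z\<Lambda>: "0 \<in> \<Lambda>" using th0[of 0] t by simp
  have G_near: "G holomorphic_on ball 0 r"
  proof (rule no_isolated_singularity'[where K = "{0}"])
    fix z :: complex assume "z \<in> {0}"
    hence [simp]: "z = 0" by simp
    have "((\<lambda>z. (F z / z) / (theta z t / z)) \<longlongrightarrow> - 2 * of_real pi * \<i> * C / (- 2 * of_real pi * \<i>)) (at 0)"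
      by (intro tendsto_divide lim_th lim_F) auto
    moreover have "- 2 * of_real pi * \<i> * C / (- 2 * of_real pi * \<i>) = C" by simp
    ultimately have L: "((\<lambda>z. (F z / z) / (theta z t / z)) \<longlongrightarrow> C) (at 0)" by simp
    have "eventually (\<lambda>z. (F z / z) / (theta z t / z) = G z) (at 0)"
    proof -
      have "eventually (\<lambda>z::complex. z \<noteq> 0) (at 0)" by (simp add: eventually_at_filter)
      with nz show ?thesis by eventually_elim (auto simp: G_def simp flip: th0)
    qed
    with L have "(G \<longlongrightarrow> C) (at 0)" using tendsto_cong by fast
    thus "(G \<longlongrightarrow> G z) (at z within ball 0 r)"
      using z\<Lambda> by (simp add: G_def tendsto_within_subset[where S = UNIV])
  qed (use holomorphic_on_subset[OF G_off r\<Lambda>] in auto)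
  have "G field_differentiable at z" for z
  proof (cases "z \<in> \<Lambda>")
    case False
    thus ?thesis using G_off op by (auto simp: holomorphic_on_open field_differentiable_def)
  next
    case True
    then obtain m n :: int where z: "z = of_int m * t + of_int n" by (auto simp: \<Lambda>_def)
    have "G field_differentiable at (z - z)"
      using G_near r by (auto simp: holomorphic_on_open field_differentiable_def)
    then obtain D where "(G has_field_derivative D) (at (z - z))"
      by (auto simp: field_differentiable_def)
    hence "((\<lambda>x. G (x - z)) has_field_derivative D) (at z)"
      using DERIV_shift[of G D z "- z"] by simp
    moreover have "G (x - z) = G x" for x
      using G_per[of "x - z" m n] z by (simp add: algebra_simps)
    ultimately show ?thesis by (auto simp: field_differentiable_def)
  qed
  hence G_hol: "G holomorphic_on UNIV"
    by (simp add: holomorphic_on_def)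
  \<comment> \<open>An elliptic function takes all its values on a period parallelogram, hence is bounded.\<close>
  define P where "P = (\<lambda>(x::real, y::real). of_real x * t + of_real y)"
  have cP: "compact (P ` ({0..1} \<times> {0..1}))"
    unfolding P_def case_prod_unfold
    by (intro compact_continuous_image continuous_intros compact_Times) auto
  hence bd: "bounded (G ` (P ` ({0..1} \<times> {0..1})))"
    by (intro compact_imp_bounded compact_continuous_image[OF _ cP]
         holomorphic_on_imp_continuous_on[OF holomorphic_on_subset[OF G_hol]]) auto
  have "range G \<subseteq> G ` (P ` ({0..1} \<times> {0..1}))"
  proof safe
    fix z
    define x where "x = Im z / Im t"
    define y where "y = Re z - x * Re t"
    have z: "z = of_real x * t + of_real y"
      using t by (auto simp: complex_eq_iff x_def y_def)
    have "of_real x = of_real (frac x) + (of_int \<lfloor>x\<rfloor> :: complex)"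
         "of_real y = of_real (frac y) + (of_int \<lfloor>y\<rfloor> :: complex)"
      by (simp_all add: frac_def)
    hence "z = P (frac x, frac y) + of_int \<lfloor>x\<rfloor> * t + of_int \<lfloor>y\<rfloor>"
      unfolding z P_def by (simp add: algebra_simps)
    hence "G z = G (P (frac x, frac y))" by (simp add: G_per)
    moreover have "(frac x, frac y) \<in> {0..1} \<times> {0..1}"
      using frac_lt_1 by (auto intro: less_imp_le)
    ultimately show "G z \<in> G ` (P ` ({0..1} \<times> {0..1}))" by blast
  qed
  hence "bounded (range G)" using bd bounded_subset by blast
  hence "G constant_on UNIV" by (rule Liouville_theorem[OF G_hol])
  hence "G z = G 0" by (auto simp: constant_on_def)
  also have "\<dots> = C" using z\<Lambda> by (simp add: G_def)
  finally show ?thesis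
    using F\<Lambda>[of z] th0[of z] by (auto simp: G_def field_simps split: if_splits)
qed

section \<open>Klein forms\<close>

lemma modular_parity:
  fixes a b c d :: int
  assumes "a * d - b * c = 1"
  shows "odd (a + c + a * c)" "odd (b + d + b * d)"
proof -
  have "odd (a * d - b * c)" using assms by simp
  thus "odd (a + c + a * c)" "odd (b + d + b * d)" by auto
qed

lemma im_moebius_pos:
  fixes a b c d :: int
  assumes det: "a * d - b * c = 1" and t: "Im t > 0"
  shows "of_int c * t + of_int d \<noteq> 0"
    "Im ((of_int a * t + of_int b) / (of_int c * t + of_int d)) > 0"
proof -
  show nz: "of_int c * t + of_int d \<noteq> 0"
  proof
    assume *: "of_int c * t + of_int d = 0"
    hence "of_int c * Im t = 0" by (auto simp: complex_eq_iff)
    hence "c = 0" using t by simp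
    moreover from this * have "d = 0" by simp
    ultimately show False using det by simp
  qed
  have "real_of_int a * real_of_int d - real_of_int b * real_of_int c = 1"
    using det by (metis of_int_1 of_int_diff of_int_mult)
  hence *: "real_of_int a * Im t * real_of_int d = Im t + real_of_int b * real_of_int c * Im t"
    by (metis (no_types, opaque_lifting) add.commute diff_add_cancel mult.commute mult.left_commute mult_1 distrib_left)
  have "Im ((of_int a * t + of_int b) / (of_int c * t + of_int d))
     = Im t / (cmod (of_int c * t + of_int d))\<^sup>2"
    unfolding Im_divide cmod_power2
    using * by (intro arg_cong2[where f = "(/)"]) (auto simp: algebra_simps)
  also have "\<dots> > 0" using t nz by simp
  finally show "Im ((of_int a * t + of_int b) / (of_int c * t + of_int d)) > 0" .
qed

lemma ee_odd_half: "odd n \<Longrightarrow> ee (of_int n / 2) = - 1"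
proof -
  assume "odd n"
  then obtain k where "n = 2 * k + 1" by (elim oddE)
  hence eq: "of_int n / 2 = of_int k + (1 / 2 :: complex)" by (simp add: field_simps)
  show ?thesis unfolding eq ee_add ee_half by simp
qed

text \<open>The transformation of the theta function under the full modular group, with the exact automorphy factor. By
  \<open>quasi_periodic_unique\<close> only the quasi-periods and the derivative at \<open>0\<close> have to be
  compared; no multiplier arises.\<close>

lemma theta_modular:
  fixes a b c d :: int
  assumes det: "a * d - b * c = 1" and t: "Im t > 0"
  defines "J \<equiv> of_int c * t + of_int d"
  defines "t' \<equiv> (of_int a * t + of_int b) / J"
  shows "theta (z / J) t' * ee (- of_int c * z\<^sup>2 / (2 * J)) = theta z t / J"
proof -
  have J: "J \<noteq> 0" and t': "Im t' > 0"
    using im_moebius_pos[OF det t] by (auto simp: J_def t'_def)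
  have det': "of_int a * of_int d - of_int b * of_int c = (1 :: complex)"
    using det by (metis of_int_1 of_int_diff of_int_mult)
  \<comment> \<open>the left-hand side, which is compared with the theta function of \<open>t\<close>\<close>
  define F where "F z = theta (z / J) t' * ee (- of_int c * z\<^sup>2 / (2 * J))" for z
  have "F z = (1 / J) * theta z t"
  proof (rule quasi_periodic_unique[OF t])
    fix z
    \<comment> \<open>the translation by \<open>1\<close>, where \<open>1 / J = a - c t'\<close>\<close>
    have one: "(z + 1) / J = z / J + of_int (- c) * t' + of_int a"
      using J det' unfolding t'_def by (simp add: field_simps) (simp add: J_def algebra_simps)
    have "F (z + 1) = (ee ((of_int (- c + a) - of_int (- c * - c) * t') / 2 - of_int (- c) * (z / J))
            * ee (- of_int c * (z + 1)\<^sup>2 / (2 * J))) * theta (z / J) t'"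
      unfolding F_def one theta_lattice[OF t'] by (simp only: mult_ac)
    also have "ee ((of_int (- c + a) - of_int (- c * - c) * t') / 2 - of_int (- c) * (z / J))
            * ee (- of_int c * (z + 1)\<^sup>2 / (2 * J))
         = ee (of_int (a + c + a * c) / 2 + of_int (- c - a * c) + (- of_int c * z\<^sup>2 / (2 * J)))"
    proof -
      have "t' * J = of_int a * t + of_int b" using J by (simp add: t'_def)
      hence "of_int c * t' * J + 1 = of_int a * J - (of_int a * of_int d - of_int b * of_int c - 1)"
        by (simp add: J_def mult.assoc) (simp add: algebra_simps)
      hence "of_int c * t' * J + 1 = of_int a * J" by (simp add: det')
      hence "of_int c * t' + 1 / J = of_int a" using J by (simp add: field_simps)
      hence *: "of_int c * (of_int c * t') + of_int c / J = of_int a * of_int c"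
        by (metis (no_types, lifting) distrib_left mult.commute mult.right_neutral times_divide_eq_right)
      show ?thesis unfolding ee_add[symmetric] using *
        by (intro arg_cong[where f = ee]) (simp add: power2_eq_square add_divide_distrib diff_divide_distrib algebra_simps)
    qed
    also have "\<dots> = - ee (- of_int c * z\<^sup>2 / (2 * J))"
      unfolding ee_add ee_odd_half[OF modular_parity(1)[OF det]] ee_of_int by simp
    finally show "F (z + 1) = - F z" by (simp add: F_def)
    \<comment> \<open>the translation by \<open>t\<close>, where \<open>t / J = d t' - b\<close>\<close>
    have tau: "(z + t) / J = z / J + of_int d * t' + of_int (- b)"
      using J det' unfolding t'_def by (simp add: field_simps) (simp add: J_def algebra_simps)
    have "F (z + t) = (ee ((of_int (d + - b) - of_int (d * d) * t') / 2 - of_int d * (z / J))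
            * ee (- of_int c * (z + t)\<^sup>2 / (2 * J))) * theta (z / J) t'"
      unfolding F_def tau theta_lattice[OF t'] by (simp only: mult_ac)
    also have "ee ((of_int (d + - b) - of_int (d * d) * t') / 2 - of_int d * (z / J))
            * ee (- of_int c * (z + t)\<^sup>2 / (2 * J))
         = ee (of_int (b + d + b * d) / 2 + of_int (- b - b * d) + (- t / 2 - z) + (- of_int c * z\<^sup>2 / (2 * J)))"
    proof -
      have 1: "of_int d * of_int d * t' + of_int c * t\<^sup>2 / J = t + of_int b * of_int d"
      proof -
        have "of_int d * of_int d * (of_int a * t + of_int b) + of_int c * t\<^sup>2 = (t + of_int b * of_int d) * J
           + (of_int a * of_int d - of_int b * of_int c - 1) * of_int d * t"
          by (simp add: J_def power2_eq_square algebra_simps)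
        also have "\<dots> = (t + of_int b * of_int d) * J" by (simp add: det')
        finally show ?thesis using J by (simp add: t'_def add_divide_distrib[symmetric] field_simps)
      qed
      have 2: "of_int d * (z / J) + of_int c * z * t / J = z"
        using J by (simp add: field_simps) (simp add: J_def algebra_simps)
      have "(of_int (d + - b) - of_int (d * d) * t') / 2 - of_int d * (z / J) + (- of_int c * (z + t)\<^sup>2 / (2 * J))
         = (of_int d - of_int b) / 2 - (of_int d * of_int d * t' + of_int c * t\<^sup>2 / J) / 2
           - (of_int d * (z / J) + of_int c * z * t / J) - of_int c * z\<^sup>2 / (2 * J)"
        using J by (simp add: field_simps power2_eq_square)
      also have "\<dots> = of_int (b + d + b * d) / 2 + of_int (- b - b * d) + (- t / 2 - z) + (- of_int c * z\<^sup>2 / (2 * J))"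
        unfolding 1 2 by (simp add: field_simps)
      finally show ?thesis unfolding ee_add[symmetric] by (rule arg_cong[where f = ee])
    qed
    also have "\<dots> = - ee (- t / 2 - z) * ee (- of_int c * z\<^sup>2 / (2 * J))"
      unfolding ee_add[of "_ + _" "- of_int c * z\<^sup>2 / (2 * J)"] ee_add[of "_ + _" "- t / 2 - z"]
        ee_add[of "of_int (b + d + b * d) / 2"]
        ee_odd_half[OF modular_parity(2)[OF det]] ee_of_int by simp
    finally show "F (z + t) = - ee (- t / 2 - z) * F z" by (simp add: F_def)
  next
    show "F holomorphic_on UNIV" unfolding F_def using J by (intro holomorphic_intros t') auto
    show "F 0 = 0" using t' by (simp add: F_def)
    have A: "((\<lambda>z. theta (z / J) t') has_field_derivative (- 2 * of_real pi * \<i>) * (1 / J)) (at 0)"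
    proof -
      have "((\<lambda>z. z / J) has_field_derivative 1 / J) (at 0)" by (auto intro!: derivative_eq_intros simp: J)
      moreover have "((\<lambda>z. theta z t') has_field_derivative (- 2 * of_real pi * \<i>)) (at (0 / J))"
        using theta_has_field_derivative_0[OF t'] by simp
      ultimately show ?thesis using DERIV_chain2 by fastforce
    qed
    have "(\<lambda>z. ee (- of_int c * z\<^sup>2 / (2 * J))) holomorphic_on UNIV"
      using J by (intro holomorphic_intros) auto
    then obtain R' where R': "((\<lambda>z. ee (- of_int c * z\<^sup>2 / (2 * J))) has_field_derivative R') (at 0)"
      by (auto simp: holomorphic_on_def field_differentiable_def)
    show "(F has_field_derivative - 2 * of_real pi * \<i> * (1 / J)) (at 0)"
      unfolding F_def using DERIV_mult'[OF A R'] t' by simp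
  qed
  thus ?thesis by (simp add: F_def)
qed

text \<open>The Klein form of the row vector \<open>(r, s)\<close>, that is, of the point \<open>r t + s\<close>, up to the factor
  \<open>- 2 \<pi> i\<close>. The entries may be arbitrary complex numbers.\<close>

definition klein :: "complex \<Rightarrow> complex \<Rightarrow> complex \<Rightarrow> complex" where
  "klein r s t = ee (r * (r * t + s) / 2) * theta (r * t + s) t"

text \<open>A matrix acts on a Klein form by multiplication of the row vector from the right; the weight is \<open>-1\<close>, and
  there is no multiplier.\<close>

lemma klein_modular:
  fixes a b c d :: int
  assumes det: "a * d - b * c = 1" and t: "Im t > 0"
  defines "J \<equiv> of_int c * t + of_int d"
  defines "t' \<equiv> (of_int a * t + of_int b) / J"
  shows "klein r s t' = klein (r * of_int a + s * of_int c) (r * of_int b + s * of_int d) t / J"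
proof -
  have J: "J \<noteq> 0" using im_moebius_pos[OF det t] by (auto simp: J_def)
  have det': "of_int a * of_int d - of_int b * of_int c = (1 :: complex)"
    using det by (metis of_int_1 of_int_diff of_int_mult)
  define r' s' where "r' = r * of_int a + s * of_int c" and "s' = r * of_int b + s * of_int d"
  define z where "z = r' * t + s'"
  have z: "r * t' + s = z / J"
    using J by (simp add: t'_def field_simps) (simp add: z_def r'_def s'_def J_def algebra_simps)
  have T: "theta (z / J) t' = ee (of_int c * z\<^sup>2 / (2 * J)) * theta z t / J"
  proof -
    have inv: "ee (- of_int c * z\<^sup>2 / (2 * J)) * ee (of_int c * z\<^sup>2 / (2 * J)) = 1"
      unfolding ee_add[symmetric] by simp
    have "theta (z / J) t' = theta (z / J) t' * (ee (- of_int c * z\<^sup>2 / (2 * J)) * ee (of_int c * z\<^sup>2 / (2 * J)))"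
      unfolding inv by simp
    also have "\<dots> = (theta z t / J) * ee (of_int c * z\<^sup>2 / (2 * J))"
      unfolding mult.assoc[symmetric] J_def t'_def theta_modular[OF det t, of z] ..
    finally show ?thesis by simp
  qed
  have "r + of_int c * z = r' * J"
  proof -
    have "r + of_int c * z - r' * J = (of_int a * of_int d - of_int b * of_int c - 1) * - r"
      by (simp add: z_def r'_def s'_def J_def algebra_simps)
    thus ?thesis using det' by simp
  qed
  hence eq: "r * (z / J) / 2 + of_int c * z\<^sup>2 / (2 * J) = r' * z / 2"
    using J by (simp add: field_simps power2_eq_square) (metis distrib_left mult.commute mult.left_commute)
  have E: "ee (r * (z / J) / 2) * ee (of_int c * z\<^sup>2 / (2 * J)) = ee (r' * z / 2)"
    unfolding ee_add[symmetric] eq ..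
  have "klein r s t' = (ee (r * (z / J) / 2) * ee (of_int c * z\<^sup>2 / (2 * J))) * theta z t / J"
    unfolding klein_def z T by simp
  also have "\<dots> = klein r' s' t / J"
    unfolding E by (simp add: klein_def z_def)
  finally show ?thesis by (simp add: r'_def s'_def)
qed

lemma klein_shift:
  fixes m n :: int
  assumes "Im t > 0"
  shows "klein (r + of_int m) (s + of_int n) t
           = ee ((of_int (m + n + m * n) + r * of_int n - of_int m * s) / 2) * klein r s t"
proof -
  have z: "(r + of_int m) * t + (s + of_int n) = (r * t + s) + of_int m * t + of_int n"
    by (simp add: algebra_simps)
  show ?thesis
    unfolding klein_def z theta_lattice[OF assms] mult.assoc[symmetric] ee_add[symmetric]
    by (intro arg_cong2[where f = "(*)"] arg_cong[where f = ee] refl) (simp add: field_simps)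
qed

section \<open>The discriminant\<close>

text \<open>The discriminant \<open>q (q; q)\<^sup>2\<^sup>4\<close> with \<open>q = e(t)\<close>, without the factor \<open>(2
  \<pi>)\<^sup>1\<^sup>2\<close>.\<close>

definition Delta :: "complex \<Rightarrow> complex" where
  "Delta t = ee t * qpochhammer_inf (ee t) (ee t) ^ 24"

text \<open>This expresses the discriminant by the Klein forms of the three points of order two.\<close>

lemma klein_two_torsion_product:
  assumes t: "Im t > 0"
  shows "(klein (1 / 2) 0 t * klein 0 (1 / 2) t * klein (1 / 2) (1 / 2) t) ^ 4 * Delta t = - 16"
proof -
  note q1 = norm_ee_less_1[OF t]
  define p where "p = ee (t / 2)"
  define q where "q = ee t"
  define E where "E = qpochhammer_inf q q"
  have E: "E \<noteq> 0" using qpoch_self_nonzero[OF q1] by (simp add: E_def q_def)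
  have p2: "p\<^sup>2 = q" by (simp add: p_def q_def power2_eq_square flip: ee_add)
  have eq1: "ee (t - t / 2) = p" "ee (t / 2 + 1 / 2) = - p" "ee (t - 1 / 2) = - q"
    "ee (t - (t / 2 + 1 / 2)) = - p"
  proof -
    have *: "t - (t / 2 + 1 / 2) = t / 2 - 1 / 2" "t - t / 2 = t / 2" by (simp_all add: field_simps)
    show "ee (t - t / 2) = p" "ee (t / 2 + 1 / 2) = - p" "ee (t - 1 / 2) = - q"
      "ee (t - (t / 2 + 1 / 2)) = - p"
      unfolding * ee_add ee_diff ee_half by (simp_all add: p_def q_def)
  qed
  have k1: "klein (1 / 2) 0 t = ee (1 / 2 * (1 / 2 * t) / 2) * ee (- (t / 2) / 2) * (qpochhammer_inf p q)\<^sup>2 / E\<^sup>2"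
    using eq1 by (simp add: klein_def theta_def E_def q_def p_def power2_eq_square)
  have k2: "klein 0 (1 / 2) t = ee (- (1 / 2) / 2) * (qpochhammer_inf (- 1) q * qpochhammer_inf (- q) q) / E\<^sup>2"
    using eq1 ee_half by (simp add: klein_def theta_def E_def q_def)
  have k3: "klein (1 / 2) (1 / 2) t = ee (1 / 2 * (1 / 2 * t + 1 / 2) / 2) * ee (- (t / 2 + 1 / 2) / 2) * (qpochhammer_inf (- p) q)\<^sup>2 / E\<^sup>2"
    using eq1 by (simp add: klein_def theta_def E_def q_def p_def power2_eq_square)
  have q1': "norm q < 1" using q1 by (simp add: q_def)
  have q2: "norm (q\<^sup>2) < 1"
    unfolding power2_eq_square norm_mult using mult_strict_mono'[OF q1' q1'] by simp
  \<comment> \<open>Euler's identity \<open>(q; q\<^sup>2) (- q; q) = 1\<close>\<close>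
  define R where "R = qpochhammer_inf q (q\<^sup>2)"
  define S where "S = qpochhammer_inf (- q) q"
  have pm: "qpochhammer_inf p q * qpochhammer_inf (- p) q = R"
    unfolding R_def using qpoch_mult_minus[OF q1', of p] by (simp add: p2)
  have "E * S = qpochhammer_inf (q\<^sup>2) (q\<^sup>2)"
    unfolding E_def S_def by (rule qpoch_mult_minus[OF q1'])
  moreover have "R * qpochhammer_inf (q\<^sup>2) (q\<^sup>2) = E"
    unfolding R_def E_def using qpoch_even_odd[OF q1', of q] by (simp add: power2_eq_square)
  ultimately have "R * (E * S) = E" by simp
  hence "E * (R * S) = E * 1" by (simp add: mult.left_commute)
  hence RS: "R * S = 1" using E by simp
  have m1: "qpochhammer_inf (- 1) q = 2 * S"
    using qpoch_Suc[OF q1', of "- 1"] by (simp add: S_def)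
  define c where "c = ee (1 / 2 * (1 / 2 * t) / 2) * ee (- (t / 2) / 2) * ee (- (1 / 2) / 2)
       * (ee (1 / 2 * (1 / 2 * t + 1 / 2) / 2) * ee (- (t / 2 + 1 / 2) / 2))"
  have "klein (1 / 2) 0 t * klein 0 (1 / 2) t * klein (1 / 2) (1 / 2) t
     = c * (qpochhammer_inf p q * qpochhammer_inf (- p) q)\<^sup>2 * (2 * S * S) / E ^ 6"
    unfolding k1 k2 k3 m1 S_def[symmetric] c_def using E by (simp add: field_simps)
  also have "\<dots> = 2 * c * (R * S)\<^sup>2 / E ^ 6"
    unfolding pm by (simp add: power2_eq_square mult_ac)
  also have "\<dots> = 2 * c / E ^ 6" by (simp add: RS)
  finally have prod: "klein (1 / 2) 0 t * klein 0 (1 / 2) t * klein (1 / 2) (1 / 2) t = 2 * c / E ^ 6" .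
  have "c ^ 4 = ee (of_nat 4 * (1 / 2 * (1 / 2 * t) / 2 + - (t / 2) / 2 + - (1 / 2) / 2 +
     (1 / 2 * (1 / 2 * t + 1 / 2) / 2 + - (t / 2 + 1 / 2) / 2)))"
    unfolding c_def ee_of_nat_mult ee_add ..
  also have "of_nat 4 * (1 / 2 * (1 / 2 * t) / 2 + - (t / 2) / 2 + - (1 / 2) / 2 +
     (1 / 2 * (1 / 2 * t + 1 / 2) / 2 + - (t / 2 + 1 / 2) / 2)) = - t + 1 / 2 + of_int (- 2)"
    by (simp add: field_simps)
  also have "ee \<dots> = - ee (- t)"
    unfolding ee_add ee_half ee_of_int by simp
  finally have c4: "c ^ 4 = - ee (- t)" .
  have "(2 * c / E ^ 6) ^ 4 * Delta t = 16 * c ^ 4 * ee t"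
    using E by (simp add: Delta_def E_def q_def power_divide power_mult_distrib flip: power_mult)
  also have "\<dots> = - 16" unfolding c4 by (simp add: ee_minus)
  finally show ?thesis unfolding prod .
qed

text \<open>The fourth powers of the Klein forms of order two depend only on the point modulo the lattice, because the factor in
  \<open>klein_shift\<close> is then a fourth root of unity.\<close>

lemma klein_half_mod_2:
  assumes t: "Im t > 0"
  shows "klein (of_int m / 2) (of_int n / 2) t ^ 4
           = klein (of_int (m mod 2) / 2) (of_int (n mod 2) / 2) t ^ 4"
proof -
  define i j where "i = m div 2" and "j = n div 2"
  have m: "of_int m / 2 = of_int (m mod 2) / 2 + (of_int i :: complex)"
  proof -
    have "of_int m = (of_int (m mod 2 + 2 * i) :: complex)"
      unfolding i_def by (simp only: mod_mult_div_eq)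
    thus ?thesis by (simp add: field_simps)
  qed
  have n: "of_int n / 2 = of_int (n mod 2) / 2 + (of_int j :: complex)"
  proof -
    have "of_int n = (of_int (n mod 2 + 2 * j) :: complex)"
      unfolding j_def by (simp only: mod_mult_div_eq)
    thus ?thesis by (simp add: field_simps)
  qed
  have "ee ((of_int (i + j + i * j) + of_int (m mod 2) / 2 * of_int j - of_int i * (of_int (n mod 2) / 2)) / 2) ^ 4
     = ee (of_int (2 * (i + j + i * j) + (m mod 2) * j - i * (n mod 2)))"
    unfolding ee_of_nat_mult[symmetric] by (rule arg_cong[where f = ee]) (simp add: field_simps)
  thus ?thesis
    unfolding m n klein_shift[OF t] power_mult_distrib ee_of_int by simp
qed

text \<open>A matrix of determinant \<open>1\<close> permutes the three points of order two modulo the lattice; the permutation is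
  determined by the matrix modulo \<open>2\<close>.\<close>

lemma Delta_modular:
  fixes a b c d :: int
  assumes det: "a * d - b * c = 1" and t: "Im t > 0"
  shows "Delta ((of_int a * t + of_int b) / (of_int c * t + of_int d))
           = (of_int c * t + of_int d) ^ 12 * Delta t"
proof -
  define J where "J = of_int c * t + of_int d"
  define t' where "t' = (of_int a * t + of_int b) / J"
  have J: "J \<noteq> 0" and t': "Im t' > 0"
    using im_moebius_pos[OF det t] by (auto simp: J_def t'_def)
  define h where "h m n = klein (of_int m / 2) (of_int n / 2) t ^ 4" for m n :: int
  have h: "h m n = h (m mod 2) (n mod 2)" for m n
    unfolding h_def by (rule klein_half_mod_2[OF t])
  have hk: "klein (of_int m / 2) (of_int n / 2) t' ^ 4 = h (m * a + n * c) (m * b + n * d) / J ^ 4" for m n :: int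
    using klein_modular[OF det t, of "of_int m / 2" "of_int n / 2"]
    by (simp add: h_def J_def t'_def power_divide add_divide_distrib)
  have per: "h a b * h c d * h (a + c) (b + d) = h 1 0 * h 0 1 * h 1 1"
  proof -
    have odd: "odd (a * d - b * c)" using det by simp
    have *: "h a b * h c d * h (a + c) (b + d) = h (a mod 2) (b mod 2) * h (c mod 2) (d mod 2)
       * h ((a mod 2 + c mod 2) mod 2) ((b mod 2 + d mod 2) mod 2)"
      by (subst h[of a b], subst h[of c d], subst h[of "a + c" "b + d"]) (simp only: mod_add_eq)
    show ?thesis
      unfolding * using odd
      by (cases "even a"; cases "even b"; cases "even c"; cases "even d")
         (simp_all add: mod2_eq_if mult_ac)
  qed
  have "Delta t' * (h a b * h c d * h (a + c) (b + d)) = - 16 * J ^ 12"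
  proof -
    have hs: "h a b = J ^ 4 * klein (1 / 2) 0 t' ^ 4" "h c d = J ^ 4 * klein 0 (1 / 2) t' ^ 4"
      "h (a + c) (b + d) = J ^ 4 * klein (1 / 2) (1 / 2) t' ^ 4"
      using hk[of 1 0] hk[of 0 1] hk[of 1 1] J by (simp_all add: field_simps)
    have "Delta t' * (h a b * h c d * h (a + c) (b + d))
       = ((klein (1 / 2) 0 t' * klein 0 (1 / 2) t' * klein (1 / 2) (1 / 2) t') ^ 4 * Delta t') * J ^ 12"
      unfolding hs power_mult_distrib by (simp add: mult_ac flip: power_add)
    thus ?thesis unfolding klein_two_torsion_product[OF t'] .
  qed
  moreover have P: "Delta t * (h 1 0 * h 0 1 * h 1 1) = - 16"
    using klein_two_torsion_product[OF t] by (simp add: h_def power_mult_distrib field_simps)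
  ultimately have eq: "Delta t' * (h 1 0 * h 0 1 * h 1 1) = (J ^ 12 * Delta t) * (h 1 0 * h 0 1 * h 1 1)"
    unfolding per by (simp add: mult.assoc)
  have nz: "h 1 0 * h 0 1 * h 1 1 \<noteq> 0"
  proof
    assume z: "h 1 0 * h 0 1 * h 1 1 = 0"
    show False using P unfolding z by simp
  qed
  have "Delta t' = J ^ 12 * Delta t" by (rule mult_right_cancel[OF nz, THEN iffD1, OF eq])
  thus ?thesis unfolding J_def t'_def .
qed

section \<open>Eta quotients\<close>

text \<open>The product of the \<open>D\<close>-th power of the discriminant and of the \<open>b j\<close>-th powers of the Klein
  forms of \<open>(j/N, 0)\<close>, for the lattice spanned by \<open>N \<tau>\<close> and \<open>1\<close>.\<close>

definition klein_quotient :: "nat \<Rightarrow> int \<Rightarrow> (nat \<Rightarrow> int) \<Rightarrow> complex \<Rightarrow> complex" where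
  "klein_quotient N D b \<tau> = Delta (of_nat N * \<tau>) powi D
     * (\<Prod>j=1..N div 2. klein (of_nat j / of_nat N) 0 (of_nat N * \<tau>) powi b j)"

lemma prod_powi_const:
  fixes x :: complex
  assumes "x \<noteq> 0" "finite S"
  shows "(\<Prod>j\<in>S. x powi f j) = x powi (\<Sum>j\<in>S. f j)"
  using assms(2) by induction (simp_all add: power_int_add assms(1))

lemma prod_ee:
  assumes "finite S" shows "(\<Prod>j\<in>S. ee (f j)) = ee (\<Sum>j\<in>S. f j)"
  using assms by induction (simp_all add: ee_add)

lemma ee_exponent_eq: "\<tau> * (M / 24 * (2 * S) - X) + \<tau> * X = M * \<tau> * (S / 12)"
  for \<tau> M S X :: complex
  by (simp add: ring_distribs)

text \<open>The power of \<open>q\<close> in front of the theta quotient is the one that the Klein forms require. The remaining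
  factor is the \<open>2 s\<close>-th power of the eta function at \<open>N \<tau>\<close>, written out because it is
  a power of the discriminant only if \<open>12\<close> divides \<open>s\<close>.\<close>

lemma theta_quotient_eq_klein:
  fixes a :: "nat \<Rightarrow> int" and k :: nat
  assumes N: "N > 0" and t: "Im \<tau> > 0"
  defines "s \<equiv> int k + (\<Sum>j=1..N div 2. a j)"
  shows "theta_quotient N (2 * k) a \<tau>
     = ee (of_nat N * \<tau> * (of_int s / 12)) * qpochhammer_inf (ee (of_nat N * \<tau>)) (ee (of_nat N * \<tau>)) powi (2 * s)
        * (\<Prod>j=1..N div 2. klein (of_nat j / of_nat N) 0 (of_nat N * \<tau>) powi a j)"
proof -
  define E where "E = qpochhammer_inf (ee (of_nat N * \<tau>)) (ee (of_nat N * \<tau>))"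
  have tN: "Im (of_nat N * \<tau>) > 0" using N t by simp
  have E: "E \<noteq> 0" unfolding E_def by (rule qpoch_self_nonzero[OF norm_ee_less_1[OF tN]])
  define q where "q = ee \<tau>"
  have qn: "q ^ n = ee (of_nat n * \<tau>)" for n by (simp add: q_def ee_of_nat_mult)
  define x where "x j = of_nat j * of_nat (N - j) * \<tau> / (2 * of_nat N)" for j
  have kl: "qpochhammer_inf (q ^ j) (q ^ N) * qpochhammer_inf (q ^ (N - j)) (q ^ N)
      = klein (of_nat j / of_nat N) 0 (of_nat N * \<tau>) * ee (x j) * E\<^sup>2" if j: "j \<le> N" for j
  proof -
    have 1: "of_nat j / of_nat N * (of_nat N * \<tau>) = of_nat j * \<tau>" using N by simp
    have 2: "of_nat N * \<tau> - of_nat j * \<tau> = of_nat (N - j) * \<tau>"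
      using j by (simp add: of_nat_diff algebra_simps)
    have 3: "ee (of_nat j / of_nat N * (of_nat j * \<tau>) / 2) * ee (- (of_nat j * \<tau>) / 2) * ee (x j) = 1"
    proof -
      have "of_nat (N - j) = (of_nat N - of_nat j :: complex)" "of_nat N \<noteq> (0::complex)"
        using N j by (simp_all add: of_nat_diff)
      hence "of_nat j / of_nat N * (of_nat j * \<tau>) / 2 + - (of_nat j * \<tau>) / 2 + x j = 0"
        unfolding x_def by (simp add: divide_simps) (simp add: algebra_simps)
      thus ?thesis unfolding ee_add[symmetric] by (simp only: ee_0)
    qed
    have "klein (of_nat j / of_nat N) 0 (of_nat N * \<tau>) = ee (of_nat j / of_nat N * (of_nat j * \<tau>) / 2) *
        (ee (- (of_nat j * \<tau>) / 2) * qpochhammer_inf (q ^ j) (q ^ N) * qpochhammer_inf (q ^ (N - j)) (q ^ N) / E\<^sup>2)"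
      unfolding klein_def theta_def add_0_right 1 2 qn E_def by simp
    hence "klein (of_nat j / of_nat N) 0 (of_nat N * \<tau>) * ee (x j) * E\<^sup>2
      = (ee (of_nat j / of_nat N * (of_nat j * \<tau>) / 2) * ee (- (of_nat j * \<tau>) / 2) * ee (x j)) *
        (qpochhammer_inf (q ^ j) (q ^ N) * qpochhammer_inf (q ^ (N - j)) (q ^ N))"
      using E by simp
    thus ?thesis unfolding 3 by simp
  qed
  define S1 where "S1 = int (2 * k) + 2 * (\<Sum>j=1..N div 2. a j)"
  define S2 where "S2 = (\<Sum>j=1..N div 2. int j * int (N - j) * a j)"
  define K where "K = (\<Prod>j=1..N div 2. klein (of_nat j / of_nat N) 0 (of_nat N * \<tau>) powi a j)"
  have sx: "(\<Sum>j=1..N div 2. of_int (a j) * x j) = \<tau> * (1 / (2 * of_nat N) * of_int S2)"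
    by (simp add: x_def S2_def sum_distrib_left sum_distrib_right sum_divide_distrib mult_ac)
  have "(\<Prod>j=1..N div 2. (qpochhammer_inf (q ^ j) (q ^ N) * qpochhammer_inf (q ^ (N - j)) (q ^ N)) powi a j)
     = (\<Prod>j=1..N div 2. (klein (of_nat j / of_nat N) 0 (of_nat N * \<tau>) * ee (x j) * E\<^sup>2) powi a j)"
    by (intro prod.cong refl arg_cong2[where f = power_int] kl) auto
  also have "\<dots> = K * (\<Prod>j=1..N div 2. ee (of_int (a j) * x j)) * (\<Prod>j=1..N div 2. (E\<^sup>2) powi a j)"
    by (simp add: K_def power_int_mult_distrib prod.distrib ee_of_int_mult)
  also have "\<dots> = K * ee (\<tau> * (1 / (2 * of_nat N) * of_int S2)) * E powi (2 * (\<Sum>j=1..N div 2. a j))"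
  proof -
    have "(\<Prod>j=1..N div 2. (E\<^sup>2) powi a j) = (E powi int 2) powi (\<Sum>j=1..N div 2. a j)"
      unfolding power_int_of_nat using E by (intro prod_powi_const) auto
    also have "\<dots> = E powi (2 * (\<Sum>j=1..N div 2. a j))"
      unfolding of_nat_numeral by (rule power_int_mult[symmetric])
    finally have pE: "(\<Prod>j=1..N div 2. (E\<^sup>2) powi a j) = E powi (2 * (\<Sum>j=1..N div 2. a j))" .
    show ?thesis unfolding prod_ee[OF finite_atLeastAtMost] sx pE ..
  qed
  finally have P: "(\<Prod>j=1..N div 2. (qpochhammer_inf (q ^ j) (q ^ N) * qpochhammer_inf (q ^ (N - j)) (q ^ N)) powi a j)
     = K * ee (\<tau> * (1 / (2 * of_nat N) * of_int S2)) * E powi (2 * (\<Sum>j=1..N div 2. a j))" .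
  have e1: "exp (2 * of_real pi * \<i> * \<tau>) = q" by (simp only: q_def ee_def)
  have e2: "exp (2 * of_real pi * \<i> * \<tau> * X) = ee (\<tau> * X)" for X
    by (simp only: ee_def mult.assoc)
  have e3: "qpochhammer_inf (q ^ N) (q ^ N) = E" by (simp only: E_def qn)
  have T: "theta_quotient N (2 * k) a \<tau> = ee (\<tau> * (of_nat N / 24 * of_int S1 - 1 / (2 * of_nat N) * of_int S2))
     * E ^ (2 * k) * (\<Prod>j=1..N div 2. (qpochhammer_inf (q ^ j) (q ^ N) * qpochhammer_inf (q ^ (N - j)) (q ^ N)) powi a j)"
    by (simp only: theta_quotient_def Let_def e1 e2 e3 S1_def S2_def)
  have 1: "E powi (2 * s) = E ^ (2 * k) * E powi (2 * (\<Sum>j=1..N div 2. a j))"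
    using E by (simp add: s_def power_int_add flip: power_int_of_nat)
  have S1: "of_int S1 = (2 * of_int s :: complex)" by (simp add: S1_def s_def)
  have 2: "ee (of_nat N * \<tau> * (of_int s / 12)) = ee (\<tau> * (of_nat N / 24 * of_int S1 - 1 / (2 * of_nat N) * of_int S2))
      * ee (\<tau> * (1 / (2 * of_nat N) * of_int S2))"
    unfolding ee_add[symmetric] S1 by (rule arg_cong[where f = ee], rule ee_exponent_eq[symmetric])
  show ?thesis
    unfolding T P K_def[symmetric] E_def[symmetric] 1 2 by (simp only: mult_ac)
qed

lemma theta_quotient_eq_klein_quotient:
  assumes N: "N > 0" and t: "Im \<tau> > 0"
    and D: "int k + (\<Sum>j=1..N div 2. a j) = 12 * D"
  shows "theta_quotient N (2 * k) a \<tau> = klein_quotient N D a \<tau>"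
proof -
  have 1: "ee (of_nat N * \<tau> * (of_int (12 * D) / 12)) = ee (of_nat N * \<tau>) powi D"
    unfolding ee_of_int_mult[symmetric] by (rule arg_cong[where f = ee]) simp
  have 2: "E powi (2 * (12 * D)) = (E ^ 24) powi D" for E :: complex
    using power_int_mult[of E 24 D] by simp
  show ?thesis
    unfolding theta_quotient_eq_klein[OF N t] D 1 2 klein_quotient_def Delta_def
    by (simp only: power_int_mult_distrib)
qed

lemma powi_power_12: "(x powi n) ^ 12 = x powi (12 * n)" for x :: complex and n :: int
  using power_int_mult[of x n 12] by (simp add: mult.commute)

lemma prod_powi_power_12:
  fixes x :: "'a \<Rightarrow> complex"
  shows "(\<Prod>j\<in>S. x j powi f j) ^ 12 = (\<Prod>j\<in>S. x j powi (12 * f j))"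
  by (subst prod_power_distrib) (intro prod.cong refl powi_power_12)

text \<open>No condition on the exponents is needed for the twelfth power.\<close>

lemma theta_quotient_power_12:
  assumes N: "N > 0" and t: "Im \<tau> > 0"
  shows "theta_quotient N (2 * k) a \<tau> ^ 12
     = klein_quotient N (int k + (\<Sum>j=1..N div 2. a j)) (\<lambda>j. 12 * a j) \<tau>"
proof -
  define s where "s = int k + (\<Sum>j=1..N div 2. a j)"
  define E where "E = qpochhammer_inf (ee (of_nat N * \<tau>)) (ee (of_nat N * \<tau>))"
  have "ee (of_nat N * \<tau> * (of_int s / 12)) ^ 12 = ee (of_nat N * \<tau>) powi s"
  proof -
    have "of_nat 12 * (M * (S / 12)) = S * M" for M S :: complex by simp
    thus ?thesis by (simp only: ee_of_nat_mult[symmetric] ee_of_int_mult[symmetric])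
  qed
  moreover have "(E powi (2 * s)) ^ 12 = (E ^ 24) powi s"
  proof -
    have "12 * (2 * s) = int 24 * s" by simp
    hence "(E powi (2 * s)) ^ 12 = E powi (int 24 * s)" by (simp only: powi_power_12)
    also have "\<dots> = (E powi int 24) powi s" by (rule power_int_mult)
    also have "E powi int 24 = E ^ 24" by (rule power_int_of_nat)
    finally show ?thesis .
  qed
  ultimately show ?thesis
    unfolding theta_quotient_eq_klein[OF N t] klein_quotient_def Delta_def power_mult_distrib
      power_int_mult_distrib prod_powi_power_12 s_def E_def by (simp only:)
qed

section \<open>Expansions at the cusps\<close>

text \<open>The function \<open>F\<close> has the order \<open>r\<close> at \<open>\<infinity>\<close>, measured in \<open>X =
  e(\<tau>/N)\<close>, and no zeros on the upper half plane: it is \<open>X\<^sup>r\<close>, with the branch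
  \<open>e(r \<tau>/N)\<close>, times a nonvanishing holomorphic function of \<open>X\<close> on the whole unit disc.
  The order may be any real number.\<close>

definition has_order :: "nat \<Rightarrow> real \<Rightarrow> (complex \<Rightarrow> complex) \<Rightarrow> bool" where
  "has_order N r F \<longleftrightarrow> (\<exists>u. u holomorphic_on ball 0 1 \<and> (\<forall>x\<in>ball 0 1. u x \<noteq> 0) \<and>
     (\<forall>\<tau>. Im \<tau> > 0 \<longrightarrow> F \<tau> = ee (of_real r * \<tau> / of_nat N) * u (ee (\<tau> / of_nat N))))"

lemma ee_in_ball: "N > 0 \<Longrightarrow> Im \<tau> > 0 \<Longrightarrow> ee (\<tau> / of_nat N) \<in> ball 0 1"
  using norm_ee_less_1[of "\<tau> / of_nat N"] by simp

lemma has_order_cong: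
  assumes "has_order N r F" "\<And>\<tau>. Im \<tau> > 0 \<Longrightarrow> F \<tau> = G \<tau>" "r = r'"
  shows "has_order N r' G"
  using assms unfolding has_order_def by metis

lemma has_order_unit:
  assumes "u holomorphic_on ball 0 1" "\<And>x. x \<in> ball 0 1 \<Longrightarrow> u x \<noteq> 0"
    "\<And>\<tau>. Im \<tau> > 0 \<Longrightarrow> F \<tau> = u (ee (\<tau> / of_nat N))"
  shows "has_order N 0 F"
  unfolding has_order_def by (rule exI[of _ u]) (use assms in auto)

lemma has_order_const: "c \<noteq> 0 \<Longrightarrow> has_order N 0 (\<lambda>\<tau>. c)"
  by (rule has_order_unit[of "\<lambda>_. c"]) (auto intro!: holomorphic_intros)

lemma has_order_ee: "has_order N r (\<lambda>\<tau>. ee (of_real r * \<tau> / of_nat N))"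
  unfolding has_order_def by (rule exI[of _ "\<lambda>_. 1"]) (auto intro!: holomorphic_intros)

lemma has_order_mult:
  assumes "has_order N r F" "has_order N s G"
  shows "has_order N (r + s) (\<lambda>\<tau>. F \<tau> * G \<tau>)"
proof -
  obtain u v where u: "u holomorphic_on ball 0 1" "\<forall>x\<in>ball 0 1. u x \<noteq> 0"
     "\<forall>\<tau>. Im \<tau> > 0 \<longrightarrow> F \<tau> = ee (of_real r * \<tau> / of_nat N) * u (ee (\<tau> / of_nat N))"
   and v: "v holomorphic_on ball 0 1" "\<forall>x\<in>ball 0 1. v x \<noteq> 0"
     "\<forall>\<tau>. Im \<tau> > 0 \<longrightarrow> G \<tau> = ee (of_real s * \<tau> / of_nat N) * v (ee (\<tau> / of_nat N))"
    using assms unfolding has_order_def by metis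
  have "ee (of_real (r + s) * \<tau> / of_nat N) = ee (of_real r * \<tau> / of_nat N) * ee (of_real s * \<tau> / of_nat N)" for \<tau>
    unfolding ee_add[symmetric] by (rule arg_cong[where f = ee]) (simp add: ring_distribs add_divide_distrib)
  thus ?thesis unfolding has_order_def
    by (intro exI[of _ "\<lambda>x. u x * v x"]) (use u v in \<open>auto intro!: holomorphic_intros\<close>)
qed

lemma has_order_powi:
  assumes "has_order N r F"
  shows "has_order N (of_int n * r) (\<lambda>\<tau>. F \<tau> powi n)"
proof -
  obtain u where u: "u holomorphic_on ball 0 1" "\<forall>x\<in>ball 0 1. u x \<noteq> 0"
     "\<forall>\<tau>. Im \<tau> > 0 \<longrightarrow> F \<tau> = ee (of_real r * \<tau> / of_nat N) * u (ee (\<tau> / of_nat N))"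
    using assms unfolding has_order_def by metis
  have "ee (of_real (of_int n * r) * \<tau> / of_nat N) = ee (of_real r * \<tau> / of_nat N) powi n" for \<tau>
    unfolding ee_of_int_mult[symmetric] by (rule arg_cong[where f = ee]) (simp add: mult_ac)
  thus ?thesis unfolding has_order_def
    by (intro exI[of _ "\<lambda>x. u x powi n"])
       (use u in \<open>auto intro!: holomorphic_intros simp: power_int_mult_distrib\<close>)
qed

lemma has_order_prod:
  assumes "finite S" "\<And>j. j \<in> S \<Longrightarrow> has_order N (r j) (F j)"
  shows "has_order N (\<Sum>j\<in>S. r j) (\<lambda>\<tau>. \<Prod>j\<in>S. F j \<tau>)"
  using assms
proof (induction S rule: finite_induct)
  case empty
  show ?case using has_order_const[of 1] by simp
next
  case (insert x S)
  have "has_order N (r x + (\<Sum>j\<in>S. r j)) (\<lambda>\<tau>. F x \<tau> * (\<Prod>j\<in>S. F j \<tau>))"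
    using insert by (intro has_order_mult) auto
  thus ?case using insert by simp
qed

lemma has_order_qpoch:
  assumes N: "N > 0" and z: "norm \<zeta> = 1" "norm \<xi> = 1" and n: "n > 0" and i: "i > 0 \<or> \<zeta> \<noteq> 1"
    and F: "\<And>\<tau>. Im \<tau> > 0 \<Longrightarrow> F \<tau> = qpochhammer_inf (\<zeta> * ee (\<tau> / of_nat N) ^ i) (\<xi> * ee (\<tau> / of_nat N) ^ n)"
  shows "has_order N 0 F"
proof (rule has_order_unit[of "\<lambda>x. qpochhammer_inf (\<zeta> * x ^ i) (\<xi> * x ^ n)"])
  have less: "norm (\<xi> * x ^ n) < 1" if "x \<in> ball 0 1" for x
  proof -
    have "norm x ^ n < 1" using that n by (intro power_less_one_iff[THEN iffD2]) auto
    thus ?thesis using z by (simp add: norm_mult norm_power)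
  qed
  show "(\<lambda>x. qpochhammer_inf (\<zeta> * x ^ i) (\<xi> * x ^ n)) holomorphic_on ball 0 1"
    by (rule holomorphic_on_qpoch) (use less in \<open>auto intro!: holomorphic_intros\<close>)
  fix x :: complex assume x: "x \<in> ball 0 1"
  show "qpochhammer_inf (\<zeta> * x ^ i) (\<xi> * x ^ n) \<noteq> 0"
  proof
    assume "qpochhammer_inf (\<zeta> * x ^ i) (\<xi> * x ^ n) = 0"
    then obtain m where m: "\<zeta> * x ^ i * (\<xi> * x ^ n) ^ m = 1"
      using qpoch_eq_0_iff[OF less[OF x]] by blast
    hence "norm (\<zeta> * x ^ i * (\<xi> * x ^ n) ^ m) = 1" by simp
    hence "norm x ^ (i + n * m) = 1"
      using z by (simp add: norm_mult norm_power power_mult power_add)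
    hence "i + n * m = 0"
      using x power_less_one_iff[of "norm x" "i + n * m"] by fastforce
    hence "i = 0" "m = 0" using n by auto
    thus False using m i by simp
  qed
qed (use F in auto)

text \<open>The argument \<open>e\<^sup>2 \<tau>/N + \<beta>\<close> is the one that occurs at a cusp \<open>a/c\<close> with
  \<open>gcd N c = e\<close>. The last assumption says that the point is not in the lattice.\<close>

lemma klein_has_order:
  fixes \<rho> e :: nat and s \<beta> :: real
  assumes N: "N > 0" and e: "e > 0" and \<rho>: "\<rho> < e" and s: "\<rho> > 0 \<or> s \<notin> \<int>"
  shows "has_order N (- real (\<rho> * (e - \<rho>)) / 2)
     (\<lambda>\<tau>. klein (of_nat \<rho> / of_nat e) (of_real s) (of_nat (e * e) * \<tau> / of_nat N + of_real \<beta>))"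
proof -
  define r where "r = real \<rho> / real e"
  have rc: "of_nat \<rho> / of_nat e = (of_real r :: complex)" by (simp add: r_def)
  define T where "T \<tau> = of_nat (e * e) * \<tau> / of_nat N + (of_real \<beta> :: complex)" for \<tau>
  define X where "X \<tau> = ee (\<tau> / of_nat N)" for \<tau>
  have Xp: "X \<tau> ^ n = ee (of_nat n * \<tau> / of_nat N)" for n \<tau>
    by (simp add: X_def flip: ee_of_nat_mult)
  have re: "r * real (e * e) = real (e * \<rho>)" using e by (simp add: r_def)
  have rec: "of_real r * of_nat (e * e) = (of_nat (e * \<rho>) :: complex)"
    using arg_cong[OF re, of complex_of_real] by (simp only: of_real_mult of_real_of_nat_eq)
  have E1: "ee (T \<tau>) = ee (of_real \<beta>) * X \<tau> ^ (e * e)" for \<tau>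
    unfolding Xp T_def ee_add by simp
  have w: "of_real r * T \<tau> + of_real s = of_real (r * \<beta> + s) + of_nat (e * \<rho>) * \<tau> / of_nat N" for \<tau>
  proof -
    have "of_real r * T \<tau> = (of_real r * of_nat (e * e)) * \<tau> / of_nat N + of_real (r * \<beta>)"
      by (simp add: T_def ring_distribs)
    thus ?thesis unfolding rec by simp
  qed
  have E2: "ee (of_real r * T \<tau> + of_real s) = ee (of_real (r * \<beta> + s)) * X \<tau> ^ (e * \<rho>)" for \<tau>
    unfolding w Xp ee_add ..
  have w': "T \<tau> - (of_real r * T \<tau> + of_real s) = of_real (\<beta> - r * \<beta> - s) + of_nat (e * (e - \<rho>)) * \<tau> / of_nat N" for \<tau>
  proof -
    have "of_nat (e * (e - \<rho>)) = (of_nat (e * e) - of_nat (e * \<rho>) :: complex)"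
      using \<rho> by (simp add: of_nat_diff ring_distribs)
    thus ?thesis unfolding w by (simp add: T_def diff_divide_distrib left_diff_distrib)
  qed
  have E3: "ee (T \<tau> - (of_real r * T \<tau> + of_real s)) = ee (of_real (\<beta> - r * \<beta> - s)) * X \<tau> ^ (e * (e - \<rho>))" for \<tau>
    unfolding w' Xp ee_add ..
  have nr: "norm (ee (of_real x)) = 1" for x by (simp add: norm_ee)
  have O1: "has_order N 0 (\<lambda>\<tau>. qpochhammer_inf (ee (of_real r * T \<tau> + of_real s)) (ee (T \<tau>)))"
  proof (rule has_order_qpoch[OF N nr[of "r * \<beta> + s"] nr[of \<beta>], of "e * e" "e * \<rho>"])
    show "e * e > 0" using e by simp
    show "e * \<rho> > 0 \<or> ee (of_real (r * \<beta> + s)) \<noteq> 1"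
    proof (cases "\<rho> = 0")
      case True
      have "ee (of_real s) \<noteq> 1"
      proof
        assume "ee (of_real s) = 1"
        then obtain n :: int where "complex_of_real s = of_int n" using ee_eq_1_iff by blast
        hence "s = of_int n" by (metis of_real_eq_iff of_real_of_int_eq)
        thus False using s True by auto
      qed
      thus ?thesis using True by (simp add: r_def)
    qed (use e in auto)
  qed (simp add: E1 E2 X_def)
  have O2: "has_order N 0 (\<lambda>\<tau>. qpochhammer_inf (ee (T \<tau> - (of_real r * T \<tau> + of_real s))) (ee (T \<tau>)))"
    by (rule has_order_qpoch[OF N nr[of "\<beta> - r * \<beta> - s"] nr[of \<beta>], of "e * e" "e * (e - \<rho>)"])
       (use e \<rho> in \<open>auto simp: E1 E3 X_def\<close>)
  have O3: "has_order N 0 (\<lambda>\<tau>. qpochhammer_inf (ee (T \<tau>)) (ee (T \<tau>)))"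
    by (rule has_order_qpoch[OF N nr[of \<beta>] nr[of \<beta>], of "e * e" "e * e"])
       (use e in \<open>auto simp: E1 X_def\<close>)
  have O4: "has_order N (- real (\<rho> * (e - \<rho>)) / 2)
     (\<lambda>\<tau>. ee (of_real r * (of_real r * T \<tau> + of_real s) / 2) * ee (- (of_real r * T \<tau> + of_real s) / 2))"
  proof -
    define c where "c = ee (of_real ((r - 1) * (r * \<beta> + s) / 2))"
    have "has_order N (0 + (- real (\<rho> * (e - \<rho>)) / 2)) (\<lambda>\<tau>. c * ee (of_real (- real (\<rho> * (e - \<rho>)) / 2) * \<tau> / of_nat N))"
      by (intro has_order_mult has_order_const has_order_ee) (simp add: c_def)
    moreover have "c * ee (of_real (- real (\<rho> * (e - \<rho>)) / 2) * \<tau> / of_nat N)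
       = ee (of_real r * (of_real r * T \<tau> + of_real s) / 2) * ee (- (of_real r * T \<tau> + of_real s) / 2)" for \<tau>
    proof -
      have "r * real e = real \<rho>" using e by (simp add: r_def)
      hence "(r - 1) * real (e * \<rho>) = real \<rho> * real \<rho> - real e * real \<rho>"
        by (simp add: left_diff_distrib flip: mult.assoc)
      also have "\<dots> = - (real \<rho> * (real e - real \<rho>))" by (simp add: right_diff_distrib mult.commute)
      also have "\<dots> = - real (\<rho> * (e - \<rho>))" using \<rho> by (simp add: of_nat_diff)
      finally have "of_real (- real (\<rho> * (e - \<rho>)) / 2) = (of_real ((r - 1) * real (e * \<rho>) / 2) :: complex)"
        by (simp only:)
      also have "\<dots> = (of_real r - 1) * of_nat (e * \<rho>) / 2" by simp
      finally have eq: "of_real (- real (\<rho> * (e - \<rho>)) / 2) = ((of_real r - 1) * of_nat (e * \<rho>) / 2 :: complex)" .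
      have gen: "R * W / 2 + - W / 2 = (R - 1) * W / 2" for R W :: complex
        by (simp add: left_diff_distrib diff_divide_distrib)
      have "of_real r * (of_real r * T \<tau> + of_real s) / 2 + - (of_real r * T \<tau> + of_real s) / 2
         = (of_real r - 1) * (of_real r * T \<tau> + of_real s) / 2" for \<tau>
        by (rule gen)
      also have "\<dots> \<tau> = of_real ((r - 1) * (r * \<beta> + s) / 2) + ((of_real r - 1) * of_nat (e * \<rho>) / 2) * \<tau> / of_nat N" for \<tau>
        unfolding w by (simp add: ring_distribs add_divide_distrib diff_divide_distrib mult_ac)
      finally show ?thesis unfolding ee_add[symmetric] c_def eq by simp
    qed
    ultimately show ?thesis by simp
  qed
  have ho: "has_order N ((- real (\<rho> * (e - \<rho>)) / 2) + 0 + 0 + of_int (- 2) * 0)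
    (\<lambda>\<tau>. ee (of_real r * (of_real r * T \<tau> + of_real s) / 2) * ee (- (of_real r * T \<tau> + of_real s) / 2)
       * qpochhammer_inf (ee (of_real r * T \<tau> + of_real s)) (ee (T \<tau>))
       * qpochhammer_inf (ee (T \<tau> - (of_real r * T \<tau> + of_real s))) (ee (T \<tau>))
       * qpochhammer_inf (ee (T \<tau>)) (ee (T \<tau>)) powi (- 2))"
    by (intro has_order_mult has_order_powi O1 O2 O3 O4)
  have inv: "x powi (- 2) = inverse (x\<^sup>2)" for x :: complex
    by (simp add: power_int_def power_inverse)
  show ?thesis
    unfolding rc T_def[symmetric] klein_def theta_def
    by (rule has_order_cong[OF ho]) (simp only: inv divide_inverse mult.assoc, simp)
qed

lemma Delta_has_order:
  fixes e :: nat and \<beta> :: real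
  assumes N: "N > 0" and e: "e > 0"
  shows "has_order N (real (e * e)) (\<lambda>\<tau>. Delta (of_nat (e * e) * \<tau> / of_nat N + of_real \<beta>))"
proof -
  define T where "T \<tau> = of_nat (e * e) * \<tau> / of_nat N + (of_real \<beta> :: complex)" for \<tau>
  have E1: "ee (T \<tau>) = ee (of_real \<beta>) * ee (\<tau> / of_nat N) ^ (e * e)" for \<tau>
    by (simp add: T_def ee_add flip: ee_of_nat_mult)
  have nr: "norm (ee (of_real x)) = 1" for x by (simp add: norm_ee)
  have O3: "has_order N 0 (\<lambda>\<tau>. qpochhammer_inf (ee (T \<tau>)) (ee (T \<tau>)))"
    by (rule has_order_qpoch[OF N nr[of \<beta>] nr[of \<beta>], of "e * e" "e * e"])
       (use e in \<open>auto simp: E1\<close>)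
  have "has_order N (0 + real (e * e) + of_int 24 * 0)
     (\<lambda>\<tau>. ee (of_real \<beta>) * ee (of_real (real (e * e)) * \<tau> / of_nat N) * qpochhammer_inf (ee (T \<tau>)) (ee (T \<tau>)) powi 24)"
    by (intro has_order_mult has_order_powi O3 has_order_const has_order_ee) simp
  thus ?thesis
    unfolding T_def[symmetric] Delta_def
    by (rule has_order_cong) (simp_all add: E1 flip: ee_of_nat_mult)
qed

text \<open>The order of vanishing of an eta quotient at the cusp \<open>a/c\<close>, in units of \<open>1/N\<close> with respect
  to \<open>q\<close>.\<close>

definition cusp_order :: "nat \<Rightarrow> int \<Rightarrow> (nat \<Rightarrow> int) \<Rightarrow> int \<Rightarrow> int \<Rightarrow> real" where
  "cusp_order N D b e a = of_int (e * e * D)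
     - (\<Sum>j=1..N div 2. of_int (b j * ((int j * a) mod e) * (e - (int j * a) mod e)) / 2)"

text \<open>The matrix \<open>diag (N, 1)\<close> times the given one is the product of an integral matrix of determinant
  \<open>1\<close> with the entries \<open>a'\<close>, \<open>b'\<close>, \<open>c'\<close>, \<open>d'\<close> and an
  upper triangular matrix with the diagonal \<open>(e, N/e)\<close>, where \<open>e = gcd N c\<close>.\<close>

lemma moebius_degeneracy:
  fixes a b c d :: int and N :: nat
  assumes N: "N > 0" and det: "a * d - b * c = 1"
  defines "e \<equiv> gcd (int N) c"
  obtains a' b' c' d' :: int and \<beta> :: real
  where "a' * d' - b' * c' = 1" "e * a' = int N * a" "e * c' = c"
    "\<And>\<tau>. Im \<tau> > 0 \<Longrightarrow> Im (of_nat (nat e * nat e) * \<tau> / of_nat N + of_real \<beta>) > 0 \<and>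
        of_int c' * (of_nat (nat e * nat e) * \<tau> / of_nat N + of_real \<beta>) + of_int d' = of_int e / of_nat N * (of_int c * \<tau> + of_int d) \<and>
        of_nat N * ((of_int a * \<tau> + of_int b) / (of_int c * \<tau> + of_int d))
           = (of_int a' * (of_nat (nat e * nat e) * \<tau> / of_nat N + of_real \<beta>) + of_int b')
              / (of_int c' * (of_nat (nat e * nat e) * \<tau> / of_nat N + of_real \<beta>) + of_int d')"
proof -
  have e: "e > 0" using N by (simp add: e_def)
  define n' where "n' = int N div e"
  define c' where "c' = c div e"
  have n': "int N = e * n'" and c': "c = e * c'" by (simp_all add: n'_def c'_def e_def)
  have "coprime a c"
  proof (rule coprimeI)
    fix x assume "x dvd a" "x dvd c"
    hence "x dvd a * d - b * c" by (intro dvd_diff dvd_mult2[of x a] dvd_mult[of x c])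
    thus "is_unit x" using det by simp
  qed
  have "e * gcd n' c' = e"
  proof -
    have "gcd (int N) c = e" by (simp add: e_def)
    hence "gcd (e * n') (e * c') = e" by (simp only: n'[symmetric] c'[symmetric])
    thus ?thesis using gcd_mult_distrib_int[of e n' c'] e by simp
  qed
  hence "coprime n' c'" using e by (simp add: coprime_iff_gcd_eq_1)
  moreover have "coprime a c'" using \<open>coprime a c\<close> unfolding c' by simp
  ultimately have "coprime (n' * a) c'" by simp
  then obtain x y where xy: "x * (n' * a) + y * c' = 1"
    using bezout_int[of "n' * a" c'] by (auto simp: coprime_iff_gcd_eq_1)
  define a' b' d' where "a' = n' * a" and "b' = - y" and "d' = x"
  have det': "a' * d' - b' * c' = 1" using xy by (simp add: a'_def b'_def d'_def algebra_simps)
  define B where "B = d' * (int N * b) - b' * d"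
  have B1: "a' * B + b' * n' = int N * b"
  proof -
    have "a' * B + b' * n' = int N * b * (a' * d') - b' * (n' * (a * d - 1))"
      by (simp add: B_def a'_def algebra_simps)
    also have "a * d - 1 = b * (e * c')" using det unfolding c'[symmetric] by simp
    also have "int N * b * (a' * d') - b' * (n' * (b * (e * c'))) = int N * b * (a' * d' - b' * c')"
      unfolding n' by (simp add: algebra_simps)
    finally show ?thesis unfolding det' by simp
  qed
  have B2: "c' * B + d' * n' = d"
  proof -
    have "c' * B + d' * n' = d' * n' * ((e * c') * b + 1) - b' * c' * d"
      unfolding B_def n' by (simp add: algebra_simps)
    also have "(e * c') * b + 1 = c * b + 1" unfolding c'[symmetric] ..
    also have "c * b + 1 = a * d" using det by (simp add: algebra_simps)
    also have "d' * n' * (a * d) - b' * c' * d = d * (a' * d' - b' * c')"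
      by (simp add: a'_def algebra_simps)
    finally show ?thesis unfolding det' by simp
  qed
  define \<beta> where "\<beta> = real_of_int B / real_of_int n'"
  have n'0: "n' > 0"
  proof -
    have "e * n' > 0" unfolding n'[symmetric] using N by simp
    thus ?thesis using e zero_less_mult_pos by blast
  qed
  have Nc: "of_nat N = (of_int e * of_int n' :: complex)"
    using arg_cong[OF n', of "of_int :: int \<Rightarrow> complex"] by simp
  have ne: "of_nat (nat e * nat e) = (of_int e * of_int e :: complex)" using e by simp
  have nz: "of_int e \<noteq> (0::complex)" "of_int n' \<noteq> (0::complex)" using e n'0 by auto
  show ?thesis
  proof (rule that[of a' d' b' c' \<beta>])
    show "a' * d' - b' * c' = 1" by (rule det')
    show "e * a' = int N * a" "e * c' = c" by (simp_all add: a'_def n' c')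
    fix \<tau> :: complex assume t: "Im \<tau> > 0"
    define T where "T = of_nat (nat e * nat e) * \<tau> / of_nat N + complex_of_real \<beta>"
    have T: "T * of_int n' = of_int e * \<tau> + of_int B"
      using nz unfolding T_def ne Nc \<beta>_def by (simp add: field_simps)
    have Teq: "T = of_real (real (nat e * nat e) / real N) * \<tau> + of_real \<beta>" by (simp add: T_def)
    have "Im T = real (nat e * nat e) / real N * Im \<tau>" by (subst Teq) simp
    moreover have "real (nat e * nat e) / real N > 0" using e N by simp
    ultimately have ImT: "Im T > 0" using t mult_pos_pos by metis
    have J: "of_int c' * T + of_int d' = of_int e / of_nat N * (of_int c * \<tau> + of_int d)"
    proof -
      have "(of_int c' * T + of_int d') * of_int n' = of_int c' * (T * of_int n') + of_int (d' * n')" by (simp add: algebra_simps)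
      also have "\<dots> = of_int (e * c') * \<tau> + of_int (c' * B + d' * n')" by (simp add: T algebra_simps)
      also have "\<dots> = of_int c * \<tau> + of_int d" unfolding B2 c'[symmetric] ..
      finally show ?thesis using nz by (simp add: Nc field_simps)
    qed
    have A: "(of_int a' * T + of_int b') * of_int n' = of_nat N * (of_int a * \<tau> + of_int b)"
    proof -
      have "(of_int a' * T + of_int b') * of_int n' = of_int a' * (T * of_int n') + of_int (b' * n')" by (simp add: algebra_simps)
      also have "\<dots> = of_int (e * a') * \<tau> + of_int (a' * B + b' * n')" by (simp add: T algebra_simps)
      also have "\<dots> = of_int (int N * a) * \<tau> + of_int (int N * b)" unfolding B1 by (simp add: a'_def n' mult.assoc)
      finally show ?thesis by (simp add: algebra_simps)
    qed
    have nzJ: "of_int c * \<tau> + of_int d \<noteq> 0" using im_moebius_pos[OF det t] by simp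
    have "of_nat N * ((of_int a * \<tau> + of_int b) / (of_int c * \<tau> + of_int d))
        = (of_int a' * T + of_int b') * of_int n' / (of_int c * \<tau> + of_int d)" unfolding A by simp
    also have "\<dots> = (of_int a' * T + of_int b') / (of_int c' * T + of_int d')"
      unfolding J Nc using nz nzJ by simp
    finally show "Im (of_nat (nat e * nat e) * \<tau> / of_nat N + of_real \<beta>) > 0 \<and>
        of_int c' * (of_nat (nat e * nat e) * \<tau> / of_nat N + of_real \<beta>) + of_int d' = of_int e / of_nat N * (of_int c * \<tau> + of_int d) \<and>
        of_nat N * ((of_int a * \<tau> + of_int b) / (of_int c * \<tau> + of_int d))
           = (of_int a' * (of_nat (nat e * nat e) * \<tau> / of_nat N + of_real \<beta>) + of_int b')
              / (of_int c' * (of_nat (nat e * nat e) * \<tau> / of_nat N + of_real \<beta>) + of_int d')"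
      using ImT J unfolding T_def by blast
  qed
qed

text \<open>The product of the given matrix with \<open>diag (N, 1)\<close> is decomposed as in \<open>moebius_degeneracy\<close>,
  the integral factor acts by \<open>klein_modular\<close> and \<open>Delta_modular\<close>, and the row vectors are
  reduced modulo the lattice by \<open>klein_shift\<close>.\<close>

lemma klein_quotient_cusp:
  fixes a b c d :: int and N :: nat
  assumes N: "N > 0" and det: "a * d - b * c = 1"
  defines "e \<equiv> gcd (int N) c"
  shows "has_order N (cusp_order N D f e a)
     (\<lambda>\<tau>. klein_quotient N D f ((of_int a * \<tau> + of_int b) / (of_int c * \<tau> + of_int d))
        / (of_int c * \<tau> + of_int d) powi (12 * D - (\<Sum>j=1..N div 2. f j)))"
proof -
  have e: "e > 0" using N by (simp add: e_def)
  obtain a' b' c' d' :: int and \<beta> :: real where A': "a' * d' - b' * c' = 1" "e * a' = int N * a" "e * c' = c"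
    and *: "\<And>\<tau>. Im \<tau> > 0 \<Longrightarrow> Im (of_nat (nat e * nat e) * \<tau> / of_nat N + of_real \<beta>) > 0 \<and>
        of_int c' * (of_nat (nat e * nat e) * \<tau> / of_nat N + of_real \<beta>) + of_int d' = of_int e / of_nat N * (of_int c * \<tau> + of_int d) \<and>
        of_nat N * ((of_int a * \<tau> + of_int b) / (of_int c * \<tau> + of_int d))
           = (of_int a' * (of_nat (nat e * nat e) * \<tau> / of_nat N + of_real \<beta>) + of_int b')
              / (of_int c' * (of_nat (nat e * nat e) * \<tau> / of_nat N + of_real \<beta>) + of_int d')"
    using moebius_degeneracy[OF N det] unfolding e_def by metis
  define T where "T \<tau> = of_nat (nat e * nat e) * \<tau> / of_nat N + complex_of_real \<beta>" for \<tau>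
  note * = *[folded T_def]
  define \<rho> where "\<rho> j = nat ((int j * a) mod e)" for j :: nat
  define m where "m j = (int j * a) div e" for j :: nat
  define s where "s j = real_of_int (int j * b') / real N" for j :: nat
  have \<rho>: "int (\<rho> j) = (int j * a) mod e" for j using e by (simp add: \<rho>_def)
  have \<rho>e: "\<rho> j < nat e" for j using e by (simp add: \<rho>_def nat_less_eq_zless)
  \<comment> \<open>the two entries of the row vector \<open>(j/N, 0)\<close> times the integral matrix\<close>
  have idx: "of_nat j / of_nat N * of_int a' + 0 * of_int c' = of_nat (\<rho> j) / of_nat (nat e) + (of_int (m j) :: complex)"
    "of_nat j / of_nat N * of_int b' + 0 * of_int d' = complex_of_real (s j) + of_int 0" for j
  proof -
    have "int j * a = int (\<rho> j) + e * m j" unfolding \<rho> m_def by simp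
    hence "of_int (int j * a) = (of_int (int (\<rho> j) + e * m j) :: complex)" by (simp only:)
    hence 1: "of_nat j * of_int a = of_nat (\<rho> j) + of_int e * (of_int (m j) :: complex)" by simp
    have "of_int (e * a') = (of_int (int N * a) :: complex)" by (simp only: A')
    hence 2: "of_int e * of_int a' = of_nat N * (of_int a :: complex)" by simp
    have ne: "of_int e \<noteq> (0::complex)" "of_nat N \<noteq> (0::complex)" using e N by auto
    have nate: "of_nat (nat e) = (of_int e :: complex)" using e by simp
    have "of_nat j / of_nat N * of_int a' = of_nat j * (of_int e * of_int a') / (of_nat N * (of_int e :: complex))"
      using ne by simp
    also have "\<dots> = (of_nat j * of_int a) / (of_int e :: complex)" unfolding 2 using ne by simp
    also have "\<dots> = of_nat (\<rho> j) / of_int e + of_int (m j)" unfolding 1 using ne by (simp add: add_divide_distrib)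
    finally show "of_nat j / of_nat N * of_int a' + 0 * of_int c' = of_nat (\<rho> j) / of_nat (nat e) + (of_int (m j) :: complex)"
      unfolding nate by simp
    show "of_nat j / of_nat N * of_int b' + 0 * of_int d' = complex_of_real (s j) + of_int 0"
      by (simp add: s_def)
  qed
  \<comment> \<open>The point is not in the lattice, because \<open>j/N\<close> is not an integer and the matrix is invertible.\<close>
  have nondeg: "\<rho> j > 0 \<or> s j \<notin> \<int>" if j: "j \<in> {1..N div 2}" for j
  proof (rule ccontr)
    assume "\<not> (\<rho> j > 0 \<or> s j \<notin> \<int>)"
    hence r0: "\<rho> j = 0" and "s j \<in> \<int>" by auto
    then obtain n :: int where n: "s j = of_int n" by (auto elim: Ints_cases)
    hence "real_of_int (int j * b') = real_of_int (n * int N)" using N by (simp add: s_def field_simps)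
    hence n': "int j * b' = n * int N" by (simp only: of_int_eq_iff)
    have "int j * a = e * m j" using r0 \<rho>[of j] unfolding m_def by (metis add.right_neutral mult_div_mod_eq of_nat_0)
    hence "e * (int j * a') = e * (int N * m j)" using A'(2) by (metis mult.assoc mult.commute)
    hence m': "int j * a' = int N * m j" using e by simp
    have "int j = (int j * a') * d' - (int j * b') * c'" using A'(1)
      by (metis mult.assoc mult.commute mult.right_neutral right_diff_distrib)
    also have "\<dots> = int N * (m j * d' - n * c')" unfolding m' n' by (simp add: algebra_simps)
    finally have "int N dvd int j" by simp
    hence "N dvd j" by simp
    hence "N \<le> j" using j by (intro dvd_imp_le) auto
    moreover have "j \<le> N div 2" "N div 2 < N" using j N by auto
    ultimately show False by linarith
  qed
  define C where "C j = ee ((of_int (m j + 0 + m j * 0) + of_nat (\<rho> j) / of_nat (nat e) * of_int 0 - of_int (m j) * of_real (s j)) / 2)" for j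
  define \<kappa> where "\<kappa> = 12 * D - (\<Sum>j=1..N div 2. f j)"
  define h where "h = (of_int e / of_nat N :: complex)"
  have h: "h \<noteq> 0" using e N by (simp add: h_def)
  have "has_order N (0 + (of_int D * real (nat e * nat e)) + (\<Sum>j=1..N div 2. of_int (f j) * (0 + - real (\<rho> j * (nat e - \<rho> j)) / 2)))
    (\<lambda>\<tau>. h powi \<kappa> * Delta (T \<tau>) powi D * (\<Prod>j=1..N div 2. (C j * klein (of_nat (\<rho> j) / of_nat (nat e)) (of_real (s j)) (T \<tau>)) powi f j))"
    unfolding T_def using e h nondeg
    by (intro has_order_mult has_order_powi has_order_prod has_order_const Delta_has_order klein_has_order N \<rho>e)
       (auto simp: C_def)
  thus ?thesis
  proof (rule has_order_cong)
    fix \<tau> :: complex assume t: "Im \<tau> > 0"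
    define J where "J = of_int c * \<tau> + of_int d"
    have J: "J \<noteq> 0" using im_moebius_pos[OF det t] by (simp add: J_def)
    note ** = *[OF t, folded J_def h_def]
    have t': "Im (T \<tau>) > 0" and J': "of_int c' * T \<tau> + of_int d' = h * J"
      and M: "of_nat N * ((of_int a * \<tau> + of_int b) / J) = (of_int a' * T \<tau> + of_int b') / (of_int c' * T \<tau> + of_int d')"
      using ** by auto
    have K: "klein (of_nat j / of_nat N) 0 ((of_int a' * T \<tau> + of_int b') / (of_int c' * T \<tau> + of_int d'))
       = C j * klein (of_nat (\<rho> j) / of_nat (nat e)) (of_real (s j)) (T \<tau>) / (h * J)" for j
      unfolding klein_modular[OF A'(1) t'] unfolding idx klein_shift[OF t'] C_def J' by (rule refl)
    have "(\<Prod>j=1..N div 2. (C j * klein (of_nat (\<rho> j) / of_nat (nat e)) (of_real (s j)) (T \<tau>) / (h * J)) powi f j)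
       = (\<Prod>j=1..N div 2. (C j * klein (of_nat (\<rho> j) / of_nat (nat e)) (of_real (s j)) (T \<tau>)) powi f j) / (h * J) powi (\<Sum>j=1..N div 2. f j)"
      unfolding power_int_divide_distrib prod_dividef using h J by (subst prod_powi_const) auto
    hence KQ: "klein_quotient N D f ((of_int a * \<tau> + of_int b) / J)
      = ((h * J) ^ 12 * Delta (T \<tau>)) powi D * ((\<Prod>j=1..N div 2. (C j * klein (of_nat (\<rho> j) / of_nat (nat e)) (of_real (s j)) (T \<tau>)) powi f j) / (h * J) powi (\<Sum>j=1..N div 2. f j))"
      unfolding klein_quotient_def M K using Delta_modular[OF A'(1) t'] by (simp only: J')
    have "((h * J) ^ 12) powi D = (h * J) powi (12 * D)"
      using power_int_mult[of "h * J" 12 D] by simp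
    hence E1: "((h * J) ^ 12 * Delta (T \<tau>)) powi D = (h * J) powi (12 * D) * Delta (T \<tau>) powi D"
      by (simp only: power_int_mult_distrib)
    have E2: "(h * J) powi (12 * D) / (h * J) powi (\<Sum>j=1..N div 2. f j) = h powi \<kappa> * J powi \<kappa>"
      using h J unfolding \<kappa>_def power_int_mult_distrib[symmetric] by (subst power_int_diff) auto
    have "klein_quotient N D f ((of_int a * \<tau> + of_int b) / J) =
       (h powi \<kappa> * J powi \<kappa>) * Delta (T \<tau>) powi D * (\<Prod>j=1..N div 2. (C j * klein (of_nat (\<rho> j) / of_nat (nat e)) (of_real (s j)) (T \<tau>)) powi f j)"
      unfolding KQ E1 E2[symmetric] by (simp only: times_divide_eq_right times_divide_eq_left mult_ac)
    thus "h powi \<kappa> * Delta (T \<tau>) powi D * (\<Prod>j=1..N div 2. (C j * klein (of_nat (\<rho> j) / of_nat (nat e)) (of_real (s j)) (T \<tau>)) powi f j)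
      = klein_quotient N D f ((of_int a * \<tau> + of_int b) / (of_int c * \<tau> + of_int d))
        / (of_int c * \<tau> + of_int d) powi (12 * D - (\<Sum>j=1..N div 2. f j))"
      unfolding J_def[symmetric] \<kappa>_def[symmetric] using J by simp
  next
    have r: "real (\<rho> j * (nat e - \<rho> j)) = of_int (((int j * a) mod e) * (e - (int j * a) mod e))" for j
    proof -
      have "int (\<rho> j * (nat e - \<rho> j)) = ((int j * a) mod e) * (e - (int j * a) mod e)"
        using \<rho>e[of j] e by (simp add: of_nat_diff \<rho> less_imp_le)
      thus ?thesis by (metis of_int_of_nat_eq)
    qed
    have e2: "real (nat e * nat e) = of_int (e * e)" using e by simp
    have t: "of_int (f j) * (0 + - real (\<rho> j * (nat e - \<rho> j)) / 2)
       = - (of_int (f j * ((int j * a) mod e) * (e - (int j * a) mod e)) / 2)" for j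
      unfolding r by (simp only: of_int_mult) (simp add: mult.assoc)
    show "0 + of_int D * real (nat e * nat e) + (\<Sum>j=1..N div 2. of_int (f j) * (0 + - real (\<rho> j * (nat e - \<rho> j)) / 2))
       = cusp_order N D f e a"
      unfolding cusp_order_def e2 t sum_negf by (simp add: mult.commute)
  qed
qed

text \<open>Under a matrix of \<open>\<Gamma>\<^sub>1(N)\<close> the row vector \<open>(j/N, 0)\<close> changes by the lattice
  vector \<open>(j u, j b)\<close>, so that \<open>klein_shift\<close> yields the character.\<close>

lemma klein_quotient_Gamma1:
  fixes a b c d u :: int and N :: nat
  assumes N: "N > 0" and det: "a * d - b * (int N * c) = 1" and a: "a = 1 + int N * u" and t: "Im \<tau> > 0"
  shows "klein_quotient N D f ((of_int a * \<tau> + of_int b) / (of_int (int N * c) * \<tau> + of_int d))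
    = (of_int (int N * c) * \<tau> + of_int d) powi (12 * D - (\<Sum>j=1..N div 2. f j))
      * ee ((of_int (\<Sum>j=1..N div 2. f j * (int j * u + int j * b + int j * u * (int j * b)))
            + of_int (\<Sum>j=1..N div 2. f j * (int j * int j * b)) / of_nat N) / 2)
      * klein_quotient N D f \<tau>"
proof -
  define T where "T = of_nat N * \<tau>"
  have T: "Im T > 0" using N t by (simp add: T_def)
  have nN: "of_nat N \<noteq> (0::complex)" using N by simp
  define J where "J = of_int (int N * c) * \<tau> + of_int d"
  have J: "J \<noteq> 0" using im_moebius_pos[OF det t] by (simp add: J_def)
  have det': "a * d - (int N * b) * c = 1" using det by (simp add: mult_ac)
  have J': "of_int c * T + of_int d = J" by (simp add: J_def T_def mult_ac)
  have M: "of_nat N * ((of_int a * \<tau> + of_int b) / J) = (of_int a * T + of_int (int N * b)) / (of_int c * T + of_int d)"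
    unfolding J' by (simp add: T_def ring_distribs mult_ac)
  define X where "X j = (of_int (int j * u + int j * b + int j * u * (int j * b)) + of_int (int j * int j * b) / of_nat N :: complex)" for j
  have K: "klein (of_nat j / of_nat N) 0 ((of_int a * T + of_int (int N * b)) / (of_int c * T + of_int d))
     = ee (X j / 2) * klein (of_nat j / of_nat N) 0 T / J" for j
  proof -
    have i1: "of_nat j / of_nat N * of_int a + 0 * of_int c = of_nat j / of_nat N + (of_int (int j * u) :: complex)"
      using nN unfolding a by (simp add: field_simps)
    have i2: "of_nat j / of_nat N * of_int (int N * b) + 0 * of_int d = 0 + (of_int (int j * b) :: complex)"
      using nN by simp
    have Xe: "(of_int (int j * u + int j * b + int j * u * (int j * b)) + of_nat j / of_nat N * of_int (int j * b) - of_int (int j * u) * 0) = X j"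
      by (simp add: X_def)
    show ?thesis
      unfolding klein_modular[OF det' T] unfolding i1 i2 klein_shift[OF T] Xe J' by (rule refl)
  qed
  have "(\<Prod>j=1..N div 2. (ee (X j / 2) * klein (of_nat j / of_nat N) 0 T / J) powi f j)
     = (\<Prod>j=1..N div 2. ee (of_int (f j) * (X j / 2))) * (\<Prod>j=1..N div 2. klein (of_nat j / of_nat N) 0 T powi f j)
        / J powi (\<Sum>j=1..N div 2. f j)"
    unfolding power_int_divide_distrib power_int_mult_distrib prod_dividef prod.distrib ee_of_int_mult
    using J by (subst prod_powi_const) auto
  also have "(\<Prod>j=1..N div 2. ee (of_int (f j) * (X j / 2))) = ee (\<Sum>j=1..N div 2. of_int (f j) * (X j / 2))"
    by (rule prod_ee) simp
  also have "(\<Sum>j=1..N div 2. of_int (f j) * (X j / 2)) = (of_int (\<Sum>j=1..N div 2. f j * (int j * u + int j * b + int j * u * (int j * b)))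
            + of_int (\<Sum>j=1..N div 2. f j * (int j * int j * b)) / of_nat N) / 2" (is "_ = ?Y / 2")
  proof -
    have "(\<Sum>j=1..N div 2. of_int (f j) * (X j / 2)) = (\<Sum>j=1..N div 2. (of_int (f j * (int j * u + int j * b + int j * u * (int j * b)))
       + of_int (f j * (int j * int j * b)) / of_nat N) / 2)"
      by (intro sum.cong refl) (simp only: X_def of_int_mult of_int_add times_divide_eq_right distrib_left)
    thus ?thesis by (simp only: sum_divide_distrib[symmetric] sum.distrib of_int_sum)
  qed
  finally have P: "(\<Prod>j=1..N div 2. (ee (X j / 2) * klein (of_nat j / of_nat N) 0 T / J) powi f j)
     = ee (?Y / 2) * (\<Prod>j=1..N div 2. klein (of_nat j / of_nat N) 0 T powi f j) / J powi (\<Sum>j=1..N div 2. f j)" .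
  have D1: "(J ^ 12 * Delta T) powi D = J powi (12 * D) * Delta T powi D"
    using power_int_mult[of J 12 D] by (simp add: power_int_mult_distrib)
  have D2: "J powi (12 * D - (\<Sum>j=1..N div 2. f j)) = J powi (12 * D) / J powi (\<Sum>j=1..N div 2. f j)"
    using J by (simp add: power_int_diff)
  have "klein_quotient N D f ((of_int a * \<tau> + of_int b) / J)
     = (J ^ 12 * Delta T) powi D * (ee (?Y / 2) * (\<Prod>j=1..N div 2. klein (of_nat j / of_nat N) 0 T powi f j) / J powi (\<Sum>j=1..N div 2. f j))"
    unfolding klein_quotient_def M K P[symmetric] using Delta_modular[OF det' T] by (simp only: J')
  thus ?thesis
    unfolding D1 J_def[symmetric] D2 klein_quotient_def T_def[symmetric]
    by (simp only: times_divide_eq_right times_divide_eq_left mult_ac)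
qed

lemma eq_at_0_of_eq_punctured:
  fixes f g :: "complex \<Rightarrow> complex"
  assumes "continuous_on (ball 0 1) f" "continuous_on (ball 0 1) g"
    "\<And>x. x \<in> ball 0 1 \<Longrightarrow> x \<noteq> 0 \<Longrightarrow> f x = g x"
  shows "f 0 = g 0"
proof -
  have f: "(f \<longlongrightarrow> f 0) (at 0)" and g: "(g \<longlongrightarrow> g 0) (at 0)"
    using assms(1,2) by (auto simp: continuous_on_eq_continuous_at isCont_def)
  have "eventually (\<lambda>x. f x = g x) (at 0)"
    unfolding eventually_at by (rule exI[of _ 1]) (use assms(3) in auto)
  hence "(g \<longlongrightarrow> f 0) (at 0)" using f tendsto_cong by fast
  thus ?thesis using g tendsto_unique[of "at (0::complex)"] by simp
qed

text \<open>The order at \<open>0\<close> of the \<open>p\<close>-th power of a holomorphic function is a multiple of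
  \<open>p\<close>. The proof divides \<open>g\<close> repeatedly by the variable.\<close>

lemma power_eq_monomial_mult_unit:
  assumes "g holomorphic_on ball 0 1" "u holomorphic_on ball 0 1" "u 0 \<noteq> 0" "p > 0"
    "\<And>x. x \<in> ball 0 1 \<Longrightarrow> x \<noteq> 0 \<Longrightarrow> g x ^ p = x ^ n * u x"
  shows "p dvd n"
  using assms
proof (induction n arbitrary: g rule: less_induct)
  case (less n)
  note g = less.prems(1) and u = less.prems(2) and u0 = less.prems(3) and p = less.prems(4) and eq = less.prems(5)
  show ?case
  proof (cases "n = 0")
    case False
    have "continuous_on (ball 0 1) (\<lambda>x. g x ^ p)" "continuous_on (ball 0 1) (\<lambda>x. x ^ n * u x)"
      by (intro holomorphic_on_imp_continuous_on holomorphic_intros g u)+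
    from eq_at_0_of_eq_punctured[OF this eq] have "g 0 ^ p = 0 ^ n * u 0" by simp
    hence g0: "g 0 = 0" using False p by (simp add: power_0_left)
    obtain h where h: "h holomorphic_on ball 0 1" "\<And>z. norm z < 1 \<Longrightarrow> g z = z * h z"
      using Schwarz3[OF g g0] by metis
    have eq': "x ^ p * h x ^ p = x ^ n * u x" if "x \<in> ball 0 1" "x \<noteq> 0" for x
      using eq[OF that] h(2)[of x] that by (simp add: power_mult_distrib)
    show ?thesis
    proof (cases "n < p")
      case True
      have "x ^ (p - n) * h x ^ p = u x" if "x \<in> ball 0 1" "x \<noteq> 0" for x
      proof -
        have "x ^ p = x ^ n * x ^ (p - n)" using True by (simp flip: power_add)
        thus ?thesis using eq'[OF that] that by (simp add: mult.assoc)
      qed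
      moreover have "continuous_on (ball 0 1) (\<lambda>x. x ^ (p - n) * h x ^ p)" "continuous_on (ball 0 1) u"
        by (intro holomorphic_on_imp_continuous_on holomorphic_intros h u)+
      ultimately have "0 ^ (p - n) * h 0 ^ p = u 0"
        using eq_at_0_of_eq_punctured by blast
      thus ?thesis using True u0 by (simp add: power_0_left)
    next
      case nl: False
      have "h x ^ p = x ^ (n - p) * u x" if "x \<in> ball 0 1" "x \<noteq> 0" for x
      proof -
        have "x ^ n = x ^ p * x ^ (n - p)" using nl by (simp flip: power_add)
        thus ?thesis using eq'[OF that] that by (simp add: mult.assoc)
      qed
      hence "p dvd n - p" using less.IH[of "n - p" h] h u u0 p False nl by fastforce
      thus ?thesis using nl by (metis dvd_refl dvd_diffD not_less)
    qed
  qed simp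
qed

text \<open>If \<open>F\<close> is holomorphic at \<open>\<infinity>\<close>, the order of its \<open>p\<close>-th power is a
  natural number divisible by \<open>p\<close>. For \<open>p = 1\<close> this says that the order of \<open>F\<close>
  is a natural number.\<close>

lemma has_order_power_holomorphic:
  assumes N: "N > 0" and o: "has_order N r (\<lambda>\<tau>. F \<tau> ^ p)" and p: "p > 0"
    and F: "holomorphic_at_infinity N F"
  obtains m :: nat where "r = real (p * m)"
proof -
  obtain g where g: "g holomorphic_on ball 0 1" and
    gF: "\<And>\<tau>. Im \<tau> > 0 \<Longrightarrow> F \<tau> = g (ee (\<tau> / of_nat N))"
    using F unfolding holomorphic_at_infinity_def ee_def by auto
  obtain u where u: "u holomorphic_on ball 0 1" "\<forall>x\<in>ball 0 1. u x \<noteq> 0"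
     "\<forall>\<tau>. Im \<tau> > 0 \<longrightarrow> F \<tau> ^ p = ee (of_real r * \<tau> / of_nat N) * u (ee (\<tau> / of_nat N))"
    using o unfolding has_order_def by metis
  \<comment> \<open>\<open>F\<close> has the period \<open>N\<close>, so that the order is an integer.\<close>
  have per: "ee ((\<i> + of_nat N) / of_nat N) = ee (\<i> / of_nat N)"
    using N by (simp add: add_divide_distrib ee_add)
  have "ee (of_real r * (\<i> + of_nat N) / of_nat N) * u (ee (\<i> / of_nat N)) = ee (of_real r * \<i> / of_nat N) * u (ee (\<i> / of_nat N))"
    using u(3)[rule_format, of "\<i> + of_nat N"] u(3)[rule_format, of \<i>] gF[of "\<i> + of_nat N"] gF[of \<i>] per by simp
  moreover have "u (ee (\<i> / of_nat N)) \<noteq> 0" using u(2) ee_in_ball[OF N, of \<i>] by simp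
  ultimately have "ee (of_real r * (\<i> + of_nat N) / of_nat N) = ee (of_real r * \<i> / of_nat N)" by simp
  moreover have "of_real r * (\<i> + of_nat N) / of_nat N = of_real r * \<i> / of_nat N + of_real r"
    using N by (simp add: field_simps)
  ultimately have "ee (of_real r) = 1" by (simp add: ee_add)
  then obtain n :: int where "complex_of_real r = of_int n" using ee_eq_1_iff by blast
  hence n: "r = of_int n" by (metis of_real_eq_iff of_real_of_int_eq)
  have eq: "g x ^ p = x powi n * u x" if x: "x \<in> ball 0 1" "x \<noteq> 0" for x
  proof -
    define \<tau> where "\<tau> = of_nat N * (Ln x / (2 * of_real pi * \<i>))"
    have e: "ee (\<tau> / of_nat N) = x" using N x by (simp add: ee_def \<tau>_def)
    have "exp (- 2 * pi * Im (\<tau> / of_nat N)) < exp 0" using x norm_ee[of "\<tau> / of_nat N"] e by simp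
    hence "- 2 * pi * Im (\<tau> / of_nat N) < 0" by (simp only: exp_less_cancel_iff)
    hence t: "Im \<tau> > 0" using N by (auto simp: zero_less_divide_iff zero_less_mult_iff)
    have "ee (of_real r * \<tau> / of_nat N) = x powi n"
      unfolding e[symmetric] ee_of_int_mult[symmetric] n by simp
    thus ?thesis using u(3)[rule_format, OF t] gF[OF t] e by simp
  qed
  show ?thesis
  proof (cases "n \<ge> 0")
    case True
    have "p dvd nat n"
      by (rule power_eq_monomial_mult_unit[OF g u(1) _ p]) (use u(2) eq True in \<open>auto simp: power_int_def\<close>)
    then obtain m where "nat n = p * m" by (elim dvdE)
    hence "r = real (p * m)" using n True by (metis of_int_of_nat_eq nat_0_le)
    thus ?thesis by (rule that)
  next
    case False
    have "x ^ nat (- n) * g x ^ p = u x" if x: "x \<in> ball 0 1" "x \<noteq> 0" for x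
      unfolding eq[OF x] using x False by (simp add: power_int_def mult.assoc flip: power_mult_distrib)
    moreover have "continuous_on (ball 0 1) (\<lambda>x. x ^ nat (- n) * g x ^ p)" "continuous_on (ball 0 1) u"
      by (intro holomorphic_on_imp_continuous_on holomorphic_intros g u)+
    ultimately have "0 ^ nat (- n) * g 0 ^ p = u 0"
      using eq_at_0_of_eq_punctured by blast
    hence "u 0 = 0" using False by (simp add: power_0_left)
    thus ?thesis using u(2) by simp
  qed
qed

section \<open>The modularity criterion\<close>

lemma SL2Z_iff: "A \<in> SL2Z \<longleftrightarrow> A $ 1 $ 1 * A $ 2 $ 2 - A $ 1 $ 2 * A $ 2 $ 1 = 1"
  by (simp add: SL2Z_def det_2)

lemma slash_eq:
  "slash k F A \<tau> = F ((of_int (A $ 1 $ 1) * \<tau> + of_int (A $ 1 $ 2)) / (of_int (A $ 2 $ 1) * \<tau> + of_int (A $ 2 $ 2)))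
     / (of_int (A $ 2 $ 1) * \<tau> + of_int (A $ 2 $ 2)) ^ k"
  by (simp add: slash_def act_def moebius_def)

lemma has_order_nonzero: "N > 0 \<Longrightarrow> has_order N r F \<Longrightarrow> Im \<tau> > 0 \<Longrightarrow> F \<tau> \<noteq> 0"
  using ee_in_ball[of N \<tau>] unfolding has_order_def by auto

lemma has_order_holomorphic:
  assumes "N > 0" "has_order N r F"
  shows "F holomorphic_on {\<tau>. Im \<tau> > 0}"
proof -
  obtain u where u: "u holomorphic_on ball 0 1"
     "\<forall>\<tau>. Im \<tau> > 0 \<longrightarrow> F \<tau> = ee (of_real r * \<tau> / of_nat N) * u (ee (\<tau> / of_nat N))"
    using assms unfolding has_order_def by metis
  have "(u \<circ> (\<lambda>\<tau>. ee (\<tau> / of_nat N))) holomorphic_on {\<tau>. Im \<tau> > 0}"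
    by (rule holomorphic_on_compose_gen[OF _ u(1)])
       (use assms(1) ee_in_ball[OF assms(1)] in \<open>auto intro!: holomorphic_intros\<close>)
  hence "(\<lambda>\<tau>. ee (of_real r * \<tau> / of_nat N) * u (ee (\<tau> / of_nat N))) holomorphic_on {\<tau>. Im \<tau> > 0}"
    using assms(1) by (intro holomorphic_intros) (auto simp: o_def)
  thus ?thesis by (rule holomorphic_transform) (use u in auto)
qed

lemma has_order_holomorphic_at_infinity:
  assumes N: "N > 0" and o: "has_order N r F" and r: "r \<in> \<nat>"
  shows "holomorphic_at_infinity N F"
proof -
  obtain u where u: "u holomorphic_on ball 0 1"
     "\<forall>\<tau>. Im \<tau> > 0 \<longrightarrow> F \<tau> = ee (of_real r * \<tau> / of_nat N) * u (ee (\<tau> / of_nat N))"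
    using o unfolding has_order_def by metis
  obtain n where n: "r = real n" using r by (auto elim: Nats_cases)
  have "ee (of_real r * \<tau> / of_nat N) = ee (\<tau> / of_nat N) ^ n" for \<tau>
    by (simp add: n flip: ee_of_nat_mult)
  moreover have "ee (\<tau> / of_nat N) = exp (2 * of_real pi * \<i> * \<tau> / of_nat N)" for \<tau>
    by (simp add: ee_def)
  ultimately show ?thesis unfolding holomorphic_at_infinity_def
    by (intro exI[of _ "\<lambda>x. x ^ n * u x"]) (use u in \<open>auto intro!: holomorphic_intros\<close>)
qed

lemma klein_quotient_has_order:
  assumes N: "N > 0"
  obtains r where "has_order N r (klein_quotient N D f)"
  using klein_quotient_cusp[OF N, of 1 1 0 0 D f] by auto

lemma theta_quotient_slash_order:
  fixes a b c d :: int
  assumes N: "N > 0" and det: "a * d - b * c = 1"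
    and D: "int k + (\<Sum>j=1..N div 2. f j) = 12 * D"
  shows "has_order N (cusp_order N D f (gcd (int N) c) a)
     (\<lambda>\<tau>. theta_quotient N (2 * k) f ((of_int a * \<tau> + of_int b) / (of_int c * \<tau> + of_int d))
        / (of_int c * \<tau> + of_int d) ^ k)"
proof (rule has_order_cong[OF klein_quotient_cusp[OF N det] _ refl])
  fix \<tau> :: complex assume t: "Im \<tau> > 0"
  have k: "12 * D - (\<Sum>j=1..N div 2. f j) = int k" using D by linarith
  show "klein_quotient N D f ((of_int a * \<tau> + of_int b) / (of_int c * \<tau> + of_int d))
      / (of_int c * \<tau> + of_int d) powi (12 * D - (\<Sum>j=1..N div 2. f j)) =
     theta_quotient N (2 * k) f ((of_int a * \<tau> + of_int b) / (of_int c * \<tau> + of_int d))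
        / (of_int c * \<tau> + of_int d) ^ k"
    unfolding k power_int_of_nat theta_quotient_eq_klein_quotient[OF N im_moebius_pos(2)[OF det t] D] ..
qed

text \<open>Holomorphy at the cusp \<open>0\<close> alone forces the exponent of the discriminant to be integral; there the
  twelfth power of the quotient has order \<open>k + (\<Sum>j. f j)\<close>.\<close>

lemma modular_form_imp_dvd_12:
  assumes N: "N > 0" and mf: "modular_form_Gamma1 k N (theta_quotient N (2 * k) f)"
  obtains D where "int k + (\<Sum>j=1..N div 2. f j) = 12 * D"
proof -
  define A :: "int ^ 2 ^ 2" where "A = vector [vector [0, - 1], vector [1, 0]]"
  have A: "A $ 1 $ 1 = 0" "A $ 1 $ 2 = - 1" "A $ 2 $ 1 = 1" "A $ 2 $ 2 = 0"
    by (simp_all add: A_def)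
  have "A \<in> SL2Z" by (simp add: SL2Z_iff A)
  hence hol: "holomorphic_at_infinity N (slash k (theta_quotient N (2 * k) f) A)"
    using mf by (simp add: modular_form_Gamma1_def)
  define s where "s = int k + (\<Sum>j=1..N div 2. f j)"
  have "has_order N (cusp_order N s (\<lambda>j. 12 * f j) (gcd (int N) 1) 0)
     (\<lambda>\<tau>. slash k (theta_quotient N (2 * k) f) A \<tau> ^ 12)"
  proof (rule has_order_cong[OF klein_quotient_cusp[OF N, of 0 0 "- 1" 1] _ refl])
    fix \<tau> :: complex assume t: "Im \<tau> > 0"
    have t': "Im ((of_int 0 * \<tau> + of_int (- 1)) / (of_int 1 * \<tau> + of_int 0)) > 0"
      by (rule im_moebius_pos(2)[OF _ t]) simp
    have k: "12 * s - (\<Sum>j=1..N div 2. 12 * f j) = int (k * 12)"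
      unfolding sum_distrib_left[symmetric] s_def by simp
    show "klein_quotient N s (\<lambda>j. 12 * f j) ((of_int 0 * \<tau> + of_int (- 1)) / (of_int 1 * \<tau> + of_int 0))
        / (of_int 1 * \<tau> + of_int 0) powi (12 * s - (\<Sum>j=1..N div 2. 12 * f j))
       = slash k (theta_quotient N (2 * k) f) A \<tau> ^ 12"
      unfolding k power_int_of_nat slash_eq A power_divide theta_quotient_power_12[OF N t'] s_def[symmetric]
      by (simp only: power_mult)
  qed simp
  from has_order_power_holomorphic[OF N this _ hol] obtain m where
    m: "cusp_order N s (\<lambda>j. 12 * f j) (gcd (int N) 1) 0 = real (12 * m)" by auto
  have "real_of_int s = real (12 * m)" using m by (simp add: cusp_order_def)
  hence "s = int (12 * m)" by linarith
  thus ?thesis using that[of "int m"] by (simp add: s_def)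
qed

text \<open>The logarithm, divided by \<open>2 \<pi> i\<close>, of the value of the character on the matrices of
  \<open>\<Gamma>\<^sub>1(N)\<close> with the upper row \<open>(1 + N u, b)\<close>.\<close>

definition Gamma1_exponent :: "nat \<Rightarrow> (nat \<Rightarrow> int) \<Rightarrow> int \<Rightarrow> int \<Rightarrow> complex" where
  "Gamma1_exponent N f u b = (of_int ((u + b) * (\<Sum>j=1..N div 2. int j * f j) + u * b * (\<Sum>j=1..N div 2. (int j)\<^sup>2 * f j))
     + of_int (b * (\<Sum>j=1..N div 2. (int j)\<^sup>2 * f j)) / of_nat N) / 2"

lemma theta_quotient_Gamma1:
  fixes b c d u :: int
  assumes N: "N > 0" and det: "(1 + int N * u) * d - b * (int N * c) = 1" and t: "Im \<tau> > 0"
    and D: "int k + (\<Sum>j=1..N div 2. f j) = 12 * D"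
  shows "theta_quotient N (2 * k) f ((of_int (1 + int N * u) * \<tau> + of_int b) / (of_int (int N * c) * \<tau> + of_int d))
       / (of_int (int N * c) * \<tau> + of_int d) ^ k
     = ee (Gamma1_exponent N f u b) * theta_quotient N (2 * k) f \<tau>"
proof -
  have k: "12 * D - (\<Sum>j=1..N div 2. f j) = int k" using D by linarith
  have s1: "(\<Sum>j=1..N div 2. f j * (int j * u + int j * b + int j * u * (int j * b)))
     = (u + b) * (\<Sum>j=1..N div 2. int j * f j) + u * b * (\<Sum>j=1..N div 2. (int j)\<^sup>2 * f j)"
    unfolding sum_distrib_left sum.distrib[symmetric]
    by (intro sum.cong refl) (simp add: algebra_simps power2_eq_square)
  have s2: "(\<Sum>j=1..N div 2. f j * (int j * int j * b)) = b * (\<Sum>j=1..N div 2. (int j)\<^sup>2 * f j)"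
    unfolding sum_distrib_left by (intro sum.cong refl) (simp add: power2_eq_square)
  have nz: "of_int (int N * c) * \<tau> + of_int d \<noteq> 0" by (rule im_moebius_pos(1)[OF det t])
  show ?thesis
    unfolding theta_quotient_eq_klein_quotient[OF N im_moebius_pos(2)[OF det t] D]
      theta_quotient_eq_klein_quotient[OF N t D] klein_quotient_Gamma1[OF N det refl t] k power_int_of_nat s1 s2
      Gamma1_exponent_def[symmetric]
    using nz by simp
qed

text \<open>The criterion for modularity. The variables \<open>u\<close>, \<open>b\<close>, \<open>c\<close>, \<open>v\<close> run
  through the matrices of \<open>\<Gamma>\<^sub>1(N)\<close> with the rows \<open>(1 + N u, b)\<close> and \<open>(N
  c, 1 + N v)\<close>.\<close>

theorem modular_form_theta_quotient_iff:
  assumes N: "N > 0"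
  shows "modular_form_Gamma1 k N (theta_quotient N (2 * k) f) \<longleftrightarrow>
    (\<exists>D. int k + (\<Sum>j=1..N div 2. f j) = 12 * D \<and>
      (\<forall>u b c v. (1 + int N * u) * (1 + int N * v) - b * (int N * c) = 1 \<longrightarrow> ee (Gamma1_exponent N f u b) = 1) \<and>
      (\<forall>a b c d. a * d - b * c = 1 \<longrightarrow> cusp_order N D f (gcd (int N) c) a \<in> \<nat>))"
  (is "?L \<longleftrightarrow> ?R")
proof
  assume L: ?L
  then obtain D where D: "int k + (\<Sum>j=1..N div 2. f j) = 12 * D"
    using modular_form_imp_dvd_12[OF N] by metis
  show ?R
  proof (intro exI[of _ D] conjI allI impI D)
    fix u b c v :: int
    assume det: "(1 + int N * u) * (1 + int N * v) - b * (int N * c) = 1"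
    define A :: "int ^ 2 ^ 2" where "A = vector [vector [1 + int N * u, b], vector [int N * c, 1 + int N * v]]"
    have A: "A $ 1 $ 1 = 1 + int N * u" "A $ 1 $ 2 = b" "A $ 2 $ 1 = int N * c" "A $ 2 $ 2 = 1 + int N * v"
      by (simp_all add: A_def)
    have "A \<in> Gamma1 N" unfolding Gamma1_def SL2Z_iff mem_Collect_eq A using det by (simp add: cong_def)
    hence "slash k (theta_quotient N (2 * k) f) A \<i> = theta_quotient N (2 * k) f \<i>"
      using L by (simp add: modular_form_Gamma1_def)
    hence "ee (Gamma1_exponent N f u b) * theta_quotient N (2 * k) f \<i> = theta_quotient N (2 * k) f \<i>"
      unfolding slash_eq A using theta_quotient_Gamma1[OF N det _ D, of \<i>] by simp
    moreover have "theta_quotient N (2 * k) f \<i> \<noteq> 0"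
    proof -
      obtain r where "has_order N r (klein_quotient N D f)" using klein_quotient_has_order[OF N] by metis
      thus ?thesis unfolding theta_quotient_eq_klein_quotient[OF N _ D, of \<i>, simplified]
        using has_order_nonzero[OF N, of r _ \<i>] by simp
    qed
    ultimately show "ee (Gamma1_exponent N f u b) = 1" by simp
  next
    fix a b c d :: int
    assume det: "a * d - b * c = 1"
    define A :: "int ^ 2 ^ 2" where "A = vector [vector [a, b], vector [c, d]]"
    have A: "A $ 1 $ 1 = a" "A $ 1 $ 2 = b" "A $ 2 $ 1 = c" "A $ 2 $ 2 = d"
      by (simp_all add: A_def)
    have "A \<in> SL2Z" unfolding SL2Z_iff A by (rule det)
    hence hol: "holomorphic_at_infinity N (slash k (theta_quotient N (2 * k) f) A)"
      using L by (simp add: modular_form_Gamma1_def)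
    have "has_order N (cusp_order N D f (gcd (int N) c) a) (\<lambda>\<tau>. slash k (theta_quotient N (2 * k) f) A \<tau> ^ 1)"
      unfolding slash_eq A power_one_right by (rule theta_quotient_slash_order[OF N det D])
    from has_order_power_holomorphic[OF N this _ hol] show "cusp_order N D f (gcd (int N) c) a \<in> \<nat>"
      by (metis of_nat_in_Nats zero_less_one)
  qed
next
  assume ?R
  then obtain D where D: "int k + (\<Sum>j=1..N div 2. f j) = 12 * D"
    and X: "\<And>u b c v. (1 + int N * u) * (1 + int N * v) - b * (int N * c) = 1 \<Longrightarrow> ee (Gamma1_exponent N f u b) = 1"
    and O: "\<And>a b c d. a * d - b * c = 1 \<Longrightarrow> cusp_order N D f (gcd (int N) c) a \<in> \<nat>"
    by blast
  show ?L unfolding modular_form_Gamma1_def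
  proof (intro conjI ballI)
    obtain r where "has_order N r (klein_quotient N D f)" using klein_quotient_has_order[OF N] by metis
    from has_order_holomorphic[OF N this]
    show "theta_quotient N (2 * k) f holomorphic_on upper_half_plane"
      by (rule holomorphic_transform) (simp add: theta_quotient_eq_klein_quotient[OF N _ D])
  next
    fix A :: "int ^ 2 ^ 2" and \<tau> :: complex
    assume A: "A \<in> Gamma1 N" and "\<tau> \<in> upper_half_plane"
    hence t: "Im \<tau> > 0" by simp
    have "int N dvd A $ 1 $ 1 - 1" "int N dvd A $ 2 $ 2 - 1" "int N dvd A $ 2 $ 1"
      using A by (auto simp: Gamma1_def cong_iff_dvd_diff)
    then obtain u v c where "A $ 1 $ 1 - 1 = int N * u" "A $ 2 $ 2 - 1 = int N * v" and c: "A $ 2 $ 1 = int N * c"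
      by (auto elim!: dvdE)
    hence uv: "A $ 1 $ 1 = 1 + int N * u" "A $ 2 $ 2 = 1 + int N * v" by linarith+
    have det: "(1 + int N * u) * (1 + int N * v) - A $ 1 $ 2 * (int N * c) = 1"
      using A unfolding Gamma1_def SL2Z_iff mem_Collect_eq uv c by blast
    show "slash k (theta_quotient N (2 * k) f) A \<tau> = theta_quotient N (2 * k) f \<tau>"
      unfolding slash_eq uv c theta_quotient_Gamma1[OF N det t D] X[OF det] by simp
  next
    fix A :: "int ^ 2 ^ 2" assume "A \<in> SL2Z"
    hence det: "A $ 1 $ 1 * A $ 2 $ 2 - A $ 1 $ 2 * A $ 2 $ 1 = 1" by (simp add: SL2Z_iff)
    have "slash k (theta_quotient N (2 * k) f) A = (\<lambda>\<tau>. theta_quotient N (2 * k) f ((of_int (A $ 1 $ 1) * \<tau> + of_int (A $ 1 $ 2)) / (of_int (A $ 2 $ 1) * \<tau> + of_int (A $ 2 $ 2)))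
        / (of_int (A $ 2 $ 1) * \<tau> + of_int (A $ 2 $ 2)) ^ k)"
      by (rule ext) (rule slash_eq)
    thus "holomorphic_at_infinity N (slash k (theta_quotient N (2 * k) f) A)"
      using has_order_holomorphic_at_infinity[OF N theta_quotient_slash_order[OF N det D] O[OF det]] by simp
  qed
qed

section \<open>Counting weighted tuples\<close>

text \<open>The lists of natural numbers whose sum with the weights \<open>ws\<close> is \<open>t\<close>.\<close>

fun tuples :: "nat list \<Rightarrow> nat \<Rightarrow> nat list set" where
  "tuples [] t = (if t = 0 then {[]} else {})"
| "tuples (w # ws) t = (\<Union>n\<in>{n. w * n \<le> t}. (#) n ` tuples ws (t - w * n))"

text \<open>The value of the character with the values \<open>\<eta>s\<close> on the unit vectors at the vector \<open>ns\<close>,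
  that is, the product of the powers \<open>\<eta>\<^sub>i\<close> to the \<open>n\<^sub>i\<close>.\<close>

fun char_weight :: "complex list \<Rightarrow> nat list \<Rightarrow> complex" where
  "char_weight (\<eta> # \<eta>s) (n # ns) = \<eta> ^ n * char_weight \<eta>s ns"
| "char_weight _ _ = 1"

text \<open>The geometric series \<open>1 / (1 - \<eta> X\<^sup>w)\<close>, for positive \<open>w\<close>.\<close>

definition geom :: "nat \<Rightarrow> complex \<Rightarrow> complex fps" where
  "geom w \<eta> = Abs_fps (\<lambda>n. if w dvd n then \<eta> ^ (n div w) else 0)"

text \<open>The product of the geometric series with the given weights and ratios.\<close>

fun geoms :: "nat list \<Rightarrow> complex list \<Rightarrow> complex fps" where
  "geoms (w # ws) (\<eta> # \<eta>s) = geom w \<eta> * geoms ws \<eta>s"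
| "geoms _ _ = 1"

lemma finite_mult_le: "w > 0 \<Longrightarrow> finite {n. w * n \<le> (t::nat)}"
  by (rule finite_subset[of _ "{..t}"]) (auto intro: order_trans[rotated])

lemma finite_tuples: "\<forall>w\<in>set ws. w > 0 \<Longrightarrow> finite (tuples ws t)"
  by (induction ws arbitrary: t) (auto intro!: finite_mult_le)

text \<open>The generating function of a character sum over weighted tuples.\<close>

lemma sum_char_weight_tuples:
  assumes "\<forall>w\<in>set ws. w > 0" "length \<eta>s = length ws"
  shows "(\<Sum>ns\<in>tuples ws t. char_weight \<eta>s ns) = fps_nth (geoms ws \<eta>s) t"
  using assms
proof (induction ws arbitrary: \<eta>s t)
  case Nil
  thus ?case by simp
next
  case (Cons w ws)
  then obtain \<eta> \<psi> where c: "\<eta>s = \<eta> # \<psi>" "length \<psi> = length ws" by (cases \<eta>s) auto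
  have w: "w > 0" using Cons by auto
  have "(\<Sum>ns\<in>tuples (w # ws) t. char_weight \<eta>s ns)
     = (\<Sum>n\<in>{n. w * n \<le> t}. \<Sum>ns\<in>(#) n ` tuples ws (t - w * n). char_weight \<eta>s ns)"
    unfolding tuples.simps using Cons.prems w
    by (intro sum.UNION_disjoint finite_mult_le ballI finite_imageI finite_tuples) auto
  also have "\<dots> = (\<Sum>n\<in>{n. w * n \<le> t}. \<eta> ^ n * fps_nth (geoms ws \<psi>) (t - w * n))"
  proof (intro sum.cong refl)
    fix n
    have "(\<Sum>ns\<in>(#) n ` tuples ws (t - w * n). char_weight \<eta>s ns) = (\<Sum>ns\<in>tuples ws (t - w * n). \<eta> ^ n * char_weight \<psi> ns)"
      by (subst sum.reindex) (auto simp: c)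
    thus "(\<Sum>ns\<in>(#) n ` tuples ws (t - w * n). char_weight \<eta>s ns) = \<eta> ^ n * fps_nth (geoms ws \<psi>) (t - w * n)"
      using Cons.IH[of \<psi>] Cons.prems c by (simp add: sum_distrib_left[symmetric])
  qed
  also have "\<dots> = (\<Sum>i\<in>(*) w ` {n. w * n \<le> t}. fps_nth (geom w \<eta>) i * fps_nth (geoms ws \<psi>) (t - i))"
    using w by (subst sum.reindex) (auto simp: geom_def inj_on_def)
  also have "\<dots> = (\<Sum>i=0..t. fps_nth (geom w \<eta>) i * fps_nth (geoms ws \<psi>) (t - i))"
    by (rule sum.mono_neutral_left) (auto simp: geom_def elim!: dvdE)
  finally show ?case by (simp add: c fps_mult_nth)
qed

lemma geom_inverse: "w > 0 \<Longrightarrow> geom w \<eta> * (1 - fps_const \<eta> * fps_X ^ w) = 1"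
proof (rule fps_ext)
  fix n assume w: "w > 0"
  have "geom w \<eta> * (1 - fps_const \<eta> * fps_X ^ w) = geom w \<eta> - fps_const \<eta> * (fps_X ^ w * geom w \<eta>)"
    by (simp add: algebra_simps)
  hence "fps_nth (geom w \<eta> * (1 - fps_const \<eta> * fps_X ^ w)) n = fps_nth (geom w \<eta>) n - \<eta> * (if n < w then 0 else fps_nth (geom w \<eta>) (n - w))"
    by (simp add: fps_X_power_mult_nth)
  also have "\<dots> = fps_nth 1 n"
  proof (cases "w dvd n")
    case True
    then obtain m where "n = w * m" by (elim dvdE)
    thus ?thesis using w by (cases m) (auto simp: geom_def)
  next
    case False
    hence "n \<noteq> 0" by (metis dvd_0_right)
    moreover have "\<not> w dvd (n - w)" if "\<not> n < w"
      using False that by (metis dvd_minus_self not_less)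
    ultimately show ?thesis using False by (auto simp: geom_def)
  qed
  finally show "fps_nth (geom w \<eta> * (1 - fps_const \<eta> * fps_X ^ w)) n = fps_nth 1 n" .
qed

lemma fps_inverse_unique':
  fixes f g h :: "complex fps"
  assumes "f * h = 1" "g * h = 1" shows "f = g"
  by (metis assms mult.assoc mult.commute mult_1)

lemma geom_mult_minus:
  assumes "w > 0" shows "geom w \<eta> * geom w (- \<eta>) = geom (2 * w) (\<eta>\<^sup>2)"
proof (rule fps_inverse_unique')
  have eq: "1 - fps_const (\<eta>\<^sup>2) * fps_X ^ (2 * w) = (1 - fps_const \<eta> * fps_X ^ w) * (1 - fps_const (- \<eta>) * fps_X ^ w)"
  proof -
    define y where "y = fps_const \<eta> * fps_X ^ w"
    have 1: "fps_const (\<eta>\<^sup>2) * fps_X ^ (2 * w) = y\<^sup>2"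
      by (simp only: y_def power_mult_distrib fps_const_power power_mult[symmetric] mult.commute[of 2 w])
    have 2: "fps_const (- \<eta>) * fps_X ^ w = - y"
      by (simp only: y_def fps_const_neg[symmetric] mult_minus_left)
    show ?thesis unfolding 1 2 y_def[symmetric] by (simp add: algebra_simps power2_eq_square)
  qed
  have "geom w \<eta> * geom w (- \<eta>) * (1 - fps_const (\<eta>\<^sup>2) * fps_X ^ (2 * w))
    = (geom w \<eta> * (1 - fps_const \<eta> * fps_X ^ w)) * (geom w (- \<eta>) * (1 - fps_const (- \<eta>) * fps_X ^ w))"
    unfolding eq by (simp only: mult_ac)
  thus "geom w \<eta> * geom w (- \<eta>) * (1 - fps_const (\<eta>\<^sup>2) * fps_X ^ (2 * w)) = 1"
    unfolding geom_inverse[OF assms] by simp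
  show "geom (2 * w) (\<eta>\<^sup>2) * (1 - fps_const (\<eta>\<^sup>2) * fps_X ^ (2 * w)) = 1"
    using assms by (intro geom_inverse) simp
qed

lemma geom_mult_cube_roots:
  assumes w: "w > 0" and \<omega>: "\<omega>\<^sup>2 + \<omega> + 1 = 0"
  shows "geom w \<eta> * geom w (\<omega> * \<eta>) * geom w (\<omega>\<^sup>2 * \<eta>) = geom (3 * w) (\<eta> ^ 3)"
proof (rule fps_inverse_unique')
  have "\<omega> * \<omega>\<^sup>2 - 1 = (\<omega> - 1) * (\<omega>\<^sup>2 + \<omega> + 1)"
    by (simp add: algebra_simps power2_eq_square)
  hence "\<omega> * \<omega>\<^sup>2 - 1 = 0" unfolding \<omega> mult_zero_right .
  hence w3: "\<omega> * \<omega>\<^sup>2 = 1" by (rule eq_iff_diff_eq_0[THEN iffD2])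
  define a where "a = fps_const \<omega>"
  define y where "y = fps_const \<eta> * fps_X ^ w"
  have a2: "fps_const (\<omega>\<^sup>2) = a\<^sup>2" by (simp add: a_def flip: fps_const_power)
  have a3: "a * a\<^sup>2 = 1"
    unfolding a2[symmetric] unfolding a_def fps_const_mult w3 fps_const_1_eq_1 ..
  have as: "a\<^sup>2 + a + 1 = 0"
  proof -
    have "a\<^sup>2 + a + 1 = fps_const (\<omega>\<^sup>2) + fps_const \<omega> + fps_const 1" unfolding a2 a_def by simp
    also have "\<dots> = fps_const (\<omega>\<^sup>2 + \<omega> + 1)" by (simp only: fps_const_add)
    finally show ?thesis by (simp add: \<omega>)
  qed
  have "(1 - y) * ((1 - a * y) * (1 - a\<^sup>2 * y)) = 1 - (a\<^sup>2 + a + 1) * y + (a\<^sup>2 + a + a * a\<^sup>2) * y\<^sup>2 - a * a\<^sup>2 * y ^ 3"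
    by (simp add: algebra_simps power2_eq_square power3_eq_cube)
  also have "\<dots> = 1 - y ^ 3" using as unfolding a3 by simp
  finally have "1 - y ^ 3 = (1 - y) * ((1 - a * y) * (1 - a\<^sup>2 * y))" ..
  moreover have "fps_const (\<eta> ^ 3) * fps_X ^ (3 * w) = y ^ 3"
    by (simp add: y_def power_mult_distrib mult.commute[of 3] flip: fps_const_power power_mult)
  ultimately have eq: "1 - fps_const (\<eta> ^ 3) * fps_X ^ (3 * w) = (1 - fps_const \<eta> * fps_X ^ w) *
     ((1 - fps_const (\<omega> * \<eta>) * fps_X ^ w) * (1 - fps_const (\<omega>\<^sup>2 * \<eta>) * fps_X ^ w))"
    unfolding a2[symmetric] by (simp add: a_def y_def mult.assoc[symmetric])
  have "geom w \<eta> * geom w (\<omega> * \<eta>) * geom w (\<omega>\<^sup>2 * \<eta>) * (1 - fps_const (\<eta> ^ 3) * fps_X ^ (3 * w))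
    = (geom w \<eta> * (1 - fps_const \<eta> * fps_X ^ w)) * ((geom w (\<omega> * \<eta>) * (1 - fps_const (\<omega> * \<eta>) * fps_X ^ w))
      * (geom w (\<omega>\<^sup>2 * \<eta>) * (1 - fps_const (\<omega>\<^sup>2 * \<eta>) * fps_X ^ w)))"
    unfolding eq by (simp only: mult_ac)
  thus "geom w \<eta> * geom w (\<omega> * \<eta>) * geom w (\<omega>\<^sup>2 * \<eta>) * (1 - fps_const (\<eta> ^ 3) * fps_X ^ (3 * w)) = 1"
    unfolding geom_inverse[OF w] by simp
  show "geom (3 * w) (\<eta> ^ 3) * (1 - fps_const (\<eta> ^ 3) * fps_X ^ (3 * w)) = 1"
    using w by (intro geom_inverse) simp
qed

lemma geom_mult_nth_0: "fps_nth (geom w \<eta> * F) 0 = fps_nth F 0"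
  by (simp add: geom_def)

lemma geom_mult_nth_Suc:
  assumes w: "w > 0" shows "fps_nth (geom w \<eta> * F) (w * Suc n) = \<eta> * fps_nth (geom w \<eta> * F) (w * n) + fps_nth F (w * Suc n)"
proof -
  have "geom w \<eta> = 1 + fps_const \<eta> * (fps_X ^ w * geom w \<eta>)"
    using geom_inverse[OF w, of \<eta>] by (simp add: algebra_simps)
  hence "geom w \<eta> * F = F + fps_const \<eta> * (fps_X ^ w * (geom w \<eta> * F))"
    by (metis (no_types, lifting) distrib_right mult.assoc mult_1)
  hence "fps_nth (geom w \<eta> * F) (w * Suc n) = fps_nth (F + fps_const \<eta> * (fps_X ^ w * (geom w \<eta> * F))) (w * Suc n)"
    by (rule arg_cong)
  also have "\<dots> = fps_nth F (w * Suc n) + \<eta> * fps_nth (geom w \<eta> * F) (w * n)"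
    by (simp add: fps_X_power_mult_nth)
  finally show ?thesis by simp
qed

text \<open>Coefficients of products of geometric series are found by iterated summation: a sequence with the right start and the
  right recurrence is the sequence of coefficients. Only the indices divisible by \<open>w\<close> matter.\<close>

lemma geom_mult_nthI:
  assumes w: "w > 0" and F: "\<And>n. fps_nth F (w * n) = f n" and "g 0 = f 0" "\<And>n. g (Suc n) = \<eta> * g n + f (Suc n)"
  shows "fps_nth (geom w \<eta> * F) (w * n) = g n"
proof (induction n)
  case 0
  show ?case using F[of 0] assms(3) geom_mult_nth_0[of w \<eta> F] by simp
next
  case (Suc n)
  show ?case unfolding geom_mult_nth_Suc[OF w] Suc.IH F assms(4) ..
qed

lemma geom_nth: "w > 0 \<Longrightarrow> fps_nth (geom w \<eta>) (w * n) = \<eta> ^ n"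
  by (simp add: geom_def)

lemma mem_tuples_iff:
  "ns \<in> tuples ws t \<longleftrightarrow> length ns = length ws \<and> sum_list (map2 (*) ws ns) = t"
proof (induction ws arbitrary: ns t)
  case (Cons w ws)
  show ?case
  proof (cases ns)
    case (Cons n ms)
    have "ns \<in> tuples (w # ws) t \<longleftrightarrow> w * n \<le> t \<and> ms \<in> tuples ws (t - w * n)"
      by (auto simp: Cons)
    also have "\<dots> \<longleftrightarrow> w * n \<le> t \<and> length ms = length ws \<and> sum_list (map2 (*) ws ms) = t - w * n"
      by (simp add: Cons.IH)
    also have "\<dots> \<longleftrightarrow> length ns = length (w # ws) \<and> sum_list (map2 (*) (w # ws) ns) = t"
      by (auto simp: Cons)
    finally show ?thesis .
  qed auto
qed auto

lemma geom_1_1_powers: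
  assumes w: "w > 0"
  shows "fps_nth (geom w 1 * geom w 1) (w * n) = of_nat n + 1"
    "fps_nth (geom w 1 * (geom w 1 * geom w 1)) (w * n) = (of_nat n + 1) * (of_nat n + 2) / 2"
    "fps_nth (geom w 1 * (geom w 1 * (geom w 1 * geom w 1))) (w * n)
       = (of_nat n + 1) * (of_nat n + 2) * (of_nat n + 3) / 6"
    "fps_nth (geom w 1 * (geom w 1 * (geom w 1 * (geom w 1 * (geom w 1 * geom w 1))))) (w * n)
       = (of_nat n + 1) * (of_nat n + 2) * (of_nat n + 3) * (of_nat n + 4) * (of_nat n + 5) / 120"
proof -
  have 1: "fps_nth (geom w 1) (w * n) = 1" for n using geom_nth[OF w, of 1 n] by simp
  have 2: "fps_nth (geom w 1 * geom w 1) (w * n) = of_nat n + 1" for n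
    by (rule geom_mult_nthI[OF w 1]) simp_all
  have 3: "fps_nth (geom w 1 * (geom w 1 * geom w 1)) (w * n) = (of_nat n + 1) * (of_nat n + 2) / 2" for n
    by (rule geom_mult_nthI[OF w 2]) (simp_all add: field_simps)
  have 4: "fps_nth (geom w 1 * (geom w 1 * (geom w 1 * geom w 1))) (w * n)
      = (of_nat n + 1) * (of_nat n + 2) * (of_nat n + 3) / 6" for n
    by (rule geom_mult_nthI[OF w 3]) (simp_all add: field_simps)
  have 5: "fps_nth (geom w 1 * (geom w 1 * (geom w 1 * (geom w 1 * geom w 1)))) (w * n)
       = (of_nat n + 1) * (of_nat n + 2) * (of_nat n + 3) * (of_nat n + 4) / 24" for n
    by (rule geom_mult_nthI[OF w 4]) (simp_all add: field_simps)
  have 6: "fps_nth (geom w 1 * (geom w 1 * (geom w 1 * (geom w 1 * (geom w 1 * geom w 1))))) (w * n)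
       = (of_nat n + 1) * (of_nat n + 2) * (of_nat n + 3) * (of_nat n + 4) * (of_nat n + 5) / 120" for n
    by (rule geom_mult_nthI[OF w 5]) (simp_all add: field_simps)
  show "fps_nth (geom w 1 * geom w 1) (w * n) = of_nat n + 1"
    "fps_nth (geom w 1 * (geom w 1 * geom w 1)) (w * n) = (of_nat n + 1) * (of_nat n + 2) / 2"
    "fps_nth (geom w 1 * (geom w 1 * (geom w 1 * geom w 1))) (w * n)
       = (of_nat n + 1) * (of_nat n + 2) * (of_nat n + 3) / 6"
    "fps_nth (geom w 1 * (geom w 1 * (geom w 1 * (geom w 1 * (geom w 1 * geom w 1))))) (w * n)
       = (of_nat n + 1) * (of_nat n + 2) * (of_nat n + 3) * (of_nat n + 4) * (of_nat n + 5) / 120"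
    by (rule 2 3 4 6)+
qed

section \<open>The count at level 14\<close>

text \<open>Summing the coefficients of \<open>1 / (1 - X)\<^sup>6\<close> at the multiples of \<open>3\<close> twice gives this
  polynomial.\<close>

lemma coeff_14_trivial:
  "fps_nth (geoms [3, 3, 1, 1, 1, 1, 1, 1] [1, 1, 1, 1, 1, 1, 1, 1]) (3 * n)
     = (1680 + 11504 * of_nat n + 27006 * of_nat n ^ 2 + 30709 * of_nat n ^ 3 + 18900 * of_nat n ^ 4
        + 6426 * of_nat n ^ 5 + 1134 * of_nat n ^ 6 + 81 * of_nat n ^ 7) / 1680"
proof -
  define F where "F = geom 1 1 * (geom 1 1 * (geom 1 1 * (geom 1 1 * (geom 1 1 * geom 1 1))))"
  have 1: "fps_nth F (3 * n) = (40 + 274 * of_nat n + 675 * of_nat n ^ 2 + 765 * of_nat n ^ 3 + 405 * of_nat n ^ 4 + 81 * of_nat n ^ 5) / 40" for n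
  proof -
    have e: "fps_nth F (3 * n) = (of_nat (3 * n) + 1) * (of_nat (3 * n) + 2) * (of_nat (3 * n) + 3)
        * (of_nat (3 * n) + 4) * (of_nat (3 * n) + 5) / 120"
      using geom_1_1_powers(4)[of 1 "3 * n"] by (simp only: F_def mult_1 zero_less_one)
    show ?thesis unfolding e by (simp add: field_simps eval_nat_numeral)
  qed
  have 2: "fps_nth (geom 3 1 * F) (3 * n) = (80 + 552 * of_nat n + 1318 * of_nat n ^ 2 + 1485 * of_nat n ^ 3 + 855 * of_nat n ^ 4 + 243 * of_nat n ^ 5 + 27 * of_nat n ^ 6) / 80" for n
    by (rule geom_mult_nthI[OF _ 1]) (simp_all add: field_simps eval_nat_numeral)
  have 3: "fps_nth (geom 3 1 * (geom 3 1 * F)) (3 * n) = (1680 + 11504 * of_nat n + 27006 * of_nat n ^ 2 + 30709 * of_nat n ^ 3 + 18900 * of_nat n ^ 4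
        + 6426 * of_nat n ^ 5 + 1134 * of_nat n ^ 6 + 81 * of_nat n ^ 7) / 1680" for n
    by (rule geom_mult_nthI[OF _ 2]) (simp_all add: field_simps eval_nat_numeral)
  show ?thesis using 3 by (simp add: F_def)
qed

text \<open>For the quadratic character the product is \<open>1 / ((1 - X\<^sup>6) (1 - X\<^sup>2)\<^sup>3)\<close>.\<close>

lemma coeff_14_sign:
  "fps_nth (geoms [3, 3, 1, 1, 1, 1, 1, 1] [1, - 1, 1, 1, 1, - 1, - 1, - 1]) (6 * n)
     = (2 + 8 * of_nat n + 9 * of_nat n ^ 2 + 3 * of_nat n ^ 3) / 2"
proof -
  define F where "F = geom 2 1 * (geom 2 1 * geom 2 1)"
  have "geoms [3, 3, 1, 1, 1, 1, 1, 1] [1, - 1, 1, 1, 1, - 1, - 1, - 1]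
     = (geom 3 1 * geom 3 (- 1)) * ((geom 1 1 * geom 1 (- 1)) * ((geom 1 1 * geom 1 (- 1)) * (geom 1 1 * geom 1 (- 1))))"
    unfolding geoms.simps mult_1_right by (simp only: mult_ac)
  also have "\<dots> = geom 6 1 * F"
    using geom_mult_minus[of 1 1] geom_mult_minus[of 3 1] by (simp add: F_def)
  finally have eq: "geoms [3, 3, 1, 1, 1, 1, 1, 1] [1, - 1, 1, 1, 1, - 1, - 1, - 1] = geom 6 1 * F" .
  have 1: "fps_nth F (6 * n) = (2 + 9 * of_nat n + 9 * of_nat n ^ 2) / 2" for n
    using geom_1_1_powers(2)[of 2 "3 * n"] unfolding F_def
    by (simp add: field_simps eval_nat_numeral)
  show ?thesis unfolding eq
    by (rule geom_mult_nthI[OF _ 1]) (simp_all add: field_simps eval_nat_numeral)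
qed

lemma cube_root_facts:
  fixes \<omega> :: complex
  assumes "\<omega>\<^sup>2 + \<omega> + 1 = 0"
  shows "\<omega>\<^sup>2 = - 1 - \<omega>" "\<omega> ^ 3 = 1" "(\<omega>\<^sup>2)\<^sup>2 = \<omega>" "\<omega> ^ (3 * n) = 1"
proof -
  have "\<omega>\<^sup>2 = (\<omega>\<^sup>2 + \<omega> + 1) - 1 - \<omega>" by simp
  thus 2: "\<omega>\<^sup>2 = - 1 - \<omega>" unfolding assms by simp
  have "\<omega> ^ 3 - 1 = (\<omega> - 1) * (\<omega>\<^sup>2 + \<omega> + 1)" by (simp add: algebra_simps power2_eq_square power3_eq_cube)
  hence "\<omega> ^ 3 - 1 = 0" unfolding assms mult_zero_right .
  thus 3: "\<omega> ^ 3 = 1" by (simp only: eq_iff_diff_eq_0[of _ 1])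
  have "(\<omega>\<^sup>2)\<^sup>2 = \<omega> ^ 3 * \<omega>" by (simp add: power2_eq_square power3_eq_cube)
  thus "(\<omega>\<^sup>2)\<^sup>2 = \<omega>" unfolding 3 by simp
  show "\<omega> ^ (3 * n) = 1" unfolding power_mult 3 by simp
qed

text \<open>For a character of order \<open>3\<close> the six ratios of weight \<open>1\<close> are the cube roots of unity, each
  of them twice, so that the product is \<open>1 / ((1 - X\<^sup>3)\<^sup>2 (1 - \<omega> X\<^sup>3)\<^sup>2)\<close>.\<close>

lemma coeff_14_cubic:
  assumes \<omega>: "\<omega>\<^sup>2 + \<omega> + 1 = 0"
  shows "fps_nth (geoms [3, 3, 1, 1, 1, 1, 1, 1] [\<omega>, \<omega>, 1, \<omega>\<^sup>2, \<omega>, \<omega>\<^sup>2, 1, \<omega>]) (3 * n)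
     = (of_nat n + 1) * ((1 + \<omega>) / 3) + 2 * (2 + \<omega>) / 9 + \<omega> ^ n * ((of_nat n + 1) * (- \<omega> / 3) + 2 * (1 - \<omega>) / 9)"
proof -
  note w2 = cube_root_facts(1)[OF \<omega>]
  have ww: "\<omega> * \<omega> = - 1 - \<omega>" "\<omega> * (\<omega> * x) = - x - \<omega> * x" for x
    using w2 by (simp_all add: power2_eq_square mult.assoc[symmetric] left_diff_distrib)
  have "geoms [3, 3, 1, 1, 1, 1, 1, 1] [\<omega>, \<omega>, 1, \<omega>\<^sup>2, \<omega>, \<omega>\<^sup>2, 1, \<omega>]
     = geom 3 \<omega> * (geom 3 \<omega> * ((geom 1 1 * geom 1 (\<omega> * 1) * geom 1 (\<omega>\<^sup>2 * 1)) * (geom 1 1 * geom 1 (\<omega> * 1) * geom 1 (\<omega>\<^sup>2 * 1))))"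
    unfolding geoms.simps mult_1_right by (simp only: mult_ac)
  also have "\<dots> = geom 3 \<omega> * (geom 3 \<omega> * (geom 3 1 * geom 3 1))"
    using geom_mult_cube_roots[of 1 \<omega> 1, OF _ \<omega>] by simp
  finally have eq: "geoms [3, 3, 1, 1, 1, 1, 1, 1] [\<omega>, \<omega>, 1, \<omega>\<^sup>2, \<omega>, \<omega>\<^sup>2, 1, \<omega>] = geom 3 \<omega> * (geom 3 \<omega> * (geom 3 1 * geom 3 1))" .
  have 1: "fps_nth (geom 3 1 * geom 3 1) (3 * n) = of_nat n + 1" for n
    by (rule geom_1_1_powers(1)) simp
  have 2: "fps_nth (geom 3 \<omega> * (geom 3 1 * geom 3 1)) (3 * n)
       = (of_nat n + 1) * (2 + \<omega>) / 3 + 1 / 3 - \<omega> * \<omega> ^ n / 3" for n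
    by (rule geom_mult_nthI[OF _ 1]) (simp_all add: field_simps ww)
  show ?thesis unfolding eq
    by (rule geom_mult_nthI[OF _ 2]) (simp_all add: field_simps ww)
qed

text \<open>For a character of order \<open>6\<close> the product is \<open>1 / ((1 - X\<^sup>6) (1 - \<omega>\<^sup>2
  X\<^sup>6))\<close>.\<close>

lemma coeff_14_cubic_sign:
  assumes \<omega>: "\<omega>\<^sup>2 + \<omega> + 1 = 0"
  shows "fps_nth (geoms [3, 3, 1, 1, 1, 1, 1, 1] [\<omega>, - \<omega>, 1, \<omega>\<^sup>2, \<omega>, - \<omega>\<^sup>2, - 1, - \<omega>]) (6 * n)
     = (1 - (\<omega>\<^sup>2) ^ Suc n) * (1 - \<omega>) / 3"
proof -
  note w2 = cube_root_facts(1)[OF \<omega>]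
  have ww: "\<omega> * \<omega> = - 1 - \<omega>" "\<omega> * (\<omega> * x) = - x - \<omega> * x" for x
    using w2 by (simp_all add: power2_eq_square mult.assoc[symmetric] left_diff_distrib)
  have "geoms [3, 3, 1, 1, 1, 1, 1, 1] [\<omega>, - \<omega>, 1, \<omega>\<^sup>2, \<omega>, - \<omega>\<^sup>2, - 1, - \<omega>]
     = (geom 3 \<omega> * geom 3 (- \<omega>)) * ((geom 1 1 * geom 1 (\<omega> * 1) * geom 1 (\<omega>\<^sup>2 * 1)) * (geom 1 (- 1) * geom 1 (\<omega> * - 1) * geom 1 (\<omega>\<^sup>2 * - 1)))"
    unfolding geoms.simps mult_1_right mult_minus_right by (simp only: mult_ac)
  also have "\<dots> = geom 6 (\<omega>\<^sup>2) * (geom 3 1 * geom 3 (- 1))"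
    using geom_mult_cube_roots[of 1 \<omega> 1, OF _ \<omega>] geom_mult_cube_roots[of 1 \<omega> "- 1", OF _ \<omega>]
      geom_mult_minus[of 3 \<omega>] by simp
  also have "geom 3 1 * geom 3 (- 1) = geom 6 1" using geom_mult_minus[of 3 1] by simp
  finally have eq: "geoms [3, 3, 1, 1, 1, 1, 1, 1] [\<omega>, - \<omega>, 1, \<omega>\<^sup>2, \<omega>, - \<omega>\<^sup>2, - 1, - \<omega>] = geom 6 (\<omega>\<^sup>2) * geom 6 1" .
  have 1: "fps_nth (geom 6 1) (6 * n) = 1" for n using geom_nth[of 6 1 n] by simp
  show ?thesis unfolding eq
    by (rule geom_mult_nthI[OF _ 1]) (simp_all add: w2 field_simps ww)
qed

text \<open>Both nontrivial cube roots of unity contribute the same number, and \<open>6 * E14 k\<close> in total.\<close>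

lemma twisted_14:
  assumes \<omega>: "\<omega>\<^sup>2 + \<omega> + 1 = 0"
  shows "\<omega> ^ (2 * k) * fps_nth (geoms [3, 3, 1, 1, 1, 1, 1, 1] [\<omega>, \<omega>, 1, \<omega>\<^sup>2, \<omega>, \<omega>\<^sup>2, 1, \<omega>]) (6 * k)
      + \<omega> ^ (2 * k) * fps_nth (geoms [3, 3, 1, 1, 1, 1, 1, 1] [\<omega>, - \<omega>, 1, \<omega>\<^sup>2, \<omega>, - \<omega>\<^sup>2, - 1, - \<omega>]) (6 * k)
      = of_real (3 * E14 k)"
proof -
  note w2 = cube_root_facts(1)[OF \<omega>]
  have ww: "\<omega> * \<omega> = - 1 - \<omega>" "\<omega> * (\<omega> * x) = - x - \<omega> * x" for x
    using w2 by (simp_all add: power2_eq_square mult.assoc[symmetric] left_diff_distrib)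
  have eq6: "6 * k = 3 * (2 * k)" by simp
  have c: "fps_nth (geoms [3, 3, 1, 1, 1, 1, 1, 1] [\<omega>, \<omega>, 1, \<omega>\<^sup>2, \<omega>, \<omega>\<^sup>2, 1, \<omega>]) (6 * k)
     = (of_nat (2 * k) + 1) * ((1 + \<omega>) / 3) + 2 * (2 + \<omega>) / 9
       + \<omega> ^ (2 * k) * ((of_nat (2 * k) + 1) * (- \<omega> / 3) + 2 * (1 - \<omega>) / 9)"
    unfolding eq6 by (rule coeff_14_cubic[OF \<omega>])
  have k: "k = 3 * (k div 3) + k mod 3" by simp
  have p: "\<omega> ^ k = \<omega> ^ (k mod 3)"
    by (subst k, subst power_add) (simp add: cube_root_facts(4)[OF \<omega>])
  have p2: "\<omega> ^ (2 * k) = (\<omega> ^ (k mod 3))\<^sup>2" unfolding p[symmetric] by (simp add: power_mult mult.commute[of 2])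
  have p3: "(\<omega>\<^sup>2) ^ k = (\<omega> ^ (k mod 3))\<^sup>2" unfolding p2[symmetric] by (simp add: power_mult)
  have m6: "k mod 6 \<in> {0, 3} \<longleftrightarrow> k mod 3 = 0" "k mod 6 \<in> {1, 4} \<longleftrightarrow> k mod 3 = 1"
    by (simp_all, presburger+)
  have "k mod 3 < 3" by simp
  then consider "k mod 3 = 0" | "k mod 3 = 1" | "k mod 3 = 2" by linarith
  thus ?thesis
  proof cases
    case 1
    thus ?thesis unfolding coeff_14_cubic_sign[OF \<omega>] c p2 E14_def m6 power_Suc p3
      by (simp add: field_simps ww w2)
  next
    case 2
    thus ?thesis unfolding coeff_14_cubic_sign[OF \<omega>] c p2 E14_def m6 power_Suc p3
      by (simp add: field_simps ww w2)
  next
    case 3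
    thus ?thesis unfolding coeff_14_cubic_sign[OF \<omega>] c p2 E14_def m6 power_Suc p3
      by (simp add: field_simps ww w2 power2_eq_square)
  qed
qed

lemma list_8_cases:
  assumes "length ns = 8"
  obtains a b c1 c2 c3 e1 e2 e3 where "ns = [a, b, c1, c2, c3, e1, e2, e3]"
  using assms by (auto simp: numeral_eq_Suc length_Suc_conv)

text \<open>The vectors of the orders at the eight classes of cusps of level \<open>14\<close> of those theta quotients that are
  modular forms of weight \<open>k\<close>. The equation is the valence formula; the congruences say that the
  exponents are integral.\<close>

definition solutions14 :: "nat \<Rightarrow> nat list set" where
  "solutions14 k = {[a, b, c1, c2, c3, e1, e2, e3] | a b c1 c2 c3 e1 e2 e3.
     3 * a + 3 * b + c1 + c2 + c3 + e1 + e2 + e3 = 6 * k \<and> 2 dvd (b + e1 + e2 + e3) \<and>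
     3 dvd (2 * k + a + b + 2 * c2 + c3 + 2 * e1 + e3)}"

lemma cube_root_sum:
  fixes \<omega> :: complex
  assumes \<omega>: "\<omega>\<^sup>2 + \<omega> + 1 = 0"
  shows "1 + \<omega> ^ y + (\<omega>\<^sup>2) ^ y = (if 3 dvd y then 3 else 0)"
proof -
  have y: "y = 3 * (y div 3) + y mod 3" by simp
  have 1: "\<omega> ^ y = \<omega> ^ (y mod 3)"
    by (subst y, subst power_add) (simp add: cube_root_facts(4)[OF \<omega>])
  have 2: "(\<omega>\<^sup>2) ^ y = (\<omega> ^ (y mod 3))\<^sup>2" unfolding 1[symmetric] by (simp add: mult.commute flip: power_mult)
  have "y mod 3 < 3" by simp
  then consider "y mod 3 = 0" | "y mod 3 = 1" | "y mod 3 = 2" by linarith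
  thus ?thesis unfolding 1 2 dvd_eq_mod_eq_0
  proof cases
    case 2
    have "1 + \<omega> + \<omega>\<^sup>2 = 0" using \<omega> by (simp add: add_ac)
    thus "1 + \<omega> ^ (y mod 3) + (\<omega> ^ (y mod 3))\<^sup>2 = (if y mod 3 = 0 then 3 else 0)" unfolding 2 by simp
  next
    case 3
    have "1 + \<omega>\<^sup>2 + \<omega> = 0" using \<omega> by (simp add: add_ac)
    thus "1 + \<omega> ^ (y mod 3) + (\<omega> ^ (y mod 3))\<^sup>2 = (if y mod 3 = 0 then 3 else 0)" unfolding 3 cube_root_facts(3)[OF \<omega>] by simp
  qed simp
qed

lemma obtain_cube_root:
  obtains \<omega> :: complex where "\<omega>\<^sup>2 + \<omega> + 1 = 0"
proof -
  have "(csqrt (- 3))\<^sup>2 = (- 3 :: complex)" by (rule power2_csqrt)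
  hence "((csqrt (- 3) - 1) / 2)\<^sup>2 + (csqrt (- 3) - 1) / 2 + 1 = (0 :: complex)"
    by (simp add: power2_eq_square field_simps)
  thus ?thesis by (rule that)
qed

lemma tuples14_iff:
  "ns \<in> tuples [3, 3, 1, 1, 1, 1, 1, 1] t \<longleftrightarrow> (\<exists>a b c1 c2 c3 e1 e2 e3. ns = [a, b, c1, c2, c3, e1, e2, e3] \<and>
      3 * a + 3 * b + c1 + c2 + c3 + e1 + e2 + e3 = t)"
    (is "_ \<longleftrightarrow> ?R")
proof
  assume mem: "ns \<in> tuples [3, 3, 1, 1, 1, 1, 1, 1] t"
  have l: "length ns = 8" using mem[unfolded mem_tuples_iff, THEN conjunct1] by simp
  have s: "sum_list (map2 (*) [3, 3, 1, 1, 1, 1, 1, 1] ns) = t" by (rule mem[unfolded mem_tuples_iff, THEN conjunct2])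
  from l obtain a b c1 c2 c3 e1 e2 e3 where ns: "ns = [a, b, c1, c2, c3, e1, e2, e3]"
    by (rule list_8_cases)
  have eq: "3 * a + 3 * b + c1 + c2 + c3 + e1 + e2 + e3 = t" using s unfolding ns by simp
  show ?R by (rule exI[of _ a], rule exI[of _ b], rule exI[of _ c1], rule exI[of _ c2], rule exI[of _ c3], rule exI[of _ e1], rule exI[of _ e2], rule exI[of _ e3], rule conjI[OF ns eq])
next
  assume ?R
  then obtain a b c1 c2 c3 e1 e2 e3 where ns: "ns = [a, b, c1, c2, c3, e1, e2, e3]"
    and s: "3 * a + 3 * b + c1 + c2 + c3 + e1 + e2 + e3 = t" by blast
  have "sum_list (map2 (*) [3, 3, 1, 1, 1, 1, 1, 1] ns) = t" unfolding s[symmetric] ns by simp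
  moreover have "length ns = length ([3, 3, 1, 1, 1, 1, 1, 1] :: nat list)" unfolding ns by simp
  ultimately show "ns \<in> tuples [3, 3, 1, 1, 1, 1, 1, 1] t" unfolding mem_tuples_iff by (rule conjI[rotated])
qed

text \<open>The sum of the characters of order \<open>3\<close> and \<open>6\<close> whose component of order \<open>3\<close> is
  given by the cube root of unity \<open>\<theta>\<close>. The power of \<open>\<theta>\<close> in front takes the
  summand \<open>2 * k\<close> in the congruence modulo \<open>3\<close> into account.\<close>

definition twist14 :: "nat \<Rightarrow> complex \<Rightarrow> nat list \<Rightarrow> complex" where
  "twist14 k \<theta> ns = \<theta> ^ (2 * k) * char_weight [\<theta>, \<theta>, 1, \<theta>\<^sup>2, \<theta>, \<theta>\<^sup>2, 1, \<theta>] ns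
      + \<theta> ^ (2 * k) * char_weight [\<theta>, - \<theta>, 1, \<theta>\<^sup>2, \<theta>, - \<theta>\<^sup>2, - 1, - \<theta>] ns"

lemma twist14_eq:
  assumes "x = b + e1 + e2 + e3" "y = 2 * k + a + b + 2 * c2 + c3 + 2 * e1 + e3"
  shows "twist14 k \<theta> [a, b, c1, c2, c3, e1, e2, e3] = (1 + (- 1) ^ x) * \<theta> ^ y"
proof -
  have m: "(- c) ^ n = (- 1) ^ n * c ^ n" for c :: complex and n by (rule power_minus)
  have y: "\<theta> ^ y = \<theta> ^ (2 * k) * \<theta> ^ a * \<theta> ^ b * (\<theta>\<^sup>2) ^ c2 * \<theta> ^ c3 * (\<theta>\<^sup>2) ^ e1 * \<theta> ^ e3"
    unfolding assms(2) power_add power_mult ..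
  have x: "(- 1 :: complex) ^ x = (- 1) ^ b * (- 1) ^ e1 * (- 1) ^ e2 * (- 1) ^ e3"
    unfolding assms(1) power_add ..
  show ?thesis
    unfolding twist14_def char_weight.simps m[of \<theta>] m[of "\<theta>\<^sup>2"] distrib_right y x power_one
    by (simp only: mult_ac mult_1 mult_1_right)
qed

text \<open>The indicator function of the congruences as a sum over the six characters.\<close>

lemma indicator14:
  assumes \<omega>: "\<omega>\<^sup>2 + \<omega> + 1 = 0" and ns: "ns \<in> tuples [3, 3, 1, 1, 1, 1, 1, 1] (6 * k)"
  shows "char_weight [1, 1, 1, 1, 1, 1, 1, 1] ns + char_weight [1, - 1, 1, 1, 1, - 1, - 1, - 1] ns
      + twist14 k \<omega> ns + twist14 k (\<omega>\<^sup>2) ns = (if ns \<in> solutions14 k then 6 else 0)"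
proof -
  obtain a b c1 c2 c3 e1 e2 e3 where ns': "ns = [a, b, c1, c2, c3, e1, e2, e3]"
    and eq: "3 * a + 3 * b + c1 + c2 + c3 + e1 + e2 + e3 = 6 * k" using ns[unfolded tuples14_iff] by blast
  define x where "x = b + e1 + e2 + e3"
  define y where "y = 2 * k + a + b + 2 * c2 + c3 + 2 * e1 + e3"
  have mem: "ns \<in> solutions14 k \<longleftrightarrow> 2 dvd x \<and> 3 dvd y"
    unfolding solutions14_def ns' x_def y_def using eq by simp
  have 1: "char_weight [1, 1, 1, 1, 1, 1, 1, 1] ns = 1" by (simp add: ns')
  have 2: "char_weight [1, - 1, 1, 1, 1, - 1, - 1, - 1] ns = (- 1) ^ x"
    by (simp add: ns' x_def power_add)
  have 3: "twist14 k \<theta> ns = (1 + (- 1) ^ x) * \<theta> ^ y" for \<theta>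
    unfolding ns' by (rule twist14_eq[OF x_def y_def])
  have "1 + (- 1) ^ x + (1 + (- 1) ^ x) * \<omega> ^ y + (1 + (- 1) ^ x) * (\<omega>\<^sup>2) ^ y
     = (1 + (- 1) ^ x) * (1 + \<omega> ^ y + (\<omega>\<^sup>2) ^ y)"
    by (simp only: distrib_left mult_1_right)
  also have "\<dots> = (if ns \<in> solutions14 k then 6 else 0)"
    unfolding cube_root_sum[OF \<omega>] mem by (cases "even x") simp_all
  finally show ?thesis unfolding 1 2 3 .
qed

lemma sum_char_weight_8:
  assumes "\<forall>w\<in>set ws. w > 0" "length ws = 8"
  shows "(\<Sum>ns\<in>tuples ws t. char_weight [h1, h2, h3, h4, h5, h6, h7, h8] ns)
     = fps_nth (geoms ws [h1, h2, h3, h4, h5, h6, h7, h8]) t"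
  by (rule sum_char_weight_tuples[OF assms(1)]) (simp add: assms(2))

text \<open>The contributions of the trivial and of the quadratic character.\<close>

lemma T14_eq:
  "(1680 + 11504 * of_nat (2 * k) + 27006 * of_nat (2 * k) ^ 2 + 30709 * of_nat (2 * k) ^ 3 + 18900 * of_nat (2 * k) ^ 4
        + 6426 * of_nat (2 * k) ^ 5 + 1134 * of_nat (2 * k) ^ 6 + 81 * of_nat (2 * k) ^ 7) / 1680
    + (2 + 8 * of_nat k + 9 * of_nat k ^ 2 + 3 * of_nat k ^ 3) / 2 = complex_of_real (6 * T14 k)"
proof -
  define x where "x = complex_of_nat k"
  have T: "of_real (6 * T14 k) = 6 * ((x + 1) * (324 * x ^ 6 + 1944 * x ^ 5 + 4482 * x ^ 4 + 4968 * x ^ 3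
       + 2788 * x ^ 2 + 824 * x + 105) / 315)"
    unfolding T14_def Let_def x_def by simp
  have kx: "of_nat (2 * k) = 2 * x" "of_nat k = x" unfolding x_def by simp_all
  show ?thesis unfolding T kx power_mult_distrib
    by (simp add: field_simps eval_nat_numeral)
qed

lemma card_eq_sum_indicator:
  fixes c :: complex
  assumes "finite S" "A \<subseteq> S" "\<And>x. x \<in> S \<Longrightarrow> g x = (if x \<in> A then c else 0)"
  shows "(\<Sum>x\<in>S. g x) = of_nat (card A) * c"
proof -
  have "(\<Sum>x\<in>S. g x) = (\<Sum>x\<in>S. if x \<in> A then c else 0)" by (intro sum.cong refl assms(3))
  also have "\<dots> = (\<Sum>x\<in>A. c)" using assms(1,2) by (intro sum.mono_neutral_cong_right) auto
  finally show ?thesis by simp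
qed

theorem card_solutions14: "finite (solutions14 k)" "real (card (solutions14 k)) = T14 k + E14 k"
proof -
  define ws :: "nat list" where "ws = [3, 3, 1, 1, 1, 1, 1, 1]"
  have pos: "\<forall>w\<in>set ws. w > 0" "length ws = 8" by (simp_all add: ws_def)
  have fin: "finite (tuples ws (6 * k))" by (rule finite_tuples[OF pos(1)])
  have sub: "solutions14 k \<subseteq> tuples ws (6 * k)"
  proof
    fix ns assume "ns \<in> solutions14 k"
    thus "ns \<in> tuples ws (6 * k)" unfolding solutions14_def ws_def tuples14_iff mem_Collect_eq
      by - (elim exE conjE, intro exI conjI, assumption+)
  qed
  show "finite (solutions14 k)" by (rule finite_subset[OF sub fin])
  obtain \<omega> :: complex where \<omega>: "\<omega>\<^sup>2 + \<omega> + 1 = 0" by (rule obtain_cube_root)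
  have \<omega>2: "(\<omega>\<^sup>2)\<^sup>2 + \<omega>\<^sup>2 + 1 = 0" using \<omega> unfolding cube_root_facts(3)[OF \<omega>] by (simp add: add_ac)
  have 66: "6 * k = 3 * (2 * k)" by simp
  have t: "(\<Sum>ns\<in>tuples ws (6 * k). twist14 k \<theta> ns) = of_real (3 * E14 k)" if th: "\<theta>\<^sup>2 + \<theta> + 1 = 0" for \<theta>
    unfolding twist14_def sum.distrib sum_distrib_left[symmetric] sum_char_weight_8[OF pos]
    unfolding ws_def by (rule twisted_14[OF th])
  have u: "(\<Sum>ns\<in>tuples ws (6 * k). char_weight [1, 1, 1, 1, 1, 1, 1, 1] ns)
     = (1680 + 11504 * of_nat (2 * k) + 27006 * of_nat (2 * k) ^ 2 + 30709 * of_nat (2 * k) ^ 3 + 18900 * of_nat (2 * k) ^ 4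
        + 6426 * of_nat (2 * k) ^ 5 + 1134 * of_nat (2 * k) ^ 6 + 81 * of_nat (2 * k) ^ 7) / 1680"
    unfolding sum_char_weight_8[OF pos] unfolding ws_def 66 by (rule coeff_14_trivial)
  have v: "(\<Sum>ns\<in>tuples ws (6 * k). char_weight [1, - 1, 1, 1, 1, - 1, - 1, - 1] ns)
     = (2 + 8 * of_nat k + 9 * of_nat k ^ 2 + 3 * of_nat k ^ 3) / 2"
    unfolding sum_char_weight_8[OF pos] unfolding ws_def by (rule coeff_14_sign)
  have "(\<Sum>ns\<in>tuples ws (6 * k). char_weight [1, 1, 1, 1, 1, 1, 1, 1] ns + char_weight [1, - 1, 1, 1, 1, - 1, - 1, - 1] ns
      + twist14 k \<omega> ns + twist14 k (\<omega>\<^sup>2) ns) = of_nat (card (solutions14 k)) * 6"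
    by (rule card_eq_sum_indicator[OF fin sub]) (rule indicator14[OF \<omega>], simp only: ws_def)
  hence "of_nat (card (solutions14 k)) * 6 = complex_of_real (6 * T14 k) + of_real (3 * E14 k) + of_real (3 * E14 k)"
    unfolding sum.distrib u v t[OF \<omega>] t[OF \<omega>2] T14_eq by (rule sym)
  hence "complex_of_real (real (card (solutions14 k)) * 6) = of_real (6 * T14 k + 3 * E14 k + 3 * E14 k)"
    by (simp only: of_real_add of_real_mult[of _ 6] of_real_of_nat_eq of_real_numeral)
  hence "real (card (solutions14 k)) * 6 = 6 * T14 k + 3 * E14 k + 3 * E14 k" by (simp only: of_real_eq_iff)
  thus "real (card (solutions14 k)) = T14 k + E14 k" by linarith
qed

section \<open>The count at level 15\<close>

text \<open>The vectors of the orders at the eight classes of cusps of level \<open>15\<close> of those theta quotients that are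
  modular forms of weight \<open>k\<close>. The equation is the valence formula; the congruence says that the
  exponents are integral.\<close>

definition solutions15 :: "nat \<Rightarrow> nat list set" where
  "solutions15 k = {[a, b, c1, c2, e1, e2, e3, e4] | a b c1 c2 e1 e2 e3 e4.
     4 * a + 4 * b + 2 * c1 + 2 * c2 + e1 + e2 + e3 + e4 = 8 * k \<and>
     4 dvd (k + a + 3 * b + 3 * c1 + c2 + 3 * e2 + 2 * e3 + e4)}"

text \<open>The factors of weight \<open>1\<close>, \<open>2\<close> and \<open>4\<close> are combined in this order by iterated
  summation.\<close>

lemma coeff_15_trivial:
  "fps_nth (geoms [4, 4, 2, 2, 1, 1, 1, 1] [1, 1, 1, 1, 1, 1, 1, 1]) (4 * n)
     = (630 + 4371 * of_nat n + 10402 * of_nat n ^ 2 + 11963 * of_nat n ^ 3 + 7420 * of_nat n ^ 4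
        + 2534 * of_nat n ^ 5 + 448 * of_nat n ^ 6 + 32 * of_nat n ^ 7) / 630"
proof -
  define F where "F = geom 1 1 * (geom 1 1 * (geom 1 1 * geom 1 1))"
  have 1: "fps_nth F (2 * n) = (3 + 11 * of_nat n + 12 * of_nat n ^ 2 + 4 * of_nat n ^ 3) / 3" for n
  proof -
    have e: "fps_nth F (2 * n) = (of_nat (2 * n) + 1) * (of_nat (2 * n) + 2) * (of_nat (2 * n) + 3) / 6"
      using geom_1_1_powers(3)[of 1 "2 * n"] by (simp only: F_def mult_1 zero_less_one)
    show ?thesis unfolding e by (simp add: field_simps eval_nat_numeral)
  qed
  have 2: "fps_nth (geom 2 1 * F) (2 * n) = (6 + 21 * of_nat n + 25 * of_nat n ^ 2 + 12 * of_nat n ^ 3 + 2 * of_nat n ^ 4) / 6" for n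
    by (rule geom_mult_nthI[OF _ 1]) (simp_all add: field_simps eval_nat_numeral)
  have 3: "fps_nth (geom 2 1 * (geom 2 1 * F)) (2 * n) = (30 + 103 * of_nat n + 130 * of_nat n ^ 2 + 75 * of_nat n ^ 3 + 20 * of_nat n ^ 4 + 2 * of_nat n ^ 5) / 30" for n
    by (rule geom_mult_nthI[OF _ 2]) (simp_all add: field_simps eval_nat_numeral)
  have 4: "fps_nth (geom 2 1 * (geom 2 1 * F)) (4 * n) = (15 + 103 * of_nat n + 260 * of_nat n ^ 2 + 300 * of_nat n ^ 3 + 160 * of_nat n ^ 4 + 32 * of_nat n ^ 5) / 15" for n
  proof -
    have 44: "4 * n = 2 * (2 * n)" by simp
    show ?thesis unfolding 44 3 by (simp add: field_simps eval_nat_numeral)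
  qed
  have 5: "fps_nth (geom 4 1 * (geom 2 1 * (geom 2 1 * F))) (4 * n) = (90 + 627 * of_nat n + 1523 * of_nat n ^ 2 + 1740 * of_nat n ^ 3 + 1010 * of_nat n ^ 4 + 288 * of_nat n ^ 5 + 32 * of_nat n ^ 6) / 90" for n
    by (rule geom_mult_nthI[OF _ 4]) (simp_all add: field_simps eval_nat_numeral)
  have 6: "fps_nth (geom 4 1 * (geom 4 1 * (geom 2 1 * (geom 2 1 * F)))) (4 * n) = (630 + 4371 * of_nat n + 10402 * of_nat n ^ 2 + 11963 * of_nat n ^ 3 + 7420 * of_nat n ^ 4
        + 2534 * of_nat n ^ 5 + 448 * of_nat n ^ 6 + 32 * of_nat n ^ 7) / 630" for n
    by (rule geom_mult_nthI[OF _ 5]) (simp_all add: field_simps eval_nat_numeral)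
  show ?thesis using 6 by (simp add: F_def)
qed

text \<open>For the quadratic character the product is \<open>1 / (1 - X\<^sup>8)\<^sup>2\<close>.\<close>

lemma coeff_15_sign:
  "fps_nth (geoms [4, 4, 2, 2, 1, 1, 1, 1] [- 1, - 1, - 1, - 1, 1, - 1, 1, - 1]) (8 * n) = of_nat n + 1"
proof -
  have "geoms [4, 4, 2, 2, 1, 1, 1, 1] [- 1, - 1, - 1, - 1, 1, - 1, 1, - 1]
     = geom 4 (- 1) * geom 4 (- 1) * (geom 2 (- 1) * geom 2 (- 1)) * ((geom 1 1 * geom 1 (- 1)) * (geom 1 1 * geom 1 (- 1)))"
    unfolding geoms.simps mult_1_right by (simp only: mult_ac)
  also have "\<dots> = geom 4 (- 1) * geom 4 (- 1) * ((geom 2 1 * geom 2 (- 1)) * (geom 2 1 * geom 2 (- 1)))"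
    using geom_mult_minus[of 1 1] by (simp add: mult_ac)
  also have "\<dots> = (geom 4 1 * geom 4 (- 1)) * (geom 4 1 * geom 4 (- 1))"
    using geom_mult_minus[of 2 1] by (simp add: mult_ac)
  also have "\<dots> = geom 8 1 * geom 8 1" using geom_mult_minus[of 4 1] by simp
  finally show ?thesis using geom_1_1_powers(1)[of 8 n] by (simp only:)
qed

text \<open>For a character of order \<open>4\<close> the product is \<open>1 / (1 - X\<^sup>1\<^sup>6)\<close>.\<close>

lemma coeff_15_quartic:
  assumes \<iota>: "\<iota>\<^sup>2 = - 1"
  shows "fps_nth (geoms [4, 4, 2, 2, 1, 1, 1, 1] [\<iota>, - \<iota>, - \<iota>, \<iota>, 1, - \<iota>, - 1, \<iota>]) (8 * n) = (if even n then 1 else 0)"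
proof -
  have "geoms [4, 4, 2, 2, 1, 1, 1, 1] [\<iota>, - \<iota>, - \<iota>, \<iota>, 1, - \<iota>, - 1, \<iota>]
     = (geom 4 \<iota> * geom 4 (- \<iota>)) * (geom 2 \<iota> * geom 2 (- \<iota>)) * ((geom 1 1 * geom 1 (- 1)) * (geom 1 \<iota> * geom 1 (- \<iota>)))"
    unfolding geoms.simps mult_1_right by (simp only: mult_ac)
  also have "\<dots> = geom 8 (- 1) * geom 4 (- 1) * (geom 2 1 * geom 2 (- 1))"
    using geom_mult_minus[of 4 \<iota>] geom_mult_minus[of 2 \<iota>] geom_mult_minus[of 1 \<iota>] geom_mult_minus[of 1 1] by (simp add: \<iota>)
  also have "geom 2 1 * geom 2 (- 1) = geom 4 1" using geom_mult_minus[of 2 1] by simp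
  also have "geom 8 (- 1) * geom 4 (- 1) * geom 4 1 = geom 8 (- 1) * (geom 4 1 * geom 4 (- 1))" by (simp only: mult_ac)
  also have "\<dots> = geom 8 1 * geom 8 (- 1)" using geom_mult_minus[of 4 1] by (simp add: mult.commute)
  also have "\<dots> = geom 16 1" using geom_mult_minus[of 8 1] by simp
  finally have eq: "geoms [4, 4, 2, 2, 1, 1, 1, 1] [\<iota>, - \<iota>, - \<iota>, \<iota>, 1, - \<iota>, - 1, \<iota>] = geom 16 1" .
  have "16 dvd 8 * n \<longleftrightarrow> even n" by presburger
  thus ?thesis unfolding eq geom_def by simp
qed

lemma imaginary_power_sum: "1 + \<i> ^ y + (- 1) ^ y + (- \<i>) ^ y = (if 4 dvd y then 4 else 0 :: complex)"
proof -
  have y: "y = 4 * (y div 4) + y mod 4" by simp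
  have 4: "\<i> ^ 4 = 1" "(- 1) ^ 4 = (1 :: complex)" "(- \<i>) ^ 4 = 1" by (simp_all add: power4_eq_xxxx)
  have p: "c ^ y = c ^ (y mod 4)" if "c ^ 4 = 1" for c :: complex
    by (subst y, subst power_add, subst power_mult) (simp add: that)
  have "y mod 4 < 4" by simp
  then consider "y mod 4 = 0" | "y mod 4 = 1" | "y mod 4 = 2" | "y mod 4 = 3" by linarith
  thus ?thesis unfolding p[OF 4(1)] p[OF 4(2)] p[OF 4(3)] dvd_eq_mod_eq_0
    by cases (simp_all add: power2_eq_square power3_eq_cube)
qed

lemma tuples15_iff:
  "ns \<in> tuples [4, 4, 2, 2, 1, 1, 1, 1] t \<longleftrightarrow> (\<exists>a b c1 c2 e1 e2 e3 e4. ns = [a, b, c1, c2, e1, e2, e3, e4] \<and>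
      4 * a + 4 * b + 2 * c1 + 2 * c2 + e1 + e2 + e3 + e4 = t)"
    (is "_ \<longleftrightarrow> ?R")
proof
  assume mem: "ns \<in> tuples [4, 4, 2, 2, 1, 1, 1, 1] t"
  have l: "length ns = 8" using mem[unfolded mem_tuples_iff, THEN conjunct1] by simp
  have s: "sum_list (map2 (*) [4, 4, 2, 2, 1, 1, 1, 1] ns) = t" by (rule mem[unfolded mem_tuples_iff, THEN conjunct2])
  from l obtain a b c1 c2 e1 e2 e3 e4 where ns: "ns = [a, b, c1, c2, e1, e2, e3, e4]"
    by (rule list_8_cases)
  have eq: "4 * a + 4 * b + 2 * c1 + 2 * c2 + e1 + e2 + e3 + e4 = t" using s unfolding ns by simp
  show ?R by (rule exI[of _ a], rule exI[of _ b], rule exI[of _ c1], rule exI[of _ c2], rule exI[of _ e1], rule exI[of _ e2], rule exI[of _ e3], rule exI[of _ e4], rule conjI[OF ns eq])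
next
  assume ?R
  then obtain a b c1 c2 e1 e2 e3 e4 where ns: "ns = [a, b, c1, c2, e1, e2, e3, e4]"
    and s: "4 * a + 4 * b + 2 * c1 + 2 * c2 + e1 + e2 + e3 + e4 = t" by blast
  have "sum_list (map2 (*) [4, 4, 2, 2, 1, 1, 1, 1] ns) = t" unfolding s[symmetric] ns by simp
  moreover have "length ns = length ([4, 4, 2, 2, 1, 1, 1, 1] :: nat list)" unfolding ns by simp
  ultimately show "ns \<in> tuples [4, 4, 2, 2, 1, 1, 1, 1] t" unfolding mem_tuples_iff by (rule conjI[rotated])
qed

lemma quartic_weight_eq:
  assumes t: "\<theta>\<^sup>2 = - 1" and y: "y = k + a + 3 * b + 3 * c1 + c2 + 3 * e2 + 2 * e3 + e4"
  shows "\<theta> ^ k * char_weight [\<theta>, - \<theta>, - \<theta>, \<theta>, 1, - \<theta>, - 1, \<theta>] [a, b, c1, c2, e1, e2, e3, e4] = \<theta> ^ y"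
proof -
  have t3: "\<theta> ^ 3 = - \<theta>" using t by (simp add: power3_eq_cube power2_eq_square)
  have "\<theta> ^ y = \<theta> ^ k * \<theta> ^ a * (\<theta> ^ 3) ^ b * (\<theta> ^ 3) ^ c1 * \<theta> ^ c2 * (\<theta> ^ 3) ^ e2 * (\<theta>\<^sup>2) ^ e3 * \<theta> ^ e4"
    unfolding y power_add power_mult ..
  thus ?thesis unfolding t3 t char_weight.simps power_one
    by (simp only: mult_ac mult_1 mult_1_right)
qed

lemma sign_weight_eq:
  assumes y: "y = k + a + 3 * b + 3 * c1 + c2 + 3 * e2 + 2 * e3 + e4"
  shows "(- 1) ^ k * char_weight [- 1, - 1, - 1, - 1, 1, - 1, 1, - 1] [a, b, c1, c2, e1, e2, e3, e4] = (- 1) ^ y"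
proof -
  have 3: "(- 1 :: complex) ^ 3 = - 1" "(- 1 :: complex)\<^sup>2 = 1" by simp_all
  have "(- 1 :: complex) ^ y = (- 1) ^ k * (- 1) ^ a * ((- 1) ^ 3) ^ b * ((- 1) ^ 3) ^ c1 * (- 1) ^ c2 * ((- 1) ^ 3) ^ e2 * ((- 1)\<^sup>2) ^ e3 * (- 1) ^ e4"
    unfolding y power_add power_mult ..
  thus ?thesis unfolding 3 char_weight.simps power_one
    by (simp only: mult_ac mult_1 mult_1_right)
qed

text \<open>The indicator function of the congruence as a sum over the four characters.\<close>

lemma indicator15:
  assumes ns: "ns \<in> tuples [4, 4, 2, 2, 1, 1, 1, 1] (8 * k)"
  shows "char_weight [1, 1, 1, 1, 1, 1, 1, 1] ns + \<i> ^ k * char_weight [\<i>, - \<i>, - \<i>, \<i>, 1, - \<i>, - 1, \<i>] ns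
      + (- 1) ^ k * char_weight [- 1, - 1, - 1, - 1, 1, - 1, 1, - 1] ns
      + (- \<i>) ^ k * char_weight [- \<i>, - (- \<i>), - (- \<i>), - \<i>, 1, - (- \<i>), - 1, - \<i>] ns
      = (if ns \<in> solutions15 k then 4 else 0)"
proof -
  obtain a b c1 c2 e1 e2 e3 e4 where ns': "ns = [a, b, c1, c2, e1, e2, e3, e4]"
    and eq: "4 * a + 4 * b + 2 * c1 + 2 * c2 + e1 + e2 + e3 + e4 = 8 * k" using ns[unfolded tuples15_iff] by blast
  define y where "y = k + a + 3 * b + 3 * c1 + c2 + 3 * e2 + 2 * e3 + e4"
  have mem: "ns \<in> solutions15 k \<longleftrightarrow> 4 dvd y"
    unfolding solutions15_def ns' y_def using eq by simp
  have i2: "\<i>\<^sup>2 = (- 1 :: complex)" "(- \<i>)\<^sup>2 = (- 1 :: complex)" by simp_all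
  have 1: "char_weight [1, 1, 1, 1, 1, 1, 1, 1] ns = 1" by (simp add: ns')
  show ?thesis
    unfolding 1 unfolding ns' quartic_weight_eq[OF i2(1) y_def] quartic_weight_eq[OF i2(2) y_def] sign_weight_eq[OF y_def]
      imaginary_power_sum unfolding ns'[symmetric] mem ..
qed

text \<open>The contribution of the trivial character.\<close>

lemma T15_eq:
  "(630 + 4371 * of_nat (2 * k) + 10402 * of_nat (2 * k) ^ 2 + 11963 * of_nat (2 * k) ^ 3 + 7420 * of_nat (2 * k) ^ 4
        + 2534 * of_nat (2 * k) ^ 5 + 448 * of_nat (2 * k) ^ 6 + 32 * of_nat (2 * k) ^ 7) / 630 = complex_of_real (4 * T15 k)"
proof -
  define x where "x = complex_of_nat k"
  have T: "of_real (4 * T15 k) = 4 * ((x + 1) * (2 * x + 1) * (2 * x + 3) * (512 * x ^ 4 + 2048 * x ^ 3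
       + 2584 * x ^ 2 + 1072 * x + 105) / 1260)"
    unfolding T15_def Let_def x_def by simp
  have kx: "of_nat (2 * k) = 2 * x" unfolding x_def by simp
  show ?thesis unfolding T kx power_mult_distrib
    by (simp add: field_simps eval_nat_numeral)
qed

text \<open>The contributions of the three nontrivial characters.\<close>

lemma E15_eq:
  "\<i> ^ k * (if even k then 1 else 0) + (- 1) ^ k * (of_nat k + 1) + (- \<i>) ^ k * (if even k then 1 else 0)
     = complex_of_real (4 * E15 k)"
proof -
  have y: "k = 4 * (k div 4) + k mod 4" by simp
  have 4: "\<i> ^ 4 = 1" "(- 1) ^ 4 = (1 :: complex)" "(- \<i>) ^ 4 = 1" by (simp_all add: power4_eq_xxxx)
  have p: "c ^ k = c ^ (k mod 4)" if "c ^ 4 = 1" for c :: complex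
    by (subst y, subst power_add, subst power_mult) (simp add: that)
  have ev: "even k \<longleftrightarrow> k mod 4 = 0 \<or> k mod 4 = 2" by presburger
  have "k mod 4 < 4" by simp
  then consider "k mod 4 = 0" | "k mod 4 = 1" | "k mod 4 = 2" | "k mod 4 = 3" by linarith
  thus ?thesis unfolding p[OF 4(1)] p[OF 4(2)] p[OF 4(3)] E15_def ev
    by cases (simp_all add: power2_eq_square power3_eq_cube field_simps)
qed

theorem card_solutions15: "finite (solutions15 k)" "real (card (solutions15 k)) = T15 k + E15 k"
proof -
  define ws :: "nat list" where "ws = [4, 4, 2, 2, 1, 1, 1, 1]"
  have pos: "\<forall>w\<in>set ws. w > 0" "length ws = 8" by (simp_all add: ws_def)
  have fin: "finite (tuples ws (8 * k))" by (rule finite_tuples[OF pos(1)])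
  have sub: "solutions15 k \<subseteq> tuples ws (8 * k)"
  proof
    fix ns assume "ns \<in> solutions15 k"
    thus "ns \<in> tuples ws (8 * k)" unfolding solutions15_def ws_def tuples15_iff mem_Collect_eq
      by - (elim exE conjE, intro exI conjI, assumption+)
  qed
  show "finite (solutions15 k)" by (rule finite_subset[OF sub fin])
  have i2: "\<i>\<^sup>2 = (- 1 :: complex)" "(- \<i>)\<^sup>2 = (- 1 :: complex)" by simp_all
  have 88: "8 * k = 4 * (2 * k)" by simp
  have t: "(\<Sum>ns\<in>tuples ws (8 * k). \<theta> ^ k * char_weight [\<theta>, - \<theta>, - \<theta>, \<theta>, 1, - \<theta>, - 1, \<theta>] ns) = \<theta> ^ k * (if even k then 1 else 0)"
    if th: "\<theta>\<^sup>2 = - 1" for \<theta>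
    unfolding sum_distrib_left[symmetric] sum_char_weight_8[OF pos]
    unfolding ws_def coeff_15_quartic[OF th] ..
  have u: "(\<Sum>ns\<in>tuples ws (8 * k). char_weight [1, 1, 1, 1, 1, 1, 1, 1] ns)
     = (630 + 4371 * of_nat (2 * k) + 10402 * of_nat (2 * k) ^ 2 + 11963 * of_nat (2 * k) ^ 3 + 7420 * of_nat (2 * k) ^ 4
        + 2534 * of_nat (2 * k) ^ 5 + 448 * of_nat (2 * k) ^ 6 + 32 * of_nat (2 * k) ^ 7) / 630"
    unfolding sum_char_weight_8[OF pos] unfolding ws_def 88 by (rule coeff_15_trivial)
  have v: "(\<Sum>ns\<in>tuples ws (8 * k). (- 1) ^ k * char_weight [- 1, - 1, - 1, - 1, 1, - 1, 1, - 1] ns)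
     = (- 1) ^ k * (of_nat k + 1)"
    unfolding sum_distrib_left[symmetric] sum_char_weight_8[OF pos] unfolding ws_def coeff_15_sign ..
  have "(\<Sum>ns\<in>tuples ws (8 * k). char_weight [1, 1, 1, 1, 1, 1, 1, 1] ns + \<i> ^ k * char_weight [\<i>, - \<i>, - \<i>, \<i>, 1, - \<i>, - 1, \<i>] ns
      + (- 1) ^ k * char_weight [- 1, - 1, - 1, - 1, 1, - 1, 1, - 1] ns
      + (- \<i>) ^ k * char_weight [- \<i>, - (- \<i>), - (- \<i>), - \<i>, 1, - (- \<i>), - 1, - \<i>] ns) = of_nat (card (solutions15 k)) * 4"
    by (rule card_eq_sum_indicator[OF fin sub]) (rule indicator15, simp only: ws_def)
  hence "of_nat (card (solutions15 k)) * 4 = complex_of_real (4 * T15 k) + (\<i> ^ k * (if even k then 1 else 0) + (- 1) ^ k * (of_nat k + 1) + (- \<i>) ^ k * (if even k then 1 else 0))"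
    unfolding sum.distrib u v t[OF i2(1)] t[OF i2(2)] T15_eq add.assoc[symmetric] by (rule sym)
  hence "complex_of_real (real (card (solutions15 k)) * 4) = of_real (4 * T15 k + 4 * E15 k)"
    unfolding E15_eq by (simp only: of_real_add of_real_mult[of _ 4] of_real_of_nat_eq of_real_numeral)
  hence "real (card (solutions15 k)) * 4 = 4 * T15 k + 4 * E15 k" by (simp only: of_real_eq_iff)
  thus "real (card (solutions15 k)) = T15 k + E15 k" by linarith
qed

section \<open>The orders at the cusps and the character\<close>

text \<open>Twice the sum by which the orders of the Klein forms lower the order of an eta quotient of level \<open>14\<close> or
  \<open>15\<close> at the cusps of the class \<open>(e, a)\<close>, where the vector \<open>f\<close> of exponents is
  indexed by \<open>{1..7}\<close>.\<close>

definition weight_sum :: "int \<Rightarrow> int \<Rightarrow> (nat \<Rightarrow> int) \<Rightarrow> int" where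
  "weight_sum e a f = (\<Sum>j=1..7. f j * ((int j * a) mod e) * (e - (int j * a) mod e))"

lemma sum_1_7: "(\<Sum>j=Suc 0..7. g j) = g (Suc 0) + g 2 + g 3 + g 4 + g 5 + g 6 + g (7::nat)"
  by (simp add: eval_nat_numeral)

lemma weight_sum_cong:
  assumes "a mod e = b mod e \<or> (- a) mod e = b mod e"
  shows "weight_sum e a f = weight_sum e b f"
proof -
  have cong: "weight_sum e x f = weight_sum e y f" if "x mod e = y mod e" for x y
  proof -
    have "(int j * x) mod e = (int j * y) mod e" for j by (metis that mod_mult_right_eq)
    thus ?thesis by (simp add: weight_sum_def)
  qed
  have "((int j * (- a)) mod e) * (e - (int j * (- a)) mod e) = ((int j * a) mod e) * (e - (int j * a) mod e)" for j
    by (simp add: zmod_zminus1_eq_if)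
  hence "weight_sum e (- a) f = weight_sum e a f"
    unfolding weight_sum_def mult.assoc by (simp only:)
  thus ?thesis using assms cong by metis
qed

lemma cusp_order_Nats_iff:
  assumes "N div 2 = 7"
  shows "cusp_order N D f e a \<in> \<nat> \<longleftrightarrow> (\<exists>n::nat. 2 * e * e * D - weight_sum e a f = 2 * int n)"
proof -
  have c: "cusp_order N D f e a = real_of_int (2 * e * e * D - weight_sum e a f) / 2"
    unfolding cusp_order_def assms weight_sum_def
    by (simp add: diff_divide_distrib flip: sum_divide_distrib)
  have "cusp_order N D f e a = real n \<longleftrightarrow> 2 * e * e * D - weight_sum e a f = 2 * int n" for n
  proof -
    have "cusp_order N D f e a = real n \<longleftrightarrow> real_of_int (2 * e * e * D - weight_sum e a f) = real_of_int (2 * int n)"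
      unfolding c by auto
    thus ?thesis by (simp only: of_int_eq_iff)
  qed
  thus ?thesis unfolding Nats_def image_iff by auto
qed

text \<open>A cusp of the class \<open>(e, a)\<close> has width \<open>N / e\<close>, so that its order in the local parameter is
  \<open>1 / e\<close> times the order in the uniform parameter \<open>q\<^sup>1\<^sup>/\<^sup>N\<close>.\<close>

lemma cusp_coordinate_exists:
  fixes a b d e D V m :: int
  assumes O: "\<forall>a b c d. a * d - b * c = 1 \<longrightarrow> cusp_order N D f (gcd (int N) c) a \<in> \<nat>"
    and N: "N div 2 = 7" and e: "e dvd int N" "e > 0" and det: "a * d - b * e = 1"
    and W: "weight_sum e a f = m * V" and m: "m = (if even e then 2 * e else e)"
  shows "\<exists>n::nat. 2 * e * int n = 2 * e * e * D - weight_sum e a f"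
proof -
  have "gcd (int N) e = e" using gcd_proj2_if_dvd_int[OF e(1)] e(2) by simp
  hence "cusp_order N D f e a \<in> \<nat>" using O[rule_format, OF det] by simp
  then obtain n where n: "2 * e * e * D - weight_sum e a f = 2 * int n"
    using cusp_order_Nats_iff[OF N] by auto
  have "e dvd int n"
  proof (cases "even e")
    case True
    hence "2 * int n = 2 * (e * (e * D - V))" using n W m by (simp add: algebra_simps)
    thus ?thesis by simp
  next
    case False
    have "e dvd 2 * int n" unfolding n[symmetric] W m using False by simp
    moreover have "coprime e 2" using False by simp
    ultimately show ?thesis by (simp add: coprime_dvd_mult_right_iff)
  qed
  then obtain t where t: "int n = e * t" by (elim dvdE)
  have "0 \<le> e * t" unfolding t[symmetric] by simp
  hence "t \<ge> 0" using e(2) by (simp add: zero_le_mult_iff)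
  hence "2 * e * int (nat t) = 2 * e * e * D - weight_sum e a f" using n t by simp
  thus ?thesis ..
qed

lemma coprime_gcd_of_det:
  fixes a b c d n :: int
  assumes "a * d - b * c = 1" shows "coprime a (gcd n c)"
proof (rule coprimeI)
  fix x assume "x dvd a" "x dvd gcd n c"
  hence "x dvd a * d - b * c" by (intro dvd_diff dvd_mult2[of x a] dvd_mult[of x c]) auto
  thus "is_unit x" using assms by simp
qed

lemma ee_half_eq_1_iff:
  assumes "N > 0"
  shows "ee ((of_int X + of_int Y / of_nat N) / 2) = 1 \<longleftrightarrow> 2 * int N dvd int N * X + Y"
proof -
  have nz: "of_nat N \<noteq> (0::complex)" using assms by simp
  have "(of_int X + of_int Y / of_nat N) / 2 = (of_int n :: complex) \<longleftrightarrow> int N * X + Y = 2 * int N * n" for n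
  proof -
    have "(of_int X + of_int Y / of_nat N) / 2 = (of_int n :: complex)
      \<longleftrightarrow> of_int (int N * X + Y) = (of_int (2 * int N * n) :: complex)"
      using nz by (simp add: field_simps)
    thus ?thesis by (simp only: of_int_eq_iff)
  qed
  thus ?thesis unfolding ee_eq_1_iff dvd_def by (simp only:)
qed

text \<open>The translation and one further matrix detect the conditions.\<close>

lemma Gamma1_trivial_iff_14:
  "(\<forall>u b c v. (1 + int 14 * u) * (1 + int 14 * v) - b * (int 14 * c) = 1 \<longrightarrow> ee (Gamma1_exponent 14 f u b) = 1)
   \<longleftrightarrow> 2 dvd (f 1 + 2 * f 2 + 3 * f 3 + 4 * f 4 + 5 * f 5 + 6 * f 6 + 7 * f 7)
     \<and> 28 dvd (f 1 + 4 * f 2 + 9 * f 3 + 16 * f 4 + 25 * f 5 + 36 * f 6 + 49 * f 7)"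
proof -
  define P where "P = f 1 + 2 * f 2 + 3 * f 3 + 4 * f 4 + 5 * f 5 + 6 * f 6 + 7 * f 7"
  define Q where "Q = f 1 + 4 * f 2 + 9 * f 3 + 16 * f 4 + 25 * f 5 + 36 * f 6 + 49 * f 7"
  have P': "(\<Sum>j=1..14 div 2. int j * f j) = P" by (simp add: sum_1_7 P_def)
  have Q': "(\<Sum>j=1..14 div 2. (int j)\<^sup>2 * f j) = Q" by (simp add: sum_1_7 Q_def)
  have G: "ee (Gamma1_exponent 14 f u b) = 1 \<longleftrightarrow> 28 dvd 14 * ((u + b) * P + u * b * Q) + b * Q" for u b
    using ee_half_eq_1_iff[of 14 "(u + b) * P + u * b * Q" "b * Q"]
    unfolding Gamma1_exponent_def P' Q' by simp
  show ?thesis unfolding G P_def[symmetric] Q_def[symmetric]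
  proof (intro iffI allI impI)
    assume H: "\<forall>u b c v. (1 + int 14 * u) * (1 + int 14 * v) - b * (int 14 * c) = 1 \<longrightarrow> 28 dvd 14 * ((u + b) * P + u * b * Q) + b * Q"
    \<comment> \<open>the matrices with the rows \<open>(1, 1)\<close>, \<open>(0, 1)\<close> and \<open>(15, 2)\<close>, \<open>(112, 15)\<close>\<close>
    have "28 dvd 14 * P + Q" using H[rule_format, of 0 0 1 0] by simp
    moreover have "28 dvd 42 * P + 30 * Q" using H[rule_format, of 1 1 2 8] by (simp add: add.commute)
    ultimately obtain x y where xy: "14 * P + Q = 28 * x" "42 * P + 30 * Q = 28 * y"
      by (elim dvdE) (rule that)
    have "Q = 28 * (Q - y + 3 * x)" "P = 2 * (y - Q - 2 * x)" using xy by algebra+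
    thus "2 dvd P \<and> 28 dvd Q" by (metis dvd_triv_left)
  next
    fix u b c v :: int
    assume "2 dvd P \<and> 28 dvd Q"
    then obtain p q where "P = 2 * p" "Q = 28 * q" by (auto elim!: dvdE)
    hence "14 * ((u + b) * P + u * b * Q) + b * Q = 28 * ((u + b) * p + 14 * u * b * q + b * q)"
      by (simp add: algebra_simps)
    thus "28 dvd 14 * ((u + b) * P + u * b * Q) + b * Q" by simp
  qed
qed

text \<open>At odd level the conditions modulo \<open>2\<close> are automatic.\<close>

lemma Gamma1_trivial_iff_15:
  "(\<forall>u b c v. (1 + int 15 * u) * (1 + int 15 * v) - b * (int 15 * c) = 1 \<longrightarrow> ee (Gamma1_exponent 15 f u b) = 1)
   \<longleftrightarrow> 15 dvd (f 1 + 4 * f 2 + 9 * f 3 + 16 * f 4 + 25 * f 5 + 36 * f 6 + 49 * f 7)"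
proof -
  define P where "P = f 1 + 2 * f 2 + 3 * f 3 + 4 * f 4 + 5 * f 5 + 6 * f 6 + 7 * f 7"
  define Q where "Q = f 1 + 4 * f 2 + 9 * f 3 + 16 * f 4 + 25 * f 5 + 36 * f 6 + 49 * f 7"
  have P': "(\<Sum>j=1..15 div 2. int j * f j) = P" by (simp add: sum_1_7 P_def)
  have Q': "(\<Sum>j=1..15 div 2. (int j)\<^sup>2 * f j) = Q" by (simp add: sum_1_7 Q_def)
  have PQ: "even (P + Q)"
  proof -
    have "P + Q = 2 * (f 1 + 3 * f 2 + 6 * f 3 + 10 * f 4 + 15 * f 5 + 21 * f 6 + 28 * f 7)"
      by (simp add: P_def Q_def)
    thus ?thesis by simp
  qed
  have G: "ee (Gamma1_exponent 15 f u b) = 1 \<longleftrightarrow> 30 dvd 15 * ((u + b) * P + u * b * Q) + b * Q" for u b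
    using ee_half_eq_1_iff[of 15 "(u + b) * P + u * b * Q" "b * Q"]
    unfolding Gamma1_exponent_def P' Q' by simp
  show ?thesis unfolding G Q_def[symmetric]
  proof (intro iffI allI impI)
    assume H: "\<forall>u b c v. (1 + int 15 * u) * (1 + int 15 * v) - b * (int 15 * c) = 1 \<longrightarrow> 30 dvd 15 * ((u + b) * P + u * b * Q) + b * Q"
    have "30 dvd 15 * P + Q" using H[rule_format, of 0 0 1 0] by simp
    thus "15 dvd Q" by presburger
  next
    fix u b c v :: int
    assume det: "(1 + int 15 * u) * (1 + int 15 * v) - b * (int 15 * c) = 1"
    assume "15 dvd Q"
    then obtain q where q: "Q = 15 * q" by (elim dvdE)
    \<comment> \<open>If \<open>u\<close> is odd, the upper left entry is even, and the determinant would be even for an even \<open>b\<close>.\<close>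
    have ub: "odd u \<Longrightarrow> odd b"
    proof
      assume "odd u" "even b"
      hence "even ((1 + int 15 * u) * (1 + int 15 * v) - b * (int 15 * c))" by simp
      thus False unfolding det by simp
    qed
    have "even ((u + b) * P + 15 * (u * b * q) + b * q)"
      using PQ ub unfolding q by (cases "even u"; cases "even b"; cases "even P"; simp)
    then obtain m where "(u + b) * P + 15 * (u * b * q) + b * q = 2 * m" by (elim evenE)
    moreover have "15 * ((u + b) * P + u * b * Q) + b * Q = 15 * ((u + b) * P + 15 * (u * b * q) + b * q)"
      unfolding q by (simp add: algebra_simps)
    ultimately have "15 * ((u + b) * P + u * b * Q) + b * Q = 30 * m" by simp
    thus "30 dvd 15 * ((u + b) * P + u * b * Q) + b * Q" by simp
  qed
qed

text \<open>A bijection between \<open>S\<close> and \<open>T\<close>, given as a relation.\<close>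

lemma card_eq_of_relation:
  assumes fin: "finite S" and ex: "\<And>x. x \<in> S \<Longrightarrow> \<exists>y\<in>T. R x y" and ex': "\<And>y. y \<in> T \<Longrightarrow> \<exists>x\<in>S. R x y"
    and un: "\<And>x y z. y \<in> T \<Longrightarrow> z \<in> T \<Longrightarrow> R x y \<Longrightarrow> R x z \<Longrightarrow> y = z"
    and un': "\<And>x y z. R x z \<Longrightarrow> R y z \<Longrightarrow> x = y"
  shows "finite T \<and> card T = card S"
proof -
  obtain h where h: "\<And>x. x \<in> S \<Longrightarrow> h x \<in> T \<and> R x (h x)" using ex by metis
  have inj: "inj_on h S" by (rule inj_onI) (metis h un')
  have "h ` S = T"
  proof (intro equalityI subsetI)
    fix y assume "y \<in> T"
    moreover from ex'[OF this] obtain x where "x \<in> S" "R x y" by blast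
    ultimately have "h x = y" using h un by metis
    thus "y \<in> h ` S" using \<open>x \<in> S\<close> by blast
  qed (use h in blast)
  thus ?thesis using fin card_image[OF inj] finite_imageI[OF fin, of h] by simp
qed

lemma divisors_14: "e dvd int 14 \<Longrightarrow> e > 0 \<Longrightarrow> e \<in> {1, 2, 7, 14}"
proof -
  assume e: "e dvd int 14" "e > 0"
  hence "e \<le> 14" using zdvd_imp_le[of e 14] by simp
  hence "e = 1 \<or> e = 2 \<or> e = 3 \<or> e = 4 \<or> e = 5 \<or> e = 6 \<or> e = 7 \<or> e = 8 \<or> e = 9 \<or> e = 10 \<or> e = 11 \<or> e = 12 \<or> e = 13 \<or> e = 14"
    using e(2) by presburger
  thus ?thesis using e(1) by auto
qed

lemma divisors_15: "e dvd int 15 \<Longrightarrow> e > 0 \<Longrightarrow> e \<in> {1, 3, 5, 15}"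
proof -
  assume e: "e dvd int 15" "e > 0"
  hence "e \<le> 15" using zdvd_imp_le[of e 15] by simp
  hence "e = 1 \<or> e = 2 \<or> e = 3 \<or> e = 4 \<or> e = 5 \<or> e = 6 \<or> e = 7 \<or> e = 8 \<or> e = 9 \<or> e = 10 \<or> e = 11 \<or> e = 12 \<or> e = 13 \<or> e = 14 \<or> e = 15"
    using e(2) by presburger
  thus ?thesis using e(1) by auto
qed

lemma nat_dvd_of_int_eq: "int n = int m * x \<Longrightarrow> m dvd n"
  by (metis dvd_triv_left int_dvd_int_iff)

lemma not_coprime_dvd: "x dvd a \<Longrightarrow> x dvd e \<Longrightarrow> x > 1 \<Longrightarrow> \<not> coprime a (e :: int)"
  using not_coprimeI[of x a e] by auto

lemma coprime_imp_mod_2: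
  fixes a :: int
  assumes "coprime a 2" shows "(a mod 2 = 1 \<or> (- a) mod 2 = 1)"
proof -
  have "\<not> 2 dvd a" using assms not_coprime_dvd[of 2 a 2] by auto
  thus ?thesis by presburger
qed

lemma coprime_imp_mod_7:
  fixes a :: int
  assumes "coprime a 7" shows "(a mod 7 = 1 \<or> (- a) mod 7 = 1) \<or> (a mod 7 = 2 \<or> (- a) mod 7 = 2) \<or> (a mod 7 = 3 \<or> (- a) mod 7 = 3)"
proof -
  define r where "r = a mod 7"
  have "\<not> 7 dvd a" using assms not_coprime_dvd[of 7 a 7] by auto
  hence *: "\<not> 7 dvd r" by (simp_all add: r_def dvd_mod_iff)
  have "0 \<le> r" "r < 7" by (simp_all add: r_def)
  hence mem: "r \<in> set [0..6]" by simp
  have all: "\<forall>r\<in>set [0..6]. \<not> 7 dvd r \<longrightarrow>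
      (r = 1 \<or> 7 - r = 1) \<or> (r = 2 \<or> 7 - r = 2) \<or> (r = 3 \<or> 7 - r = 3)"
    by code_simp
  have cases: "(r = 1 \<or> 7 - r = 1) \<or> (r = 2 \<or> 7 - r = 2) \<or> (r = 3 \<or> 7 - r = 3)"
    using bspec[OF all mem] * by blast
  have "r \<noteq> 0" using *(1) by auto
  hence neg: "(- a) mod 7 = 7 - r" using zmod_zminus1_eq_if[of a 7] by (simp add: r_def)
  show ?thesis unfolding neg r_def[symmetric] by (rule cases)
qed

lemma coprime_imp_mod_14:
  fixes a :: int
  assumes "coprime a 14" shows "(a mod 14 = 1 \<or> (- a) mod 14 = 1) \<or> (a mod 14 = 3 \<or> (- a) mod 14 = 3) \<or> (a mod 14 = 5 \<or> (- a) mod 14 = 5)"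
proof -
  define r where "r = a mod 14"
  have "\<not> 2 dvd a" "\<not> 7 dvd a" using assms not_coprime_dvd[of 2 a 14] not_coprime_dvd[of 7 a 14] by auto
  hence *: "\<not> 2 dvd r" "\<not> 7 dvd r" by (simp_all add: r_def dvd_mod_iff)
  have "0 \<le> r" "r < 14" by (simp_all add: r_def)
  hence mem: "r \<in> set [0..13]" by simp
  have all: "\<forall>r\<in>set [0..13]. \<not> 2 dvd r \<longrightarrow> \<not> 7 dvd r \<longrightarrow>
      (r = 1 \<or> 14 - r = 1) \<or> (r = 3 \<or> 14 - r = 3) \<or> (r = 5 \<or> 14 - r = 5)"
    by code_simp
  have cases: "(r = 1 \<or> 14 - r = 1) \<or> (r = 3 \<or> 14 - r = 3) \<or> (r = 5 \<or> 14 - r = 5)"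
    using bspec[OF all mem] * by blast
  have "r \<noteq> 0" using *(1) by auto
  hence neg: "(- a) mod 14 = 14 - r" using zmod_zminus1_eq_if[of a 14] by (simp add: r_def)
  show ?thesis unfolding neg r_def[symmetric] by (rule cases)
qed

lemma coprime_imp_mod_3:
  fixes a :: int
  assumes "coprime a 3" shows "(a mod 3 = 1 \<or> (- a) mod 3 = 1)"
proof -
  have "\<not> 3 dvd a" using assms not_coprime_dvd[of 3 a 3] by auto
  thus ?thesis by presburger
qed

lemma coprime_imp_mod_5:
  fixes a :: int
  assumes "coprime a 5" shows "(a mod 5 = 1 \<or> (- a) mod 5 = 1) \<or> (a mod 5 = 2 \<or> (- a) mod 5 = 2)"
proof -
  have "\<not> 5 dvd a" using assms not_coprime_dvd[of 5 a 5] by auto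
  thus ?thesis by presburger
qed

lemma coprime_imp_mod_15:
  fixes a :: int
  assumes "coprime a 15" shows "(a mod 15 = 1 \<or> (- a) mod 15 = 1) \<or> (a mod 15 = 2 \<or> (- a) mod 15 = 2) \<or> (a mod 15 = 4 \<or> (- a) mod 15 = 4) \<or> (a mod 15 = 7 \<or> (- a) mod 15 = 7)"
proof -
  define r where "r = a mod 15"
  have "\<not> 3 dvd a" "\<not> 5 dvd a" using assms not_coprime_dvd[of 3 a 15] not_coprime_dvd[of 5 a 15] by auto
  hence *: "\<not> 3 dvd r" "\<not> 5 dvd r" by (simp_all add: r_def dvd_mod_iff)
  have "0 \<le> r" "r < 15" by (simp_all add: r_def)
  hence mem: "r \<in> set [0..14]" by simp
  have all: "\<forall>r\<in>set [0..14]. \<not> 3 dvd r \<longrightarrow> \<not> 5 dvd r \<longrightarrow>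
      (r = 1 \<or> 15 - r = 1) \<or> (r = 2 \<or> 15 - r = 2) \<or> (r = 4 \<or> 15 - r = 4) \<or> (r = 7 \<or> 15 - r = 7)"
    by code_simp
  have cases: "(r = 1 \<or> 15 - r = 1) \<or> (r = 2 \<or> 15 - r = 2) \<or> (r = 4 \<or> 15 - r = 4) \<or> (r = 7 \<or> 15 - r = 7)"
    using bspec[OF all mem] * by blast
  have "r \<noteq> 0" using *(1) by auto
  hence neg: "(- a) mod 15 = 15 - r" using zmod_zminus1_eq_if[of a 15] by (simp add: r_def)
  show ?thesis unfolding neg r_def[symmetric] by (rule cases)
qed

section \<open>The exponents of level 14\<close>

text \<open>The numbers \<open>A\<close>, \<open>B\<close>, \<open>C1\<close>, \<open>C2\<close>, \<open>C3\<close>,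
  \<open>E1\<close>, \<open>E2\<close>, \<open>E3\<close> are the orders of the theta quotient with exponents
  \<open>f\<close> at the eight classes of cusps \<open>a/c\<close>, in local parameters. The classes are given by
  \<open>(gcd 14 c, a mod gcd 14 c)\<close> up to the sign of \<open>a\<close>; in the order of the arguments they are
  \<open>(1, 0)\<close>, \<open>(2, 1)\<close>, \<open>(7, 1)\<close>, \<open>(7, 2)\<close>, \<open>(7, 3)\<close>,
  \<open>(14, 1)\<close>, \<open>(14, 3)\<close>, \<open>(14, 5)\<close>.\<close>

definition orders14 :: "nat \<Rightarrow> nat \<Rightarrow> nat \<Rightarrow> nat \<Rightarrow> nat \<Rightarrow> nat \<Rightarrow> nat \<Rightarrow> nat \<Rightarrow> nat \<Rightarrow> (nat \<Rightarrow> int) \<Rightarrow> bool" where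
  "orders14 k A B C1 C2 C3 E1 E2 E3 f \<longleftrightarrow>
     12 * int A = int k + f 1 + f 2 + f 3 + f 4 + f 5 + f 6 + f 7 \<and>
     4 * int B = 8 * int A - (f 1 + f 3 + f 5 + f 7) \<and>
     14 * int C1 = 98 * int A - (6 * f 1 + 10 * f 2 + 12 * f 3 + 12 * f 4 + 10 * f 5 + 6 * f 6) \<and>
     14 * int C2 = 98 * int A - (10 * f 1 + 12 * f 2 + 6 * f 3 + 6 * f 4 + 12 * f 5 + 10 * f 6) \<and>
     14 * int C3 = 98 * int A - (12 * f 1 + 6 * f 2 + 10 * f 3 + 10 * f 4 + 6 * f 5 + 12 * f 6) \<and>
     28 * int E1 = 392 * int A - (13 * f 1 + 24 * f 2 + 33 * f 3 + 40 * f 4 + 45 * f 5 + 48 * f 6 + 49 * f 7) \<and>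
     28 * int E2 = 392 * int A - (33 * f 1 + 48 * f 2 + 45 * f 3 + 24 * f 4 + 13 * f 5 + 40 * f 6 + 49 * f 7) \<and>
     28 * int E3 = 392 * int A - (45 * f 1 + 40 * f 2 + 13 * f 3 + 48 * f 4 + 33 * f 5 + 24 * f 6 + 49 * f 7)"

definition order_relation14 :: "nat \<Rightarrow> nat list \<Rightarrow> (nat \<Rightarrow> int) \<Rightarrow> bool" where
  "order_relation14 k ns f \<longleftrightarrow> (\<exists>A B C1 C2 C3 E1 E2 E3. ns = [A, B, C1, C2, C3, E1, E2, E3] \<and> orders14 k A B C1 C2 C3 E1 E2 E3 f)"

lemma weight_sum_14:
  shows "weight_sum 1 0 f = 0"
    "weight_sum 2 1 f = f 1 + f 3 + f 5 + f 7"
    "weight_sum 7 1 f = 6 * f 1 + 10 * f 2 + 12 * f 3 + 12 * f 4 + 10 * f 5 + 6 * f 6"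
    "weight_sum 7 2 f = 10 * f 1 + 12 * f 2 + 6 * f 3 + 6 * f 4 + 12 * f 5 + 10 * f 6"
    "weight_sum 7 3 f = 12 * f 1 + 6 * f 2 + 10 * f 3 + 10 * f 4 + 6 * f 5 + 12 * f 6"
    "weight_sum 14 1 f = 13 * f 1 + 24 * f 2 + 33 * f 3 + 40 * f 4 + 45 * f 5 + 48 * f 6 + 49 * f 7"
    "weight_sum 14 3 f = 33 * f 1 + 48 * f 2 + 45 * f 3 + 24 * f 4 + 13 * f 5 + 40 * f 6 + 49 * f 7"
    "weight_sum 14 5 f = 45 * f 1 + 40 * f 2 + 13 * f 3 + 48 * f 4 + 33 * f 5 + 24 * f 6 + 49 * f 7"
  by (simp_all add: weight_sum_def sum_1_7)

text \<open>The system of the eight equations is solved for the weight and the exponents.\<close>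

lemma order_equations14:
  assumes "orders14 k A B C1 C2 C3 E1 E2 E3 f"
  shows "3 * int A + 3 * int B + int C1 + int C2 + int C3 + int E1 + int E2 + int E3 = 6 * int k"
    "18 * f 1 = 42 * int A - 21 * int B + 10 * int C1 - 2 * int C2 - 14 * int C3 + 7 * int E1 + int E2 - 5 * int E3"
    "18 * f 2 = 21 * int A + 21 * int B - 7 * int C1 - 13 * int C2 + 17 * int C3 + 5 * int E1 - 7 * int E2 - int E3"
    "18 * f 3 = 42 * int A - 21 * int B - 14 * int C1 + 10 * int C2 - 2 * int C3 + int E1 - 5 * int E2 + 7 * int E3"
    "18 * f 4 = 21 * int A + 21 * int B - 13 * int C1 + 17 * int C2 - 7 * int C3 - int E1 + 5 * int E2 - 7 * int E3"
    "18 * f 5 = 42 * int A - 21 * int B - 2 * int C1 - 14 * int C2 + 10 * int C3 - 5 * int E1 + 7 * int E2 + int E3"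
    "18 * f 6 = 21 * int A + 21 * int B + 17 * int C1 - 7 * int C2 - 13 * int C3 - 7 * int E1 - int E2 + 5 * int E3"
    "18 * f 7 = 18 * int A - 9 * int B + 6 * int C1 + 6 * int C2 + 6 * int C3 - 3 * int E1 - 3 * int E2 - 3 * int E3"
proof -
  from assms have eqs: "12 * int A = int k + f 1 + f 2 + f 3 + f 4 + f 5 + f 6 + f 7"
    "4 * int B = 8 * int A - (f 1 + f 3 + f 5 + f 7)"
    "14 * int C1 = 98 * int A - (6 * f 1 + 10 * f 2 + 12 * f 3 + 12 * f 4 + 10 * f 5 + 6 * f 6)"
    "14 * int C2 = 98 * int A - (10 * f 1 + 12 * f 2 + 6 * f 3 + 6 * f 4 + 12 * f 5 + 10 * f 6)"
    "14 * int C3 = 98 * int A - (12 * f 1 + 6 * f 2 + 10 * f 3 + 10 * f 4 + 6 * f 5 + 12 * f 6)"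
    "28 * int E1 = 392 * int A - (13 * f 1 + 24 * f 2 + 33 * f 3 + 40 * f 4 + 45 * f 5 + 48 * f 6 + 49 * f 7)"
    "28 * int E2 = 392 * int A - (33 * f 1 + 48 * f 2 + 45 * f 3 + 24 * f 4 + 13 * f 5 + 40 * f 6 + 49 * f 7)"
    "28 * int E3 = 392 * int A - (45 * f 1 + 40 * f 2 + 13 * f 3 + 48 * f 4 + 33 * f 5 + 24 * f 6 + 49 * f 7)"
    unfolding orders14_def by simp_all
  show "3 * int A + 3 * int B + int C1 + int C2 + int C3 + int E1 + int E2 + int E3 = 6 * int k" using eqs by algebra
  show "18 * f 1 = 42 * int A - 21 * int B + 10 * int C1 - 2 * int C2 - 14 * int C3 + 7 * int E1 + int E2 - 5 * int E3" using eqs by algebra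
  show "18 * f 2 = 21 * int A + 21 * int B - 7 * int C1 - 13 * int C2 + 17 * int C3 + 5 * int E1 - 7 * int E2 - int E3" using eqs by algebra
  show "18 * f 3 = 42 * int A - 21 * int B - 14 * int C1 + 10 * int C2 - 2 * int C3 + int E1 - 5 * int E2 + 7 * int E3" using eqs by algebra
  show "18 * f 4 = 21 * int A + 21 * int B - 13 * int C1 + 17 * int C2 - 7 * int C3 - int E1 + 5 * int E2 - 7 * int E3" using eqs by algebra
  show "18 * f 5 = 42 * int A - 21 * int B - 2 * int C1 - 14 * int C2 + 10 * int C3 - 5 * int E1 + 7 * int E2 + int E3" using eqs by algebra
  show "18 * f 6 = 21 * int A + 21 * int B + 17 * int C1 - 7 * int C2 - 13 * int C3 - 7 * int E1 - int E2 + 5 * int E3" using eqs by algebra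
  show "18 * f 7 = 18 * int A - 9 * int B + 6 * int C1 + 6 * int C2 + 6 * int C3 - 3 * int E1 - 3 * int E2 - 3 * int E3" using eqs by algebra
qed

text \<open>The orders of a modular form are natural numbers; that they are integral in the local parameters is a consequence of
  the triviality of the character. Their congruences follow from the integrality of the exponents.\<close>

lemma mem_L14_imp:
  assumes f: "f \<in> L 14 k"
  obtains ns where "order_relation14 k ns f" "ns \<in> solutions14 k"
proof -
  have "modular_form_Gamma1 k 14 (theta_quotient 14 (2 * k) f)" using f by (simp add: L_def)
  from modular_form_theta_quotient_iff[THEN iffD1, OF zero_less_numeral this]
  obtain D where D: "int k + (\<Sum>j=1..14 div 2. f j) = 12 * D"
    and G: "\<forall>u b c v. (1 + int 14 * u) * (1 + int 14 * v) - b * (int 14 * c) = 1 \<longrightarrow> ee (Gamma1_exponent 14 f u b) = 1"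
    and O: "\<forall>a b c d. a * d - b * c = 1 \<longrightarrow> cusp_order 14 D f (gcd (int 14) c) a \<in> \<nat>"
    by (elim exE conjE) (rule that)
  have D': "int k + f 1 + f 2 + f 3 + f 4 + f 5 + f 6 + f 7 = 12 * D" using D by (simp add: sum_1_7)
  have cong: "2 dvd (f 1 + 2 * f 2 + 3 * f 3 + 4 * f 4 + 5 * f 5 + 6 * f 6 + 7 * f 7) \<and> 28 dvd (f 1 + 4 * f 2 + 9 * f 3 + 16 * f 4 + 25 * f 5 + 36 * f 6 + 49 * f 7)"
    by (rule Gamma1_trivial_iff_14[THEN iffD1, OF G])
  obtain P where P: "f 1 + 2 * f 2 + 3 * f 3 + 4 * f 4 + 5 * f 5 + 6 * f 6 + 7 * f 7 = 2 * P"
    using cong[THEN conjunct1] by (elim dvdE)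
  obtain Q where Q: "f 1 + 4 * f 2 + 9 * f 3 + 16 * f 4 + 25 * f 5 + 36 * f 6 + 49 * f 7 = 28 * Q" using cong[THEN conjunct2] by (elim dvdE)
  obtain A where A: "D = int A"
  proof -
    have "cusp_order 14 D f (gcd (int 14) 1) 0 \<in> \<nat>" by (rule O[rule_format, of 0 0 "- 1" 1]) simp
    then obtain n where "2 * 1 * 1 * D - weight_sum 1 0 f = 2 * int n"
      using cusp_order_Nats_iff[of 14 D f 1 0] by auto
    thus ?thesis using that[of n] by (simp add: weight_sum_14)
  qed
  \<comment> \<open>The congruences make the weighted sums divisible, so that the orders in the local parameters are integral.\<close>
  have w: "weight_sum 2 1 f = 4 * (7 * Q + (- f 2 - 2 * f 3 - 4 * f 4 - 6 * f 5 - 9 * f 6 - 12 * f 7))" unfolding weight_sum_14 using Q by algebra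
  have "\<exists>n::nat. 2 * 2 * int n = 2 * 2 * 2 * D - weight_sum 2 1 f"
    by (rule cusp_coordinate_exists[OF O _ _ _ _ w, of 1 0]) simp_all
  then obtain B where B: "4 * int B = 8 * D - (f 1 + f 3 + f 5 + f 7)"
    unfolding weight_sum_14 by auto
  have w: "weight_sum 7 1 f = 7 * (- (4 * Q) + (f 1 + 2 * f 2 + 3 * f 3 + 4 * f 4 + 5 * f 5 + 6 * f 6 + 7 * f 7))" unfolding weight_sum_14 using Q by algebra
  have "\<exists>n::nat. 2 * 7 * int n = 2 * 7 * 7 * D - weight_sum 7 1 f"
    by (rule cusp_coordinate_exists[OF O _ _ _ _ w, of 1 0]) simp_all
  then obtain C1 where C1: "14 * int C1 = 98 * D - (6 * f 1 + 10 * f 2 + 12 * f 3 + 12 * f 4 + 10 * f 5 + 6 * f 6)"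
    unfolding weight_sum_14 by auto
  have w: "weight_sum 7 2 f = 7 * (- (16 * Q) + (2 * f 1 + 4 * f 2 + 6 * f 3 + 10 * f 4 + 16 * f 5 + 22 * f 6 + 28 * f 7))" unfolding weight_sum_14 using Q by algebra
  have "\<exists>n::nat. 2 * 7 * int n = 2 * 7 * 7 * D - weight_sum 7 2 f"
    by (rule cusp_coordinate_exists[OF O _ _ _ _ w, of 4 1]) simp_all
  then obtain C2 where C2: "14 * int C2 = 98 * D - (10 * f 1 + 12 * f 2 + 6 * f 3 + 6 * f 4 + 12 * f 5 + 10 * f 6)"
    unfolding weight_sum_14 by auto
  have w: "weight_sum 7 3 f = 7 * (- (36 * Q) + (3 * f 1 + 6 * f 2 + 13 * f 3 + 22 * f 4 + 33 * f 5 + 48 * f 6 + 63 * f 7))" unfolding weight_sum_14 using Q by algebra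
  have "\<exists>n::nat. 2 * 7 * int n = 2 * 7 * 7 * D - weight_sum 7 3 f"
    by (rule cusp_coordinate_exists[OF O _ _ _ _ w, of 5 2]) simp_all
  then obtain C3 where C3: "14 * int C3 = 98 * D - (12 * f 1 + 6 * f 2 + 10 * f 3 + 10 * f 4 + 6 * f 5 + 12 * f 6)"
    unfolding weight_sum_14 by auto
  have w: "weight_sum 14 1 f = 28 * (P - Q)" unfolding weight_sum_14 using P Q by algebra
  have "\<exists>n::nat. 2 * 14 * int n = 2 * 14 * 14 * D - weight_sum 14 1 f"
    by (rule cusp_coordinate_exists[OF O _ _ _ _ w, of 1 0]) simp_all
  then obtain E1 where E1: "28 * int E1 = 392 * D - (13 * f 1 + 24 * f 2 + 33 * f 3 + 40 * f 4 + 45 * f 5 + 48 * f 6 + 49 * f 7)"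
    unfolding weight_sum_14 by auto
  have w: "weight_sum 14 3 f = 28 * (3 * P - 9 * Q + (f 5 + 4 * f 6 + 7 * f 7))" unfolding weight_sum_14 using P Q by algebra
  have "\<exists>n::nat. 2 * 14 * int n = 2 * 14 * 14 * D - weight_sum 14 3 f"
    by (rule cusp_coordinate_exists[OF O _ _ _ _ w, of 5 1]) simp_all
  then obtain E2 where E2: "28 * int E2 = 392 * D - (33 * f 1 + 48 * f 2 + 45 * f 3 + 24 * f 4 + 13 * f 5 + 40 * f 6 + 49 * f 7)"
    unfolding weight_sum_14 by auto
  have w: "weight_sum 14 5 f = 28 * (5 * P - 25 * Q + (f 3 + 6 * f 4 + 11 * f 5 + 18 * f 6 + 28 * f 7))" unfolding weight_sum_14 using P Q by algebra
  have "\<exists>n::nat. 2 * 14 * int n = 2 * 14 * 14 * D - weight_sum 14 5 f"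
    by (rule cusp_coordinate_exists[OF O _ _ _ _ w, of 3 1]) simp_all
  then obtain E3 where E3: "28 * int E3 = 392 * D - (45 * f 1 + 40 * f 2 + 13 * f 3 + 48 * f 4 + 33 * f 5 + 24 * f 6 + 49 * f 7)"
    unfolding weight_sum_14 by auto
  have eA: "12 * int A = int k + f 1 + f 2 + f 3 + f 4 + f 5 + f 6 + f 7" using D' unfolding A by (rule sym)
  note eqs = eA B[unfolded A] C1[unfolded A] C2[unfolded A] C3[unfolded A] E1[unfolded A] E2[unfolded A] E3[unfolded A]
  have ords: "orders14 k A B C1 C2 C3 E1 E2 E3 f" unfolding orders14_def by (intro conjI eqs)
  have rel: "order_relation14 k [A, B, C1, C2, C3, E1, E2, E3] f"
    unfolding order_relation14_def
    by (rule exI[of _ A], rule exI[of _ B], rule exI[of _ C1], rule exI[of _ C2], rule exI[of _ C3], rule exI[of _ E1], rule exI[of _ E2], rule exI[of _ E3], rule conjI[OF refl ords])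
  note tot = order_equations14(1)[OF ords]
  define p where "p = - int B + 3 * int A + int C1 + int C2 + int C3 - 3 * f 7"
  have "int B + int E1 + int E2 + int E3 = 2 * p" unfolding p_def using eqs by algebra
  hence "int (B + E1 + E2 + E3) = int 2 * p" by simp
  hence 2: "2 dvd (B + E1 + E2 + E3)" by (rule nat_dvd_of_int_eq)
  have "2 * int k + int A + int B + 2 * int C2 + int C3 + 2 * int E1 + int E3 = 3 * (4 * int A + int B + int C1 + int C2 + 2 * int E1 + int E2 + int E3 - 2 * int k - p - f 1)"
    unfolding p_def using eqs by algebra
  hence "int (2 * k + A + B + 2 * C2 + C3 + 2 * E1 + E3) = int 3 * (4 * int A + int B + int C1 + int C2 + 2 * int E1 + int E2 + int E3 - 2 * int k - p - f 1)" by simp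
  hence 3: "3 dvd (2 * k + A + B + 2 * C2 + C3 + 2 * E1 + E3)" by (rule nat_dvd_of_int_eq)
  have 1: "3 * A + 3 * B + C1 + C2 + C3 + E1 + E2 + E3 = 6 * k" using tot by linarith
  have "[A, B, C1, C2, C3, E1, E2, E3] \<in> solutions14 k" unfolding solutions14_def mem_Collect_eq
    by (rule exI[of _ A], rule exI[of _ B], rule exI[of _ C1], rule exI[of _ C2], rule exI[of _ C3], rule exI[of _ E1], rule exI[of _ E2], rule exI[of _ E3], intro conjI refl 1 2 3)
  with rel show ?thesis by (rule that)
qed

text \<open>Conversely the linear equations can be solved for integral exponents, and the criterion holds for them.\<close>

lemma solutions14_imp_mem_L:
  assumes ns: "ns \<in> solutions14 k"
  obtains f where "order_relation14 k ns f" "f \<in> L 14 k"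
proof -
  obtain A B C1 C2 C3 E1 E2 E3 where ns': "ns = [A, B, C1, C2, C3, E1, E2, E3]" and 1: "3 * A + 3 * B + C1 + C2 + C3 + E1 + E2 + E3 = 6 * k"
    and 2: "2 dvd (B + E1 + E2 + E3)" and 3: "3 dvd (2 * k + A + B + 2 * C2 + C3 + 2 * E1 + E3)"
    using ns[unfolded solutions14_def mem_Collect_eq] by blast
  obtain p' where p': "B + E1 + E2 + E3 = 2 * p'" using 2 by (elim dvdE)
  obtain r' where r': "2 * k + A + B + 2 * C2 + C3 + 2 * E1 + E3 = 3 * r'" using 3 by (elim dvdE)
  define p r where "p = int p'" and "r = int r'"
  have p: "int B + int E1 + int E2 + int E3 = 2 * p" unfolding p_def using p' by linarith
  have r: "2 * int k + int A + int B + 2 * int C2 + int C3 + 2 * int E1 + int E3 = 3 * r" unfolding r_def using r' by linarith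
  have t: "3 * int A + 3 * int B + int C1 + int C2 + int C3 + int E1 + int E2 + int E3 = 6 * int k" using 1 by linarith
  \<comment> \<open>the solution of the linear equations, made integral by means of the quotients in the congruences\<close>
  define f :: "nat \<Rightarrow> int" where "f = (\<lambda>j\<in>{1..7}. [4 * int A + int B + int C1 + int C2 + 2 * int E1 + int E2 + int E3 - 2 * int k - p - r,
      3 * int A + 3 * int B + int C2 + 2 * int C3 + 2 * int E1 + int E3 - int k - 2 * r,
      5 * int A + 2 * int B + 2 * int C2 + int C3 + 2 * int E1 + int E2 + 2 * int E3 - 4 * int k - p - r,
      4 * int A + 4 * int B + 3 * int C2 + int C3 + 2 * int E1 + int E2 + int E3 - 3 * int k - 2 * r,
      3 * int A + int C3 + int E1 + int E2 + int E3 - p - r,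
      2 * int A + 2 * int B + int C1 + int C2 + int E1 + int E3 + int k - 2 * r,
      3 * int A + 2 * int B + int C1 + int C2 + int C3 + int E1 + int E2 + int E3 - 4 * int k - p] ! (j - 1))"
  have f1: "f 1 = 4 * int A + int B + int C1 + int C2 + 2 * int E1 + int E2 + int E3 - 2 * int k - p - r" by (simp add: f_def eval_nat_numeral)
  have f2: "f 2 = 3 * int A + 3 * int B + int C2 + 2 * int C3 + 2 * int E1 + int E3 - int k - 2 * r" by (simp add: f_def eval_nat_numeral)
  have f3: "f 3 = 5 * int A + 2 * int B + 2 * int C2 + int C3 + 2 * int E1 + int E2 + 2 * int E3 - 4 * int k - p - r" by (simp add: f_def eval_nat_numeral)
  have f4: "f 4 = 4 * int A + 4 * int B + 3 * int C2 + int C3 + 2 * int E1 + int E2 + int E3 - 3 * int k - 2 * r" by (simp add: f_def eval_nat_numeral)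
  have f5: "f 5 = 3 * int A + int C3 + int E1 + int E2 + int E3 - p - r" by (simp add: f_def eval_nat_numeral)
  have f6: "f 6 = 2 * int A + 2 * int B + int C1 + int C2 + int E1 + int E3 + int k - 2 * r" by (simp add: f_def eval_nat_numeral)
  have f7: "f 7 = 3 * int A + 2 * int B + int C1 + int C2 + int C3 + int E1 + int E2 + int E3 - 4 * int k - p" by (simp add: f_def eval_nat_numeral)
  note fs = f1 f2 f3 f4 f5 f6 f7
  have e1: "12 * int A = int k + f 1 + f 2 + f 3 + f 4 + f 5 + f 6 + f 7" unfolding fs using p r t by algebra
  have e2: "4 * int B = 8 * int A - (f 1 + f 3 + f 5 + f 7)" unfolding fs using p r t by algebra
  have e3: "14 * int C1 = 98 * int A - (6 * f 1 + 10 * f 2 + 12 * f 3 + 12 * f 4 + 10 * f 5 + 6 * f 6)" unfolding fs using p r t by algebra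
  have e4: "14 * int C2 = 98 * int A - (10 * f 1 + 12 * f 2 + 6 * f 3 + 6 * f 4 + 12 * f 5 + 10 * f 6)" unfolding fs using p r t by algebra
  have e5: "14 * int C3 = 98 * int A - (12 * f 1 + 6 * f 2 + 10 * f 3 + 10 * f 4 + 6 * f 5 + 12 * f 6)" unfolding fs using p r t by algebra
  have e6: "28 * int E1 = 392 * int A - (13 * f 1 + 24 * f 2 + 33 * f 3 + 40 * f 4 + 45 * f 5 + 48 * f 6 + 49 * f 7)" unfolding fs using p r t by algebra
  have e7: "28 * int E2 = 392 * int A - (33 * f 1 + 48 * f 2 + 45 * f 3 + 24 * f 4 + 13 * f 5 + 40 * f 6 + 49 * f 7)" unfolding fs using p r t by algebra
  have e8: "28 * int E3 = 392 * int A - (45 * f 1 + 40 * f 2 + 13 * f 3 + 48 * f 4 + 33 * f 5 + 24 * f 6 + 49 * f 7)" unfolding fs using p r t by algebra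
  have rel: "order_relation14 k ns f" unfolding order_relation14_def ns'
    by (rule exI[of _ A], rule exI[of _ B], rule exI[of _ C1], rule exI[of _ C2], rule exI[of _ C3], rule exI[of _ E1], rule exI[of _ E2], rule exI[of _ E3], rule conjI[OF refl], unfold orders14_def)
      (intro conjI e1 e2 e3 e4 e5 e6 e7 e8)
  have "f 1 + 2 * f 2 + 3 * f 3 + 4 * f 4 + 5 * f 5 + 6 * f 6 + 7 * f 7 = 2 * (45 * int A + 28 * int B + 7 * int C1 + 18 * int C2 + 12 * int C3 + 20 * int E1 + 10 * int E2 + 16 * int E3 - 24 * int k - 8 * p - 18 * r)" unfolding fs using p r t by algebra
  hence c1: "2 dvd (f 1 + 2 * f 2 + 3 * f 3 + 4 * f 4 + 5 * f 5 + 6 * f 6 + 7 * f 7)" by simp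
  have "f 1 + 4 * f 2 + 9 * f 3 + 16 * f 4 + 25 * f 5 + 36 * f 6 + 49 * f 7 = 28 * (18 * int A + 13 * int B + 4 * int C1 + 7 * int C2 + 5 * int C3 + 8 * int E1 + 5 * int E2 + 7 * int E3 - 14 * int k - 4 * p - 6 * r)" unfolding fs using p r t by algebra
  hence c2: "28 dvd (f 1 + 4 * f 2 + 9 * f 3 + 16 * f 4 + 25 * f 5 + 36 * f 6 + 49 * f 7)" by simp
  have cong: "2 dvd (f 1 + 2 * f 2 + 3 * f 3 + 4 * f 4 + 5 * f 5 + 6 * f 6 + 7 * f 7) \<and> 28 dvd (f 1 + 4 * f 2 + 9 * f 3 + 16 * f 4 + 25 * f 5 + 36 * f 6 + 49 * f 7)" using c1 c2 by blast
  have O: "cusp_order 14 (int A) f (gcd (int 14) c) a \<in> \<nat>" if det: "a * d - b * c = 1" for a b c d :: int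
  proof -
    define e where "e = gcd (int 14) c"
    have cop: "coprime a e" unfolding e_def by (rule coprime_gcd_of_det[OF det])
    have "e dvd int 14" by (simp add: e_def)
    moreover have "e > 0" by (simp add: e_def)
    ultimately have "e \<in> {1, 2, 7, 14}" by (rule divisors_14)
    then consider "e = 1" | "e = 2" | "e = 7" | "e = 14" by blast
    then obtain n :: nat where "2 * e * e * int A - weight_sum e a f = 2 * int n"
    proof cases
      case 1
      have "2 * e * e * int A - weight_sum e a f = 2 * int A" unfolding 1 by (simp add: weight_sum_def)
      thus ?thesis by (rule that)
    next
      case 2
      have "(a mod 2 = 1 \<or> (- a) mod 2 = 1)"
        using coprime_imp_mod_2[of a] cop unfolding 2 by blast
      then consider "a mod 2 = 1 \<or> (- a) mod 2 = 1" by blast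
      thus ?thesis
      proof cases
        case 1
        have "weight_sum 2 a f = weight_sum 2 1 f" by (rule weight_sum_cong) (use 1 in simp)
        hence "2 * e * e * int A - weight_sum e a f = 2 * int (2 * B)"
          unfolding \<open>e = 2\<close> weight_sum_14 using e2 by simp
        thus ?thesis by (rule that)
      qed
    next
      case 3
      have "(a mod 7 = 1 \<or> (- a) mod 7 = 1) \<or> (a mod 7 = 2 \<or> (- a) mod 7 = 2) \<or> (a mod 7 = 3 \<or> (- a) mod 7 = 3)"
        using coprime_imp_mod_7[of a] cop unfolding 3 by blast
      then consider "a mod 7 = 1 \<or> (- a) mod 7 = 1" | "a mod 7 = 2 \<or> (- a) mod 7 = 2" | "a mod 7 = 3 \<or> (- a) mod 7 = 3" by blast
      thus ?thesis
      proof cases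
        case 1
        have "weight_sum 7 a f = weight_sum 7 1 f" by (rule weight_sum_cong) (use 1 in simp)
        hence "2 * e * e * int A - weight_sum e a f = 2 * int (7 * C1)"
          unfolding \<open>e = 7\<close> weight_sum_14 using e3 by simp
        thus ?thesis by (rule that)
      next
        case 2
        have "weight_sum 7 a f = weight_sum 7 2 f" by (rule weight_sum_cong) (use 2 in simp)
        hence "2 * e * e * int A - weight_sum e a f = 2 * int (7 * C2)"
          unfolding \<open>e = 7\<close> weight_sum_14 using e4 by simp
        thus ?thesis by (rule that)
      next
        case 3
        have "weight_sum 7 a f = weight_sum 7 3 f" by (rule weight_sum_cong) (use 3 in simp)
        hence "2 * e * e * int A - weight_sum e a f = 2 * int (7 * C3)"
          unfolding \<open>e = 7\<close> weight_sum_14 using e5 by simp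
        thus ?thesis by (rule that)
      qed
    next
      case 4
      have "(a mod 14 = 1 \<or> (- a) mod 14 = 1) \<or> (a mod 14 = 3 \<or> (- a) mod 14 = 3) \<or> (a mod 14 = 5 \<or> (- a) mod 14 = 5)"
        using coprime_imp_mod_14[of a] cop unfolding 4 by blast
      then consider "a mod 14 = 1 \<or> (- a) mod 14 = 1" | "a mod 14 = 3 \<or> (- a) mod 14 = 3" | "a mod 14 = 5 \<or> (- a) mod 14 = 5" by blast
      thus ?thesis
      proof cases
        case 1
        have "weight_sum 14 a f = weight_sum 14 1 f" by (rule weight_sum_cong) (use 1 in simp)
        hence "2 * e * e * int A - weight_sum e a f = 2 * int (14 * E1)"
          unfolding \<open>e = 14\<close> weight_sum_14 using e6 by simp
        thus ?thesis by (rule that)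
      next
        case 2
        have "weight_sum 14 a f = weight_sum 14 3 f" by (rule weight_sum_cong) (use 2 in simp)
        hence "2 * e * e * int A - weight_sum e a f = 2 * int (14 * E2)"
          unfolding \<open>e = 14\<close> weight_sum_14 using e7 by simp
        thus ?thesis by (rule that)
      next
        case 3
        have "weight_sum 14 a f = weight_sum 14 5 f" by (rule weight_sum_cong) (use 3 in simp)
        hence "2 * e * e * int A - weight_sum e a f = 2 * int (14 * E3)"
          unfolding \<open>e = 14\<close> weight_sum_14 using e8 by simp
        thus ?thesis by (rule that)
      qed
    qed
    thus ?thesis unfolding e_def[symmetric] using cusp_order_Nats_iff[of 14 "int A" f e a] by auto
  qed
  have D: "int k + (\<Sum>j=1..14 div 2. f j) = 12 * int A" using e1 by (simp add: sum_1_7)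
  have "modular_form_Gamma1 k 14 (theta_quotient 14 (2 * k) f)"
  proof (rule modular_form_theta_quotient_iff[THEN iffD2])
    show "\<exists>D. int k + (\<Sum>j=1..14 div 2. f j) = 12 * D \<and>
      (\<forall>u b c v. (1 + int 14 * u) * (1 + int 14 * v) - b * (int 14 * c) = 1 \<longrightarrow> ee (Gamma1_exponent 14 f u b) = 1) \<and>
      (\<forall>a b c d. a * d - b * c = 1 \<longrightarrow> cusp_order 14 D f (gcd (int 14) c) a \<in> \<nat>)"
      by (rule exI[of _ "int A"], rule conjI[OF D conjI], rule Gamma1_trivial_iff_14[THEN iffD2, OF cong])
        (intro allI impI, rule O)
  qed simp
  moreover have "f \<in> {1..14 div 2} \<rightarrow>\<^sub>E UNIV" by (simp add: f_def)
  ultimately have "f \<in> L 14 k" by (simp add: L_def)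
  with rel show ?thesis by (rule that)
qed

lemma order_relation14_unique:
  assumes "order_relation14 k ns f" "order_relation14 k ns g" "j \<in> {1..7}"
  shows "f j = g j"
proof -
  obtain A B C1 C2 C3 E1 E2 E3 where ns: "ns = [A, B, C1, C2, C3, E1, E2, E3]" and f: "orders14 k A B C1 C2 C3 E1 E2 E3 f"
    using assms(1)[unfolded order_relation14_def] by blast
  obtain A' B' C1' C2' C3' E1' E2' E3' where ns': "ns = [A', B', C1', C2', C3', E1', E2', E3']" and g: "orders14 k A' B' C1' C2' C3' E1' E2' E3' g"
    using assms(2)[unfolded order_relation14_def] by blast
  have eq: "A' = A" "B' = B" "C1' = C1" "C2' = C2" "C3' = C3" "E1' = E1" "E2' = E2" "E3' = E3" using ns ns' by simp_all
  note fs = order_equations14(2-8)[OF f] and gs = order_equations14(2-8)[OF g[unfolded eq]]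
  have j1: "f 1 = g 1" using fs(1) gs(1) by linarith
  have j2: "f 2 = g 2" using fs(2) gs(2) by linarith
  have j3: "f 3 = g 3" using fs(3) gs(3) by linarith
  have j4: "f 4 = g 4" using fs(4) gs(4) by linarith
  have j5: "f 5 = g 5" using fs(5) gs(5) by linarith
  have j6: "f 6 = g 6" using fs(6) gs(6) by linarith
  have j7: "f 7 = g 7" using fs(7) gs(7) by linarith
  have "j = 1 \<or> j = 2 \<or> j = 3 \<or> j = 4 \<or> j = 5 \<or> j = 6 \<or> j = 7" using assms(3) by auto
  thus ?thesis using j1 j2 j3 j4 j5 j6 j7 by blast
qed

lemma order_relation14_unique':
  assumes "order_relation14 k ns f" "order_relation14 k ms f"
  shows "ns = ms"
proof -
  obtain A B C1 C2 C3 E1 E2 E3 where ns: "ns = [A, B, C1, C2, C3, E1, E2, E3]" and f: "orders14 k A B C1 C2 C3 E1 E2 E3 f"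
    using assms(1)[unfolded order_relation14_def] by blast
  obtain A' B' C1' C2' C3' E1' E2' E3' where ms: "ms = [A', B', C1', C2', C3', E1', E2', E3']" and g: "orders14 k A' B' C1' C2' C3' E1' E2' E3' f"
    using assms(2)[unfolded order_relation14_def] by blast
  have a: "A = A'" using f[unfolded orders14_def, THEN conjunct1] g[unfolded orders14_def, THEN conjunct1] by linarith
  note f' = f[unfolded orders14_def, THEN conjunct2] and g' = g[unfolded orders14_def, folded a, THEN conjunct2]
  have v1: "B = B'" using f'[THEN conjunct1] g'[THEN conjunct1] by linarith
  have v2: "C1 = C1'" using f'[THEN conjunct2, THEN conjunct1] g'[THEN conjunct2, THEN conjunct1] by linarith
  have v3: "C2 = C2'" using f'[THEN conjunct2, THEN conjunct2, THEN conjunct1] g'[THEN conjunct2, THEN conjunct2, THEN conjunct1] by linarith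
  have v4: "C3 = C3'" using f'[THEN conjunct2, THEN conjunct2, THEN conjunct2, THEN conjunct1] g'[THEN conjunct2, THEN conjunct2, THEN conjunct2, THEN conjunct1] by linarith
  have v5: "E1 = E1'" using f'[THEN conjunct2, THEN conjunct2, THEN conjunct2, THEN conjunct2, THEN conjunct1] g'[THEN conjunct2, THEN conjunct2, THEN conjunct2, THEN conjunct2, THEN conjunct1] by linarith
  have v6: "E2 = E2'" using f'[THEN conjunct2, THEN conjunct2, THEN conjunct2, THEN conjunct2, THEN conjunct2, THEN conjunct1] g'[THEN conjunct2, THEN conjunct2, THEN conjunct2, THEN conjunct2, THEN conjunct2, THEN conjunct1] by linarith
  have v7: "E3 = E3'" using f'[THEN conjunct2, THEN conjunct2, THEN conjunct2, THEN conjunct2, THEN conjunct2, THEN conjunct2] g'[THEN conjunct2, THEN conjunct2, THEN conjunct2, THEN conjunct2, THEN conjunct2, THEN conjunct2] by linarith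
  show ?thesis unfolding ns ms a v1 v2 v3 v4 v5 v6 v7 ..
qed

theorem card_L14: "finite (L 14 k) \<and> card (L 14 k) = card (solutions14 k)"
proof (rule card_eq_of_relation[where R = "order_relation14 k"])
  show "finite (solutions14 k)" by (rule card_solutions14)
  show "\<exists>f\<in>L 14 k. order_relation14 k ns f" if "ns \<in> solutions14 k" for ns
    using solutions14_imp_mem_L[OF that] by metis
  show "\<exists>ns\<in>solutions14 k. order_relation14 k ns f" if "f \<in> L 14 k" for f
    using mem_L14_imp[OF that] by metis
  show "f = g" if "f \<in> L 14 k" "g \<in> L 14 k" "order_relation14 k ns f" "order_relation14 k ns g" for ns f g
  proof (rule PiE_ext)
    show "f \<in> {1..7} \<rightarrow>\<^sub>E UNIV" "g \<in> {1..7} \<rightarrow>\<^sub>E UNIV" using that by (simp_all add: L_def)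
    show "f j = g j" if "j \<in> {1..7}" for j
      by (rule order_relation14_unique[OF _ _ that]) fact+
  qed
  show "ns = ms" if "order_relation14 k ns f" "order_relation14 k ms f" for ns ms f
    by (rule order_relation14_unique'[OF that])
qed

section \<open>The exponents of level 15\<close>

text \<open>The numbers \<open>A\<close>, \<open>B\<close>, \<open>C1\<close>, \<open>C2\<close>, \<open>E1\<close>,
  \<open>E2\<close>, \<open>E3\<close>, \<open>E4\<close> are the orders of the theta quotient with exponents
  \<open>f\<close> at the eight classes of cusps \<open>a/c\<close>, in local parameters. The classes are given by
  \<open>(gcd 15 c, a mod gcd 15 c)\<close> up to the sign of \<open>a\<close>; in the order of the arguments they are
  \<open>(1, 0)\<close>, \<open>(3, 1)\<close>, \<open>(5, 1)\<close>, \<open>(5, 2)\<close>, \<open>(15, 1)\<close>,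
  \<open>(15, 2)\<close>, \<open>(15, 4)\<close>, \<open>(15, 7)\<close>.\<close>

definition orders15 :: "nat \<Rightarrow> nat \<Rightarrow> nat \<Rightarrow> nat \<Rightarrow> nat \<Rightarrow> nat \<Rightarrow> nat \<Rightarrow> nat \<Rightarrow> nat \<Rightarrow> (nat \<Rightarrow> int) \<Rightarrow> bool" where
  "orders15 k A B C1 C2 E1 E2 E3 E4 f \<longleftrightarrow>
     12 * int A = int k + f 1 + f 2 + f 3 + f 4 + f 5 + f 6 + f 7 \<and>
     6 * int B = 18 * int A - (2 * f 1 + 2 * f 2 + 2 * f 4 + 2 * f 5 + 2 * f 7) \<and>
     10 * int C1 = 50 * int A - (4 * f 1 + 6 * f 2 + 6 * f 3 + 4 * f 4 + 4 * f 6 + 6 * f 7) \<and>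
     10 * int C2 = 50 * int A - (6 * f 1 + 4 * f 2 + 4 * f 3 + 6 * f 4 + 6 * f 6 + 4 * f 7) \<and>
     30 * int E1 = 450 * int A - (14 * f 1 + 26 * f 2 + 36 * f 3 + 44 * f 4 + 50 * f 5 + 54 * f 6 + 56 * f 7) \<and>
     30 * int E2 = 450 * int A - (26 * f 1 + 44 * f 2 + 54 * f 3 + 56 * f 4 + 50 * f 5 + 36 * f 6 + 14 * f 7) \<and>
     30 * int E3 = 450 * int A - (44 * f 1 + 56 * f 2 + 36 * f 3 + 14 * f 4 + 50 * f 5 + 54 * f 6 + 26 * f 7) \<and>
     30 * int E4 = 450 * int A - (56 * f 1 + 14 * f 2 + 54 * f 3 + 26 * f 4 + 50 * f 5 + 36 * f 6 + 44 * f 7)"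

definition order_relation15 :: "nat \<Rightarrow> nat list \<Rightarrow> (nat \<Rightarrow> int) \<Rightarrow> bool" where
  "order_relation15 k ns f \<longleftrightarrow> (\<exists>A B C1 C2 E1 E2 E3 E4. ns = [A, B, C1, C2, E1, E2, E3, E4] \<and> orders15 k A B C1 C2 E1 E2 E3 E4 f)"

lemma weight_sum_15:
  shows "weight_sum 1 0 f = 0"
    "weight_sum 3 1 f = 2 * f 1 + 2 * f 2 + 2 * f 4 + 2 * f 5 + 2 * f 7"
    "weight_sum 5 1 f = 4 * f 1 + 6 * f 2 + 6 * f 3 + 4 * f 4 + 4 * f 6 + 6 * f 7"
    "weight_sum 5 2 f = 6 * f 1 + 4 * f 2 + 4 * f 3 + 6 * f 4 + 6 * f 6 + 4 * f 7"
    "weight_sum 15 1 f = 14 * f 1 + 26 * f 2 + 36 * f 3 + 44 * f 4 + 50 * f 5 + 54 * f 6 + 56 * f 7"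
    "weight_sum 15 2 f = 26 * f 1 + 44 * f 2 + 54 * f 3 + 56 * f 4 + 50 * f 5 + 36 * f 6 + 14 * f 7"
    "weight_sum 15 4 f = 44 * f 1 + 56 * f 2 + 36 * f 3 + 14 * f 4 + 50 * f 5 + 54 * f 6 + 26 * f 7"
    "weight_sum 15 7 f = 56 * f 1 + 14 * f 2 + 54 * f 3 + 26 * f 4 + 50 * f 5 + 36 * f 6 + 44 * f 7"
  by (simp_all add: weight_sum_def sum_1_7)

text \<open>The system of the eight equations is solved for the weight and the exponents.\<close>

lemma order_equations15:
  assumes "orders15 k A B C1 C2 E1 E2 E3 E4 f"
  shows "4 * int A + 4 * int B + 2 * int C1 + 2 * int C2 + int E1 + int E2 + int E3 + int E4 = 8 * int k"
    "32 * f 1 = 60 * int A - 20 * int B + 18 * int C1 - 30 * int C2 + 13 * int E1 + 5 * int E2 - 3 * int E3 - 11 * int E4"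
    "32 * f 2 = 60 * int A - 20 * int B - 30 * int C1 + 18 * int C2 + 5 * int E1 - 3 * int E2 - 11 * int E3 + 13 * int E4"
    "32 * f 3 = 40 * int A + 40 * int B - 36 * int C1 + 28 * int C2 + 6 * int E1 - 10 * int E2 + 6 * int E3 - 10 * int E4"
    "32 * f 4 = 60 * int A - 20 * int B + 18 * int C1 - 30 * int C2 - 3 * int E1 - 11 * int E2 + 13 * int E3 + 5 * int E4"
    "32 * f 5 = 48 * int A - 16 * int B + 24 * int C1 + 24 * int C2 - 4 * int E1 - 4 * int E2 - 4 * int E3 - 4 * int E4"
    "32 * f 6 = 40 * int A + 40 * int B + 28 * int C1 - 36 * int C2 - 10 * int E1 + 6 * int E2 - 10 * int E3 + 6 * int E4"
    "32 * f 7 = 60 * int A - 20 * int B - 30 * int C1 + 18 * int C2 - 11 * int E1 + 13 * int E2 + 5 * int E3 - 3 * int E4"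
proof -
  from assms have eqs: "12 * int A = int k + f 1 + f 2 + f 3 + f 4 + f 5 + f 6 + f 7"
    "6 * int B = 18 * int A - (2 * f 1 + 2 * f 2 + 2 * f 4 + 2 * f 5 + 2 * f 7)"
    "10 * int C1 = 50 * int A - (4 * f 1 + 6 * f 2 + 6 * f 3 + 4 * f 4 + 4 * f 6 + 6 * f 7)"
    "10 * int C2 = 50 * int A - (6 * f 1 + 4 * f 2 + 4 * f 3 + 6 * f 4 + 6 * f 6 + 4 * f 7)"
    "30 * int E1 = 450 * int A - (14 * f 1 + 26 * f 2 + 36 * f 3 + 44 * f 4 + 50 * f 5 + 54 * f 6 + 56 * f 7)"
    "30 * int E2 = 450 * int A - (26 * f 1 + 44 * f 2 + 54 * f 3 + 56 * f 4 + 50 * f 5 + 36 * f 6 + 14 * f 7)"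
    "30 * int E3 = 450 * int A - (44 * f 1 + 56 * f 2 + 36 * f 3 + 14 * f 4 + 50 * f 5 + 54 * f 6 + 26 * f 7)"
    "30 * int E4 = 450 * int A - (56 * f 1 + 14 * f 2 + 54 * f 3 + 26 * f 4 + 50 * f 5 + 36 * f 6 + 44 * f 7)"
    unfolding orders15_def by simp_all
  show "4 * int A + 4 * int B + 2 * int C1 + 2 * int C2 + int E1 + int E2 + int E3 + int E4 = 8 * int k" using eqs by algebra
  show "32 * f 1 = 60 * int A - 20 * int B + 18 * int C1 - 30 * int C2 + 13 * int E1 + 5 * int E2 - 3 * int E3 - 11 * int E4" using eqs by algebra
  show "32 * f 2 = 60 * int A - 20 * int B - 30 * int C1 + 18 * int C2 + 5 * int E1 - 3 * int E2 - 11 * int E3 + 13 * int E4" using eqs by algebra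
  show "32 * f 3 = 40 * int A + 40 * int B - 36 * int C1 + 28 * int C2 + 6 * int E1 - 10 * int E2 + 6 * int E3 - 10 * int E4" using eqs by algebra
  show "32 * f 4 = 60 * int A - 20 * int B + 18 * int C1 - 30 * int C2 - 3 * int E1 - 11 * int E2 + 13 * int E3 + 5 * int E4" using eqs by algebra
  show "32 * f 5 = 48 * int A - 16 * int B + 24 * int C1 + 24 * int C2 - 4 * int E1 - 4 * int E2 - 4 * int E3 - 4 * int E4" using eqs by algebra
  show "32 * f 6 = 40 * int A + 40 * int B + 28 * int C1 - 36 * int C2 - 10 * int E1 + 6 * int E2 - 10 * int E3 + 6 * int E4" using eqs by algebra
  show "32 * f 7 = 60 * int A - 20 * int B - 30 * int C1 + 18 * int C2 - 11 * int E1 + 13 * int E2 + 5 * int E3 - 3 * int E4" using eqs by algebra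
qed

text \<open>The orders of a modular form are natural numbers; that they are integral in the local parameters is a consequence of
  the triviality of the character. Their congruences follow from the integrality of the exponents.\<close>

lemma mem_L15_imp:
  assumes f: "f \<in> L 15 k"
  obtains ns where "order_relation15 k ns f" "ns \<in> solutions15 k"
proof -
  have "modular_form_Gamma1 k 15 (theta_quotient 15 (2 * k) f)" using f by (simp add: L_def)
  from modular_form_theta_quotient_iff[THEN iffD1, OF zero_less_numeral this]
  obtain D where D: "int k + (\<Sum>j=1..15 div 2. f j) = 12 * D"
    and G: "\<forall>u b c v. (1 + int 15 * u) * (1 + int 15 * v) - b * (int 15 * c) = 1 \<longrightarrow> ee (Gamma1_exponent 15 f u b) = 1"
    and O: "\<forall>a b c d. a * d - b * c = 1 \<longrightarrow> cusp_order 15 D f (gcd (int 15) c) a \<in> \<nat>"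
    by (elim exE conjE) (rule that)
  have D': "int k + f 1 + f 2 + f 3 + f 4 + f 5 + f 6 + f 7 = 12 * D" using D by (simp add: sum_1_7)
  have cong: "15 dvd (f 1 + 4 * f 2 + 9 * f 3 + 16 * f 4 + 25 * f 5 + 36 * f 6 + 49 * f 7)"
    by (rule Gamma1_trivial_iff_15[THEN iffD1, OF G])
  obtain Q where Q: "f 1 + 4 * f 2 + 9 * f 3 + 16 * f 4 + 25 * f 5 + 36 * f 6 + 49 * f 7 = 15 * Q" using cong by (elim dvdE)
  obtain A where A: "D = int A"
  proof -
    have "cusp_order 15 D f (gcd (int 15) 1) 0 \<in> \<nat>" by (rule O[rule_format, of 0 0 "- 1" 1]) simp
    then obtain n where "2 * 1 * 1 * D - weight_sum 1 0 f = 2 * int n"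
      using cusp_order_Nats_iff[of 15 D f 1 0] by auto
    thus ?thesis using that[of n] by (simp add: weight_sum_15)
  qed
  \<comment> \<open>The congruence makes the weighted sums divisible, so that the orders in the local parameters are integral.\<close>
  have w: "weight_sum 3 1 f = 3 * (- (5 * Q) + (f 1 + 2 * f 2 + 3 * f 3 + 6 * f 4 + 9 * f 5 + 12 * f 6 + 17 * f 7))" unfolding weight_sum_15 using Q by algebra
  have "\<exists>n::nat. 2 * 3 * int n = 2 * 3 * 3 * D - weight_sum 3 1 f"
    by (rule cusp_coordinate_exists[OF O _ _ _ _ w, of 1 0]) simp_all
  then obtain B where B: "6 * int B = 18 * D - (2 * f 1 + 2 * f 2 + 2 * f 4 + 2 * f 5 + 2 * f 7)"
    unfolding weight_sum_15 by auto
  have w: "weight_sum 5 1 f = 5 * (- (3 * Q) + (f 1 + 2 * f 2 + 3 * f 3 + 4 * f 4 + 5 * f 5 + 8 * f 6 + 11 * f 7))" unfolding weight_sum_15 using Q by algebra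
  have "\<exists>n::nat. 2 * 5 * int n = 2 * 5 * 5 * D - weight_sum 5 1 f"
    by (rule cusp_coordinate_exists[OF O _ _ _ _ w, of 1 0]) simp_all
  then obtain C1 where C1: "10 * int C1 = 50 * D - (4 * f 1 + 6 * f 2 + 6 * f 3 + 4 * f 4 + 4 * f 6 + 6 * f 7)"
    unfolding weight_sum_15 by auto
  have w: "weight_sum 5 2 f = 5 * (- (12 * Q) + (2 * f 1 + 4 * f 2 + 8 * f 3 + 14 * f 4 + 20 * f 5 + 30 * f 6 + 40 * f 7))" unfolding weight_sum_15 using Q by algebra
  have "\<exists>n::nat. 2 * 5 * int n = 2 * 5 * 5 * D - weight_sum 5 2 f"
    by (rule cusp_coordinate_exists[OF O _ _ _ _ w, of 3 1]) simp_all
  then obtain C2 where C2: "10 * int C2 = 50 * D - (6 * f 1 + 4 * f 2 + 4 * f 3 + 6 * f 4 + 6 * f 6 + 4 * f 7)"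
    unfolding weight_sum_15 by auto
  have w: "weight_sum 15 1 f = 15 * (- (1 * Q) + (f 1 + 2 * f 2 + 3 * f 3 + 4 * f 4 + 5 * f 5 + 6 * f 6 + 7 * f 7))" unfolding weight_sum_15 using Q by algebra
  have "\<exists>n::nat. 2 * 15 * int n = 2 * 15 * 15 * D - weight_sum 15 1 f"
    by (rule cusp_coordinate_exists[OF O _ _ _ _ w, of 1 0]) simp_all
  then obtain E1 where E1: "30 * int E1 = 450 * D - (14 * f 1 + 26 * f 2 + 36 * f 3 + 44 * f 4 + 50 * f 5 + 54 * f 6 + 56 * f 7)"
    unfolding weight_sum_15 by auto
  have w: "weight_sum 15 2 f = 15 * (- (4 * Q) + (2 * f 1 + 4 * f 2 + 6 * f 3 + 8 * f 4 + 10 * f 5 + 12 * f 6 + 14 * f 7))" unfolding weight_sum_15 using Q by algebra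
  have "\<exists>n::nat. 2 * 15 * int n = 2 * 15 * 15 * D - weight_sum 15 2 f"
    by (rule cusp_coordinate_exists[OF O _ _ _ _ w, of 8 1]) simp_all
  then obtain E2 where E2: "30 * int E2 = 450 * D - (26 * f 1 + 44 * f 2 + 54 * f 3 + 56 * f 4 + 50 * f 5 + 36 * f 6 + 14 * f 7)"
    unfolding weight_sum_15 by auto
  have w: "weight_sum 15 4 f = 15 * (- (16 * Q) + (4 * f 1 + 8 * f 2 + 12 * f 3 + 18 * f 4 + 30 * f 5 + 42 * f 6 + 54 * f 7))" unfolding weight_sum_15 using Q by algebra
  have "\<exists>n::nat. 2 * 15 * int n = 2 * 15 * 15 * D - weight_sum 15 4 f"
    by (rule cusp_coordinate_exists[OF O _ _ _ _ w, of 4 1]) simp_all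
  then obtain E3 where E3: "30 * int E3 = 450 * D - (44 * f 1 + 56 * f 2 + 36 * f 3 + 14 * f 4 + 50 * f 5 + 54 * f 6 + 26 * f 7)"
    unfolding weight_sum_15 by auto
  have w: "weight_sum 15 7 f = 15 * (- (49 * Q) + (7 * f 1 + 14 * f 2 + 33 * f 3 + 54 * f 4 + 85 * f 5 + 120 * f 6 + 163 * f 7))" unfolding weight_sum_15 using Q by algebra
  have "\<exists>n::nat. 2 * 15 * int n = 2 * 15 * 15 * D - weight_sum 15 7 f"
    by (rule cusp_coordinate_exists[OF O _ _ _ _ w, of 13 6]) simp_all
  then obtain E4 where E4: "30 * int E4 = 450 * D - (56 * f 1 + 14 * f 2 + 54 * f 3 + 26 * f 4 + 50 * f 5 + 36 * f 6 + 44 * f 7)"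
    unfolding weight_sum_15 by auto
  have eA: "12 * int A = int k + f 1 + f 2 + f 3 + f 4 + f 5 + f 6 + f 7" using D' unfolding A by (rule sym)
  note eqs = eA B[unfolded A] C1[unfolded A] C2[unfolded A] E1[unfolded A] E2[unfolded A] E3[unfolded A] E4[unfolded A]
  have ords: "orders15 k A B C1 C2 E1 E2 E3 E4 f" unfolding orders15_def by (intro conjI eqs)
  have rel: "order_relation15 k [A, B, C1, C2, E1, E2, E3, E4] f"
    unfolding order_relation15_def
    by (rule exI[of _ A], rule exI[of _ B], rule exI[of _ C1], rule exI[of _ C2], rule exI[of _ E1], rule exI[of _ E2], rule exI[of _ E3], rule exI[of _ E4], rule conjI[OF refl ords])
  note tot = order_equations15(1)[OF ords]
  have "int k + int A + 3 * int B + 3 * int C1 + int C2 + 3 * int E2 + 2 * int E3 + int E4 = 4 * (f 3 - f 4 + (- 2 * int A - 4 * int B + int C1 - 3 * int C2 - int E1 + 6 * int k))"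
    using eqs by algebra
  hence "int (k + A + 3 * B + 3 * C1 + C2 + 3 * E2 + 2 * E3 + E4) = int 4 * (f 3 - f 4 + (- 2 * int A - 4 * int B + int C1 - 3 * int C2 - int E1 + 6 * int k))" by simp
  hence 2: "4 dvd (k + A + 3 * B + 3 * C1 + C2 + 3 * E2 + 2 * E3 + E4)" by (rule nat_dvd_of_int_eq)
  have 1: "4 * A + 4 * B + 2 * C1 + 2 * C2 + E1 + E2 + E3 + E4 = 8 * k" using tot by linarith
  have "[A, B, C1, C2, E1, E2, E3, E4] \<in> solutions15 k" unfolding solutions15_def mem_Collect_eq
    by (rule exI[of _ A], rule exI[of _ B], rule exI[of _ C1], rule exI[of _ C2], rule exI[of _ E1], rule exI[of _ E2], rule exI[of _ E3], rule exI[of _ E4], intro conjI refl 1 2)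
  with rel show ?thesis by (rule that)
qed

text \<open>Conversely the linear equations can be solved for integral exponents, and the criterion holds for them.\<close>

lemma solutions15_imp_mem_L:
  assumes ns: "ns \<in> solutions15 k"
  obtains f where "order_relation15 k ns f" "f \<in> L 15 k"
proof -
  obtain A B C1 C2 E1 E2 E3 E4 where ns': "ns = [A, B, C1, C2, E1, E2, E3, E4]" and 1: "4 * A + 4 * B + 2 * C1 + 2 * C2 + E1 + E2 + E3 + E4 = 8 * k"
    and 2: "4 dvd (k + A + 3 * B + 3 * C1 + C2 + 3 * E2 + 2 * E3 + E4)"
    using ns[unfolded solutions15_def mem_Collect_eq] by blast
  obtain r' where r': "k + A + 3 * B + 3 * C1 + C2 + 3 * E2 + 2 * E3 + E4 = 4 * r'" using 2 by (elim dvdE)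
  define r where "r = int r'"
  have r: "int k + int A + 3 * int B + 3 * int C1 + int C2 + 3 * int E2 + 2 * int E3 + int E4 = 4 * r" unfolding r_def using r' by linarith
  have t: "4 * int A + 4 * int B + 2 * int C1 + 2 * int C2 + int E1 + int E2 + int E3 + int E4 = 8 * int k" using 1 by linarith
  \<comment> \<open>the solution of the linear equations, made integral by means of the quotients in the congruences\<close>
  define f :: "nat \<Rightarrow> int" where "f = (\<lambda>j\<in>{1..7}. [5 * int A + 4 * int B + 4 * int C1 + int C2 + int E1 + 3 * int E2 + 2 * int E3 + int E4 - 4 * int k - 3 * r,
      6 * int A + 5 * int B + 3 * int C1 + 3 * int C2 + int E1 + 3 * int E2 + 2 * int E3 + 2 * int E4 - 6 * int k - 3 * r,
      5 * int A + 6 * int B + 2 * int C1 + 3 * int C2 + int E1 + 2 * int E2 + 2 * int E3 + int E4 - 6 * int k - 2 * r,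
      3 * int A + 2 * int B + 3 * int C1 + 2 * int E2 + 2 * int E3 + int E4 - 3 * r,
      2 * int A + int C1 + int C2 - int k,
      3 * int A + 4 * int B + 3 * int C1 + 2 * int E2 + int E3 + int E4 - 2 * int k - 2 * r,
      4 * int A + 3 * int B + 2 * int C1 + 2 * int C2 + 3 * int E2 + 2 * int E3 + int E4 - 2 * int k - 3 * r] ! (j - 1))"
  have f1: "f 1 = 5 * int A + 4 * int B + 4 * int C1 + int C2 + int E1 + 3 * int E2 + 2 * int E3 + int E4 - 4 * int k - 3 * r" by (simp add: f_def eval_nat_numeral)
  have f2: "f 2 = 6 * int A + 5 * int B + 3 * int C1 + 3 * int C2 + int E1 + 3 * int E2 + 2 * int E3 + 2 * int E4 - 6 * int k - 3 * r" by (simp add: f_def eval_nat_numeral)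
  have f3: "f 3 = 5 * int A + 6 * int B + 2 * int C1 + 3 * int C2 + int E1 + 2 * int E2 + 2 * int E3 + int E4 - 6 * int k - 2 * r" by (simp add: f_def eval_nat_numeral)
  have f4: "f 4 = 3 * int A + 2 * int B + 3 * int C1 + 2 * int E2 + 2 * int E3 + int E4 - 3 * r" by (simp add: f_def eval_nat_numeral)
  have f5: "f 5 = 2 * int A + int C1 + int C2 - int k" by (simp add: f_def eval_nat_numeral)
  have f6: "f 6 = 3 * int A + 4 * int B + 3 * int C1 + 2 * int E2 + int E3 + int E4 - 2 * int k - 2 * r" by (simp add: f_def eval_nat_numeral)
  have f7: "f 7 = 4 * int A + 3 * int B + 2 * int C1 + 2 * int C2 + 3 * int E2 + 2 * int E3 + int E4 - 2 * int k - 3 * r" by (simp add: f_def eval_nat_numeral)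
  note fs = f1 f2 f3 f4 f5 f6 f7
  have e1: "12 * int A = int k + f 1 + f 2 + f 3 + f 4 + f 5 + f 6 + f 7" unfolding fs using r t by algebra
  have e2: "6 * int B = 18 * int A - (2 * f 1 + 2 * f 2 + 2 * f 4 + 2 * f 5 + 2 * f 7)" unfolding fs using r t by algebra
  have e3: "10 * int C1 = 50 * int A - (4 * f 1 + 6 * f 2 + 6 * f 3 + 4 * f 4 + 4 * f 6 + 6 * f 7)" unfolding fs using r t by algebra
  have e4: "10 * int C2 = 50 * int A - (6 * f 1 + 4 * f 2 + 4 * f 3 + 6 * f 4 + 6 * f 6 + 4 * f 7)" unfolding fs using r t by algebra
  have e5: "30 * int E1 = 450 * int A - (14 * f 1 + 26 * f 2 + 36 * f 3 + 44 * f 4 + 50 * f 5 + 54 * f 6 + 56 * f 7)" unfolding fs using r t by algebra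
  have e6: "30 * int E2 = 450 * int A - (26 * f 1 + 44 * f 2 + 54 * f 3 + 56 * f 4 + 50 * f 5 + 36 * f 6 + 14 * f 7)" unfolding fs using r t by algebra
  have e7: "30 * int E3 = 450 * int A - (44 * f 1 + 56 * f 2 + 36 * f 3 + 14 * f 4 + 50 * f 5 + 54 * f 6 + 26 * f 7)" unfolding fs using r t by algebra
  have e8: "30 * int E4 = 450 * int A - (56 * f 1 + 14 * f 2 + 54 * f 3 + 26 * f 4 + 50 * f 5 + 36 * f 6 + 44 * f 7)" unfolding fs using r t by algebra
  have rel: "order_relation15 k ns f" unfolding order_relation15_def ns'
    by (rule exI[of _ A], rule exI[of _ B], rule exI[of _ C1], rule exI[of _ C2], rule exI[of _ E1], rule exI[of _ E2], rule exI[of _ E3], rule exI[of _ E4], rule conjI[OF refl], unfold orders15_def)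
      (intro conjI e1 e2 e3 e4 e5 e6 e7 e8)
  have "f 1 + 4 * f 2 + 9 * f 3 + 16 * f 4 + 25 * f 5 + 36 * f 6 + 49 * f 7 = 15 * (32 * int A + 27 * int B + 21 * int C1 + 11 * int C2 + int E1 + 19 * int E2 + 13 * int E3 + 8 * int E4 - 19 * int k - 20 * r)" unfolding fs using r t by algebra
  hence c2: "15 dvd (f 1 + 4 * f 2 + 9 * f 3 + 16 * f 4 + 25 * f 5 + 36 * f 6 + 49 * f 7)" by simp
  have cong: "15 dvd (f 1 + 4 * f 2 + 9 * f 3 + 16 * f 4 + 25 * f 5 + 36 * f 6 + 49 * f 7)" using c2 by blast
  have O: "cusp_order 15 (int A) f (gcd (int 15) c) a \<in> \<nat>" if det: "a * d - b * c = 1" for a b c d :: int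
  proof -
    define e where "e = gcd (int 15) c"
    have cop: "coprime a e" unfolding e_def by (rule coprime_gcd_of_det[OF det])
    have "e dvd int 15" by (simp add: e_def)
    moreover have "e > 0" by (simp add: e_def)
    ultimately have "e \<in> {1, 3, 5, 15}" by (rule divisors_15)
    then consider "e = 1" | "e = 3" | "e = 5" | "e = 15" by blast
    then obtain n :: nat where "2 * e * e * int A - weight_sum e a f = 2 * int n"
    proof cases
      case 1
      have "2 * e * e * int A - weight_sum e a f = 2 * int A" unfolding 1 by (simp add: weight_sum_def)
      thus ?thesis by (rule that)
    next
      case 2
      have "(a mod 3 = 1 \<or> (- a) mod 3 = 1)"
        using coprime_imp_mod_3[of a] cop unfolding 2 by blast
      then consider "a mod 3 = 1 \<or> (- a) mod 3 = 1" by blast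
      thus ?thesis
      proof cases
        case 1
        have "weight_sum 3 a f = weight_sum 3 1 f" by (rule weight_sum_cong) (use 1 in simp)
        hence "2 * e * e * int A - weight_sum e a f = 2 * int (3 * B)"
          unfolding \<open>e = 3\<close> weight_sum_15 using e2 by simp
        thus ?thesis by (rule that)
      qed
    next
      case 3
      have "(a mod 5 = 1 \<or> (- a) mod 5 = 1) \<or> (a mod 5 = 2 \<or> (- a) mod 5 = 2)"
        using coprime_imp_mod_5[of a] cop unfolding 3 by blast
      then consider "a mod 5 = 1 \<or> (- a) mod 5 = 1" | "a mod 5 = 2 \<or> (- a) mod 5 = 2" by blast
      thus ?thesis
      proof cases
        case 1
        have "weight_sum 5 a f = weight_sum 5 1 f" by (rule weight_sum_cong) (use 1 in simp)
        hence "2 * e * e * int A - weight_sum e a f = 2 * int (5 * C1)"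
          unfolding \<open>e = 5\<close> weight_sum_15 using e3 by simp
        thus ?thesis by (rule that)
      next
        case 2
        have "weight_sum 5 a f = weight_sum 5 2 f" by (rule weight_sum_cong) (use 2 in simp)
        hence "2 * e * e * int A - weight_sum e a f = 2 * int (5 * C2)"
          unfolding \<open>e = 5\<close> weight_sum_15 using e4 by simp
        thus ?thesis by (rule that)
      qed
    next
      case 4
      have "(a mod 15 = 1 \<or> (- a) mod 15 = 1) \<or> (a mod 15 = 2 \<or> (- a) mod 15 = 2) \<or> (a mod 15 = 4 \<or> (- a) mod 15 = 4) \<or> (a mod 15 = 7 \<or> (- a) mod 15 = 7)"
        using coprime_imp_mod_15[of a] cop unfolding 4 by blast
      then consider "a mod 15 = 1 \<or> (- a) mod 15 = 1" | "a mod 15 = 2 \<or> (- a) mod 15 = 2" | "a mod 15 = 4 \<or> (- a) mod 15 = 4" | "a mod 15 = 7 \<or> (- a) mod 15 = 7" by blast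
      thus ?thesis
      proof cases
        case 1
        have "weight_sum 15 a f = weight_sum 15 1 f" by (rule weight_sum_cong) (use 1 in simp)
        hence "2 * e * e * int A - weight_sum e a f = 2 * int (15 * E1)"
          unfolding \<open>e = 15\<close> weight_sum_15 using e5 by simp
        thus ?thesis by (rule that)
      next
        case 2
        have "weight_sum 15 a f = weight_sum 15 2 f" by (rule weight_sum_cong) (use 2 in simp)
        hence "2 * e * e * int A - weight_sum e a f = 2 * int (15 * E2)"
          unfolding \<open>e = 15\<close> weight_sum_15 using e6 by simp
        thus ?thesis by (rule that)
      next
        case 3
        have "weight_sum 15 a f = weight_sum 15 4 f" by (rule weight_sum_cong) (use 3 in simp)
        hence "2 * e * e * int A - weight_sum e a f = 2 * int (15 * E3)"
          unfolding \<open>e = 15\<close> weight_sum_15 using e7 by simp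
        thus ?thesis by (rule that)
      next
        case 4
        have "weight_sum 15 a f = weight_sum 15 7 f" by (rule weight_sum_cong) (use 4 in simp)
        hence "2 * e * e * int A - weight_sum e a f = 2 * int (15 * E4)"
          unfolding \<open>e = 15\<close> weight_sum_15 using e8 by simp
        thus ?thesis by (rule that)
      qed
    qed
    thus ?thesis unfolding e_def[symmetric] using cusp_order_Nats_iff[of 15 "int A" f e a] by auto
  qed
  have D: "int k + (\<Sum>j=1..15 div 2. f j) = 12 * int A" using e1 by (simp add: sum_1_7)
  have "modular_form_Gamma1 k 15 (theta_quotient 15 (2 * k) f)"
  proof (rule modular_form_theta_quotient_iff[THEN iffD2])
    show "\<exists>D. int k + (\<Sum>j=1..15 div 2. f j) = 12 * D \<and>
      (\<forall>u b c v. (1 + int 15 * u) * (1 + int 15 * v) - b * (int 15 * c) = 1 \<longrightarrow> ee (Gamma1_exponent 15 f u b) = 1) \<and>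
      (\<forall>a b c d. a * d - b * c = 1 \<longrightarrow> cusp_order 15 D f (gcd (int 15) c) a \<in> \<nat>)"
      by (rule exI[of _ "int A"], rule conjI[OF D conjI], rule Gamma1_trivial_iff_15[THEN iffD2, OF cong])
        (intro allI impI, rule O)
  qed simp
  moreover have "f \<in> {1..15 div 2} \<rightarrow>\<^sub>E UNIV" by (simp add: f_def)
  ultimately have "f \<in> L 15 k" by (simp add: L_def)
  with rel show ?thesis by (rule that)
qed

lemma order_relation15_unique:
  assumes "order_relation15 k ns f" "order_relation15 k ns g" "j \<in> {1..7}"
  shows "f j = g j"
proof -
  obtain A B C1 C2 E1 E2 E3 E4 where ns: "ns = [A, B, C1, C2, E1, E2, E3, E4]" and f: "orders15 k A B C1 C2 E1 E2 E3 E4 f"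
    using assms(1)[unfolded order_relation15_def] by blast
  obtain A' B' C1' C2' E1' E2' E3' E4' where ns': "ns = [A', B', C1', C2', E1', E2', E3', E4']" and g: "orders15 k A' B' C1' C2' E1' E2' E3' E4' g"
    using assms(2)[unfolded order_relation15_def] by blast
  have eq: "A' = A" "B' = B" "C1' = C1" "C2' = C2" "E1' = E1" "E2' = E2" "E3' = E3" "E4' = E4" using ns ns' by simp_all
  note fs = order_equations15(2-8)[OF f] and gs = order_equations15(2-8)[OF g[unfolded eq]]
  have j1: "f 1 = g 1" using fs(1) gs(1) by linarith
  have j2: "f 2 = g 2" using fs(2) gs(2) by linarith
  have j3: "f 3 = g 3" using fs(3) gs(3) by linarith
  have j4: "f 4 = g 4" using fs(4) gs(4) by linarith
  have j5: "f 5 = g 5" using fs(5) gs(5) by linarith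
  have j6: "f 6 = g 6" using fs(6) gs(6) by linarith
  have j7: "f 7 = g 7" using fs(7) gs(7) by linarith
  have "j = 1 \<or> j = 2 \<or> j = 3 \<or> j = 4 \<or> j = 5 \<or> j = 6 \<or> j = 7" using assms(3) by auto
  thus ?thesis using j1 j2 j3 j4 j5 j6 j7 by blast
qed

lemma order_relation15_unique':
  assumes "order_relation15 k ns f" "order_relation15 k ms f"
  shows "ns = ms"
proof -
  obtain A B C1 C2 E1 E2 E3 E4 where ns: "ns = [A, B, C1, C2, E1, E2, E3, E4]" and f: "orders15 k A B C1 C2 E1 E2 E3 E4 f"
    using assms(1)[unfolded order_relation15_def] by blast
  obtain A' B' C1' C2' E1' E2' E3' E4' where ms: "ms = [A', B', C1', C2', E1', E2', E3', E4']" and g: "orders15 k A' B' C1' C2' E1' E2' E3' E4' f"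
    using assms(2)[unfolded order_relation15_def] by blast
  have a: "A = A'" using f[unfolded orders15_def, THEN conjunct1] g[unfolded orders15_def, THEN conjunct1] by linarith
  note f' = f[unfolded orders15_def, THEN conjunct2] and g' = g[unfolded orders15_def, folded a, THEN conjunct2]
  have v1: "B = B'" using f'[THEN conjunct1] g'[THEN conjunct1] by linarith
  have v2: "C1 = C1'" using f'[THEN conjunct2, THEN conjunct1] g'[THEN conjunct2, THEN conjunct1] by linarith
  have v3: "C2 = C2'" using f'[THEN conjunct2, THEN conjunct2, THEN conjunct1] g'[THEN conjunct2, THEN conjunct2, THEN conjunct1] by linarith
  have v4: "E1 = E1'" using f'[THEN conjunct2, THEN conjunct2, THEN conjunct2, THEN conjunct1] g'[THEN conjunct2, THEN conjunct2, THEN conjunct2, THEN conjunct1] by linarith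
  have v5: "E2 = E2'" using f'[THEN conjunct2, THEN conjunct2, THEN conjunct2, THEN conjunct2, THEN conjunct1] g'[THEN conjunct2, THEN conjunct2, THEN conjunct2, THEN conjunct2, THEN conjunct1] by linarith
  have v6: "E3 = E3'" using f'[THEN conjunct2, THEN conjunct2, THEN conjunct2, THEN conjunct2, THEN conjunct2, THEN conjunct1] g'[THEN conjunct2, THEN conjunct2, THEN conjunct2, THEN conjunct2, THEN conjunct2, THEN conjunct1] by linarith
  have v7: "E4 = E4'" using f'[THEN conjunct2, THEN conjunct2, THEN conjunct2, THEN conjunct2, THEN conjunct2, THEN conjunct2] g'[THEN conjunct2, THEN conjunct2, THEN conjunct2, THEN conjunct2, THEN conjunct2, THEN conjunct2] by linarith
  show ?thesis unfolding ns ms a v1 v2 v3 v4 v5 v6 v7 ..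
qed

theorem card_L15: "finite (L 15 k) \<and> card (L 15 k) = card (solutions15 k)"
proof (rule card_eq_of_relation[where R = "order_relation15 k"])
  show "finite (solutions15 k)" by (rule card_solutions15)
  show "\<exists>f\<in>L 15 k. order_relation15 k ns f" if "ns \<in> solutions15 k" for ns
    using solutions15_imp_mem_L[OF that] by metis
  show "\<exists>ns\<in>solutions15 k. order_relation15 k ns f" if "f \<in> L 15 k" for f
    using mem_L15_imp[OF that] by metis
  show "f = g" if "f \<in> L 15 k" "g \<in> L 15 k" "order_relation15 k ns f" "order_relation15 k ns g" for ns f g
  proof (rule PiE_ext)
    show "f \<in> {1..7} \<rightarrow>\<^sub>E UNIV" "g \<in> {1..7} \<rightarrow>\<^sub>E UNIV" using that by (simp_all add: L_def)
    show "f j = g j" if "j \<in> {1..7}" for j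
      by (rule order_relation15_unique[OF _ _ that]) fact+
  qed
  show "ns = ms" if "order_relation15 k ns f" "order_relation15 k ms f" for ns ms f
    by (rule order_relation15_unique'[OF that])
qed

theorem theorem5p4:
  fixes k :: nat
  shows "(finite (L 14 k) \<and> real (card (L 14 k)) = T14 k + E14 k) \<and>
         (finite (L 15 k) \<and> real (card (L 15 k)) = T15 k + E15 k)"
  using card_L14[of k] card_L15[of k] card_solutions14(2)[of k] card_solutions15(2)[of k] by simp

end
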